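(* Assume (B1) and (B2), with $p$ and $\beta$ as in these conditions. Then for all $0\le\alpha\le\beta$ and any sequences $\{r_n\}\subset\mathbb{R}_+$ and $\{x_n\}\subset\mathsf{X}$ such that $\lim_n r_n=+\infty$ and $\lim_n x_n=x$, there exist a probability measure $\mathbb{Q}^{\alpha}_x$ on $\mathsf{C}(\mathbb{R}_+,\mathsf{X})$ and subsequences $\{r_{n_j}\}\subseteq\{r_n\}$, $\{x_{n_j}\}\subseteq\{x_n\}$ such that $\mathbb{Q}^{\alpha}_{r_{n_j};x_{n_j}}\Rightarrow\mathbb{Q}^{\alpha}_x$ (weak convergence on $\mathsf{D}(\mathbb{R}_+,\mathsf{X})$). Furthermore, for all $0\le\alpha<\beta$, the $\alpha$-fluid limits are trivial in the sense that every $\alpha$-fluid limit satisfies $\mathbb{Q}^{\alpha}_x=\delta_g$ with $g(t)\equiv x$.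
   Context: $\mathsf{X}$ is a $d$-dimensional Euclidean space with norm $|\cdot|$ and Borel $\sigma$-field $\mathcal{X}$. $\{\Phi_k\}_{k\ge0}$ is a Markov chain on $\mathsf{X}$ with transition kernel $P$ and natural filtration $\{\mathcal{F}_k\}$; $\mathbb{P}_x,\mathbb{E}_x$ denote law and expectation of the chain given $\Phi_0=x$. It is assumed that $\mathbb{E}_x|\Phi_1|<\infty$ for all $x$. Put $\Delta(x)=\mathbb{E}_x[\Phi_1]-x$ and $\epsilon_k=\Phi_k-\mathbb{E}[\Phi_k\mid\mathcal{F}_{k-1}]$, $k\ge1$. (B1) There exists $p>1$ such that $\lim_{K\to\infty}\sup_{x\in\mathsf{X}}\mathbb{E}_x\big[|\epsilon_1|^p\mathbf{1}\{|\epsilon_1|\ge K\}\big]=0$. (B2) There exists $\beta\in[0,1\wedge(p-1))$ such that $N(\beta,\Delta)=\sup_{x\in\mathsf{X}}\{(1+|x|^\beta)|\Delta(x)|\}<\infty$. $\mathsf{C}(\mathbb{R}_+,\mathsf{X})$ is the space of continuous $\mathsf{X}$-valued functions on $[0,\infty)$ (local uniform topology), $\mathsf{D}(\mathbb{R}_+,\mathsf{X})$ the space of càdlàg functions (Skorokhod topology). For $\alpha\ge0$, $r>0$, $x\in\mathsf{X}$, let $\eta^\alpha_r(t;x)=r^{-1}\Phi_{\lfloor tr^{1+\alpha}\rfloor}$ where $\Phi_0=rx$ (so $\eta^\alpha_r(0;x)=x$), and let $\mathbb{Q}^\alpha_{r;x}$ be the law on $\mathsf{D}(\mathbb{R}_+,\mathsf{X})$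 of $\eta^\alpha_r(\cdot;x)$ under $\mathbb{P}_{rx}$. A probability measure $\mathbb{Q}^\alpha_x$ on $\mathsf{D}(\mathbb{R}_+,\mathsf{X})$ is an $\alpha$-fluid limit (with initial point $x$) if there exist $r_n\to+\infty$ and $x_n\to x$ such that $\mathbb{Q}^\alpha_{r_n;x_n}\Rightarrow\mathbb{Q}^\alpha_x$. $\delta_g$ is the Dirac mass at $g$. *)

theory Defs
  imports "HOL-Probability.Probability"
begin

section \<open>Path spaces and weak convergence\<close>

definition borel_of :: "'b topology \<Rightarrow> 'b measure" where
  "borel_of T = sigma (topspace T) {U. openin T U}"

lemma space_borel_of [simp]: "space (borel_of T) = topspace T"
  unfolding borel_of_def by (simp add: space_measure_of_conv)

lemma sets_borel_of: "sets (borel_of T) = sigma_sets (topspace T) {U. openin T U}"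
  unfolding borel_of_def by (rule sets_measure_of) (auto dest!: openin_subset)

lemma measurable_borel_of:
  assumes "continuous_map S T f"
  shows "f \<in> borel_of S \<rightarrow>\<^sub>M borel_of T"
proof (rule measurable_sigma_sets[OF sets_borel_of])
  show "{U. openin T U} \<subseteq> Pow (topspace T)" by (auto dest!: openin_subset)
  show "f \<in> space (borel_of S) \<rightarrow> topspace T"
    using assms by (auto simp: continuous_map_def)
  fix U assume "U \<in> {U. openin T U}"
  then have "openin S {x \<in> topspace S. f x \<in> U}"
    using assms by (auto simp: continuous_map_def)
  moreover have "f -` U \<inter> space (borel_of S) = {x \<in> topspace S. f x \<in> U}" by auto
  ultimately show "f -` U \<inter> space (borel_of S) \<in> sets (borel_of S)"
    by (auto simp: sets_borel_of)
qed

text \<open>Weak convergence of probability measures on the Borel sets of \<^term>\<open>T\<close>.\<close>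

definition weak_conv_on :: "'b topology \<Rightarrow> (nat \<Rightarrow> 'b measure) \<Rightarrow> 'b measure \<Rightarrow> bool" where
  "weak_conv_on T \<mu> \<nu> \<longleftrightarrow>
     (\<forall>f. continuous_map T euclideanreal f \<and> bounded (f ` topspace T) \<longrightarrow>
        (\<lambda>n. \<integral>w. f w \<partial>\<mu> n) \<longlonglongrightarrow> (\<integral>w. f w \<partial>\<nu>))"

text \<open>Paths on $[0,\infty)$ are functions on the reals that are \<^const>\<open>undefined\<close> at negative times,
  so that equality of paths is equality on $[0,\infty)$.\<close>

definition C_paths :: "(real \<Rightarrow> 'a::euclidean_space) set" where
  "C_paths = {w \<in> extensional {0..}. continuous_on {0..} w}"

definition D_paths :: "(real \<Rightarrow> 'a::euclidean_space) set" where
  "D_paths = {w \<in> extensional {0..}.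
     (\<forall>t\<ge>0. continuous (at_right t) w) \<and> (\<forall>t>0. \<exists>l. (w \<longlongrightarrow> l) (at_left t))}"

definition lu_nhd :: "real \<Rightarrow> real \<Rightarrow> (real \<Rightarrow> 'a::euclidean_space) \<Rightarrow> (real \<Rightarrow> 'a) set" where
  "lu_nhd T e w = {v \<in> C_paths. \<forall>t\<in>{0..T}. dist (v t) (w t) < e}"

definition C_topology :: "(real \<Rightarrow> 'a::euclidean_space) topology" where
  "C_topology = topology (\<lambda>U. U \<subseteq> C_paths \<and> (\<forall>w\<in>U. \<exists>T>0. \<exists>e>0. lu_nhd T e w \<subseteq> U))"

text \<open>Increasing bijections of $[0,\infty)$; these are automatically continuous and fix $0$.\<close>

definition time_changes :: "(real \<Rightarrow> real) set" where
  "time_changes = {l. strict_mono_on {0..} l \<and> l ` {0..} = {0..}}"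

definition J1_nhd :: "real \<Rightarrow> real \<Rightarrow> (real \<Rightarrow> 'a::euclidean_space) \<Rightarrow> (real \<Rightarrow> 'a) set" where
  "J1_nhd T e w = {v \<in> D_paths. \<exists>l\<in>time_changes.
     (\<forall>t\<ge>0. \<bar>l t - t\<bar> < e) \<and> (\<forall>t\<in>{0..T}. dist (v (l t)) (w t) < e)}"

text \<open>The Skorokhod (J1) topology on $D([0,\infty))$. A sequence is eventually in every
  \<^term>\<open>J1_nhd T e w\<close> iff there are time changes $l_n$ with
  $\sup_{t \ge 0} |l_n(t) - t| \to 0$ and $\sup_{t \le T} |v_n(l_n(t)) - w(t)| \to 0$ for all $T$,
  the usual criterion for Skorokhod convergence (Jacod and Shiryaev, Theorem VI.1.14; Billingsley,
  Theorem 16.1). Since the Skorokhod topology is metrizable, its open sets are the sequentially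
  open ones, and these are the sets described here.\<close>

definition D_topology :: "(real \<Rightarrow> 'a::euclidean_space) topology" where
  "D_topology = topology (\<lambda>U. U \<subseteq> D_paths \<and> (\<forall>w\<in>U. \<exists>T>0. \<exists>e>0. J1_nhd T e w \<subseteq> U))"

lemma lu_nhd_mono: "S \<le> T \<Longrightarrow> d \<le> e \<Longrightarrow> lu_nhd T d w \<subseteq> lu_nhd S e w"
  unfolding lu_nhd_def by (auto intro: less_le_trans)

lemma J1_nhd_mono:
  assumes "S \<le> T" "d \<le> e"
  shows "J1_nhd T d w \<subseteq> J1_nhd S e w"
proof
  fix v assume "v \<in> J1_nhd T d w"
  then obtain l where l: "v \<in> D_paths" "l \<in> time_changes" "\<forall>t\<ge>0. \<bar>l t - t\<bar> < d"
    "\<forall>t\<in>{0..T}. dist (v (l t)) (w t) < d"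
    unfolding J1_nhd_def by blast
  have "\<forall>t\<ge>0. \<bar>l t - t\<bar> < e" "\<forall>t\<in>{0..S}. dist (v (l t)) (w t) < e"
    using l(3,4) assms by (auto intro: less_le_trans)
  with l(1,2) show "v \<in> J1_nhd S e w"
    unfolding J1_nhd_def by blast
qed

lemma istopology_nhd:
  fixes B :: "real \<Rightarrow> real \<Rightarrow> 'b \<Rightarrow> 'b set"
  assumes mono: "\<And>S T d e w. S \<le> T \<Longrightarrow> d \<le> e \<Longrightarrow> B T d w \<subseteq> B S e w"
  shows "istopology (\<lambda>U. U \<subseteq> A \<and> (\<forall>w\<in>U. \<exists>T>0. \<exists>e>0. B T e w \<subseteq> U))"
  unfolding istopology_def
proof (intro conjI allI impI ballI)
  fix U V w
  assume U: "U \<subseteq> A \<and> (\<forall>w\<in>U. \<exists>T>0. \<exists>e>0. B T e w \<subseteq> U)"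
    and V: "V \<subseteq> A \<and> (\<forall>w\<in>V. \<exists>T>0. \<exists>e>0. B T e w \<subseteq> V)"
  show "U \<inter> V \<subseteq> A" using U by blast
  assume w: "w \<in> U \<inter> V"
  obtain T e where 1: "T > 0" "e > 0" "B T e w \<subseteq> U" using U w by blast
  obtain S d where 2: "S > 0" "d > 0" "B S d w \<subseteq> V" using V w by blast
  have "B (max S T) (min d e) w \<subseteq> U \<inter> V"
    using mono[of T "max S T" "min d e" e w] mono[of S "max S T" "min d e" d w] 1 2 by auto
  moreover have "max S T > 0" "min d e > 0" using 1 2 by auto
  ultimately show "\<exists>T>0. \<exists>e>0. B T e w \<subseteq> U \<inter> V" by blast
next
  fix K assume "\<forall>U\<in>K. U \<subseteq> A \<and> (\<forall>w\<in>U. \<exists>T>0. \<exists>e>0. B T e w \<subseteq> U)"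
  then show "\<Union>K \<subseteq> A" by blast
next
  fix K w
  assume K: "\<forall>U\<in>K. U \<subseteq> A \<and> (\<forall>w\<in>U. \<exists>T>0. \<exists>e>0. B T e w \<subseteq> U)" and "w \<in> \<Union>K"
  then obtain U where U: "U \<in> K" "w \<in> U" by blast
  with K obtain T e where "T > 0" "e > 0" "B T e w \<subseteq> U" by meson
  with U show "\<exists>T>0. \<exists>e>0. B T e w \<subseteq> \<Union>K" by blast
qed

lemma openin_C_topology:
  "openin C_topology U \<longleftrightarrow> U \<subseteq> C_paths \<and> (\<forall>w\<in>U. \<exists>T>0. \<exists>e>0. lu_nhd T e w \<subseteq> U)"
  unfolding C_topology_def by (subst topology_inverse'[OF istopology_nhd[OF lu_nhd_mono]]) auto

lemma openin_D_topology:
  "openin D_topology U \<longleftrightarrow> U \<subseteq> D_paths \<and> (\<forall>w\<in>U. \<exists>T>0. \<exists>e>0. J1_nhd T e w \<subseteq> U)"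
  unfolding D_topology_def by (subst topology_inverse'[OF istopology_nhd[OF J1_nhd_mono]]) auto

lemma topspace_C_topology [simp]: "topspace C_topology = C_paths"
proof (rule antisym)
  show "topspace C_topology \<subseteq> (C_paths :: (real \<Rightarrow> 'a) set)"
    unfolding topspace_def openin_C_topology by blast
  have "openin C_topology (C_paths :: (real \<Rightarrow> 'a) set)"
    unfolding openin_C_topology lu_nhd_def by (auto intro!: exI[of _ "1::real"])
  then show "(C_paths :: (real \<Rightarrow> 'a) set) \<subseteq> topspace C_topology"
    by (rule openin_subset)
qed

lemma topspace_D_topology [simp]: "topspace D_topology = D_paths"
proof (rule antisym)
  show "topspace D_topology \<subseteq> (D_paths :: (real \<Rightarrow> 'a) set)"
    unfolding topspace_def openin_D_topology by blast
  have "openin D_topology (D_paths :: (real \<Rightarrow> 'a) set)"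
    unfolding openin_D_topology J1_nhd_def by (auto intro!: exI[of _ "1::real"])
  then show "(D_paths :: (real \<Rightarrow> 'a) set) \<subseteq> topspace D_topology"
    by (rule openin_subset)
qed

lemma C_paths_subset_D_paths: "C_paths \<subseteq> D_paths"
proof
  fix w :: "real \<Rightarrow> 'a" assume w: "w \<in> C_paths"
  then have lim: "(w \<longlongrightarrow> w t) (at t within {0..})" if "t \<ge> 0" for t
    using that unfolding C_paths_def continuous_on_def by auto
  have "continuous (at_right t) w" if "t \<ge> 0" for t
    unfolding continuous_within
    by (rule tendsto_within_subset[OF lim[OF that]]) (use that in auto)
  moreover have "(w \<longlongrightarrow> w t) (at_left t)" if "t > 0" for t
  proof -
    have "at t within {0..} = at t"
      using that by (intro at_within_interior) auto
    then show ?thesis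
      using lim[of t] that filterlim_at_split[of w "nhds (w t)" t] by simp
  qed
  ultimately show "w \<in> D_paths"
    using w unfolding C_paths_def D_paths_def by blast
qed

lemma lu_nhd_subset_J1_nhd: "e > 0 \<Longrightarrow> lu_nhd T e w \<subseteq> J1_nhd T e w"
proof
  fix v assume e: "e > 0" and v: "v \<in> lu_nhd T e w"
  have l: "(\<lambda>t. t) \<in> time_changes"
    unfolding time_changes_def by (simp add: strict_mono_on_def)
  have "v \<in> D_paths" "\<forall>t\<in>{0..T}. dist (v t) (w t) < e"
    using v C_paths_subset_D_paths unfolding lu_nhd_def by auto
  with e show "v \<in> J1_nhd T e w"
    unfolding J1_nhd_def by (intro CollectI conjI bexI[OF _ l]) simp_all
qed

lemma continuous_map_C_D: "continuous_map C_topology D_topology (\<lambda>w. w)"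
  unfolding continuous_map_def
proof (intro conjI allI impI)
  show "(\<lambda>w. w) \<in> topspace C_topology \<rightarrow> (topspace D_topology :: (real \<Rightarrow> 'a) set)"
    using C_paths_subset_D_paths by auto
  fix U :: "(real \<Rightarrow> 'a) set" assume U: "openin D_topology U"
  show "openin C_topology {w \<in> topspace C_topology. w \<in> U}"
    unfolding openin_C_topology topspace_C_topology
  proof (intro conjI ballI)
    fix w assume "w \<in> {w \<in> C_paths. w \<in> U}"
    with U obtain T e where Te: "T > 0" "e > 0" "J1_nhd T e w \<subseteq> U"
      unfolding openin_D_topology by blast
    have "lu_nhd T e w \<subseteq> C_paths" unfolding lu_nhd_def by blast
    with Te lu_nhd_subset_J1_nhd[of e T w] have "lu_nhd T e w \<subseteq> {w \<in> C_paths. w \<in> U}" by blast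
    with Te show "\<exists>T>0. \<exists>e>0. lu_nhd T e w \<subseteq> {w \<in> C_paths. w \<in> U}" by blast
  qed blast
qed

lemma measurable_C_D: "(\<lambda>w. w) \<in> borel_of C_topology \<rightarrow>\<^sub>M borel_of D_topology"
  using continuous_map_C_D by (rule measurable_borel_of)

section \<open>Markov chains\<close>

definition natural_filtration ::
    "'w measure \<Rightarrow> (nat \<Rightarrow> 'w \<Rightarrow> 'a::euclidean_space) \<Rightarrow> nat \<Rightarrow> 'w measure" where
  "natural_filtration \<Omega> \<Phi> k =
     sigma (space \<Omega>) {\<Phi> i -` A \<inter> space \<Omega> | i A. i \<le> k \<and> A \<in> sets borel}"

text \<open>Here \<^term>\<open>\<Omega>\<close> only serves as a measurable space, and \<^term>\<open>PP x\<close> is the law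
  $\mathbf{P}_x$ on it, under which \<^term>\<open>\<Phi>\<close> is a Markov chain with kernel \<^term>\<open>P\<close>
  started at \<^term>\<open>x\<close>.\<close>

definition markov_chain ::
    "('a::euclidean_space \<Rightarrow> 'a measure) \<Rightarrow> 'w measure \<Rightarrow> ('a \<Rightarrow> 'w measure) \<Rightarrow> (nat \<Rightarrow> 'w \<Rightarrow> 'a) \<Rightarrow> bool"
where
  "markov_chain P \<Omega> PP \<Phi> \<longleftrightarrow>
     P \<in> borel \<rightarrow>\<^sub>M prob_algebra borel \<and>
     (\<forall>k. \<Phi> k \<in> \<Omega> \<rightarrow>\<^sub>M borel) \<and>
     (\<forall>x. prob_space (PP x) \<and> sets (PP x) = sets \<Omega>) \<and>
     (\<forall>x. AE \<omega> in PP x. \<Phi> 0 \<omega> = x) \<and>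
     (\<forall>x k. \<forall>A\<in>sets borel. AE \<omega> in PP x.
        real_cond_exp (PP x) (natural_filtration \<Omega> \<Phi> k) (\<lambda>\<omega>'. indicator A (\<Phi> (Suc k) \<omega>')) \<omega>
          = measure (P (\<Phi> k \<omega>)) A)"

text \<open>Conditional expectation of a vector-valued random variable, taken coordinatewise.\<close>

definition vec_cond_exp ::
    "'w measure \<Rightarrow> 'w measure \<Rightarrow> ('w \<Rightarrow> 'a::euclidean_space) \<Rightarrow> 'w \<Rightarrow> 'a" where
  "vec_cond_exp M F f \<omega> = (\<Sum>b\<in>Basis. real_cond_exp M F (\<lambda>\<omega>'. f \<omega>' \<bullet> b) \<omega> *\<^sub>R b)"

definition drift :: "('a::euclidean_space \<Rightarrow> 'w measure) \<Rightarrow> (nat \<Rightarrow> 'w \<Rightarrow> 'a) \<Rightarrow> 'a \<Rightarrow> 'a" where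
  "drift PP \<Phi> x = (\<integral>\<omega>. \<Phi> 1 \<omega> \<partial>PP x) - x"

text \<open>The variable $\epsilon_k$, for $k \ge 1$, under $\mathbf{P}_x$.\<close>

definition noise ::
    "'w measure \<Rightarrow> ('a::euclidean_space \<Rightarrow> 'w measure) \<Rightarrow> (nat \<Rightarrow> 'w \<Rightarrow> 'a) \<Rightarrow> 'a \<Rightarrow> nat \<Rightarrow> 'w \<Rightarrow> 'a" where
  "noise \<Omega> PP \<Phi> x k \<omega> =
     \<Phi> k \<omega> - vec_cond_exp (PP x) (natural_filtration \<Omega> \<Phi> (k - 1)) (\<Phi> k) \<omega>"

definition condB1 ::
    "'w measure \<Rightarrow> ('a::euclidean_space \<Rightarrow> 'w measure) \<Rightarrow> (nat \<Rightarrow> 'w \<Rightarrow> 'a) \<Rightarrow> real \<Rightarrow> bool" where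
  "condB1 \<Omega> PP \<Phi> p \<longleftrightarrow> p > 1 \<and>
     ((\<lambda>K::real. SUP x. \<integral>\<^sup>+\<omega>. ennreal (norm (noise \<Omega> PP \<Phi> x 1 \<omega>) powr p)
          * indicator {\<omega>'. norm (noise \<Omega> PP \<Phi> x 1 \<omega>') \<ge> K} \<omega> \<partial>PP x) \<longlongrightarrow> 0) at_top"

text \<open>The case distinction is the convention $0^0 = 1$, which \<^const>\<open>powr\<close> does not follow.\<close>

definition drift_bound :: "real \<Rightarrow> ('a::euclidean_space \<Rightarrow> 'a) \<Rightarrow> ennreal" where
  "drift_bound \<beta> \<Delta> =
     (SUP x. ennreal ((1 + (if \<beta> = 0 then 1 else norm x powr \<beta>)) * norm (\<Delta> x)))"

definition condB2 ::
    "('a::euclidean_space \<Rightarrow> 'w measure) \<Rightarrow> (nat \<Rightarrow> 'w \<Rightarrow> 'a) \<Rightarrow> real \<Rightarrow> real \<Rightarrow> bool" where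
  "condB2 PP \<Phi> p \<beta> \<longleftrightarrow>
     0 \<le> \<beta> \<and> \<beta> < min 1 (p - 1) \<and> drift_bound \<beta> (drift PP \<Phi>) < \<infinity>"

section \<open>Fluid limits\<close>

definition scaled_path :: "(nat \<Rightarrow> 'w \<Rightarrow> 'a::euclidean_space) \<Rightarrow> real \<Rightarrow> real \<Rightarrow> 'w \<Rightarrow> real \<Rightarrow> 'a" where
  "scaled_path \<Phi> \<alpha> r \<omega> = (\<lambda>t\<in>{0..}. inverse r *\<^sub>R \<Phi> (nat \<lfloor>t * r powr (1 + \<alpha>)\<rfloor>) \<omega>)"

definition scaled_law ::
    "('a::euclidean_space \<Rightarrow> 'w measure) \<Rightarrow> (nat \<Rightarrow> 'w \<Rightarrow> 'a) \<Rightarrow> real \<Rightarrow> real \<Rightarrow> 'a \<Rightarrow> (real \<Rightarrow> 'a) measure" where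
  "scaled_law PP \<Phi> \<alpha> r x = distr (PP (r *\<^sub>R x)) (borel_of D_topology) (scaled_path \<Phi> \<alpha> r)"

definition fluid_limit ::
    "('a::euclidean_space \<Rightarrow> 'w measure) \<Rightarrow> (nat \<Rightarrow> 'w \<Rightarrow> 'a) \<Rightarrow> real \<Rightarrow> 'a \<Rightarrow> (real \<Rightarrow> 'a) measure \<Rightarrow> bool" where
  "fluid_limit PP \<Phi> \<alpha> x Q \<longleftrightarrow>
     prob_space Q \<and> sets Q = sets (borel_of D_topology) \<and>
     (\<exists>r xs. (\<forall>n. 0 < r n) \<and> filterlim r at_top sequentially \<and> xs \<longlonglongrightarrow> x \<and>
        weak_conv_on D_topology (\<lambda>n. scaled_law PP \<Phi> \<alpha> (r n) (xs n)) Q)"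

end

theory Submission
  imports Defs
begin

text \<open>
  Let \<open>S\<close> be the partial sums of the noise, divided by \<open>r\<close>. The function
  \<open>sqrt (1 + |s|^2) - 1\<close> is quadratic near \<open>0\<close> and linear at infinity, so a centred increment \<open>e\<close>
  raises its expectation by at most \<open>2 E|e|^q\<close> for \<open>q\<close> in \<open>[1,2]\<close>. With \<open>q = min p 2\<close>, stopping gives
  a maximal inequality with bound of order \<open>r^(1+\<alpha>-q)\<close> for \<open>O(r^(1+\<alpha>))\<close> steps, and this tends to \<open>0\<close>
  because \<open>\<alpha> < min 1 (p-1)\<close>. Outside the ball of radius \<open>\<rho>\<close> the scaled drift contributes at most
  \<open>N \<rho>^(-\<beta>) r^(\<alpha>-\<beta>) |t-s|\<close>, and the excursions into the ball contribute \<open>2 \<rho>\<close>. For \<open>\<alpha> < \<beta>\<close> this shows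
  that the scaled path converges to its initial point; for \<open>\<alpha> \<le> \<beta>\<close> the choice
  \<open>\<rho> = |t-s|^(1/(1+\<beta>))\<close> gives, up to a vanishing error, a Hoelder modulus of continuity.

  Sampled at rational times, paths with a fixed modulus form a compact metric space. A compact metric
  space embeds into the reals with uniformly continuous inverse, which reduces the extraction of a
  weak limit to Helly's theorem; Tietze's theorem transfers test functions.
\<close>

section \<open>Weak limits on compact metric spaces\<close>

text \<open>Two obstacles shape the proof. First, scaled paths jump, so they satisfy a modulus of
  continuity only up to an additive error, and only on finite horizons; they need not lie in a
  compact set of paths. Compactness is therefore taken on the samples, and the exact modulus
  reappears in the limit, where the error is gone. The limit is continuous, so Skorokhod convergence
  is obtained from locally uniform convergence, with the identity as time change. Second,
  \<open>p\<close> may be below 2, so the noise need not have a variance and L2 martingale bounds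
  are out of reach; the expansion of a smooth convex function asks only for moments of order
  \<open>q\<close>. The exponent 1/(1+\<beta>) solves
  \<open>\<rho> = \<rho> powr (-\<beta>) * h\<close>: it balances the diameter of the ball, where
  the drift bound degenerates, against the drift outside over a time span \<open>h\<close>. At
  \<alpha> = \<beta> the factor r^(\<alpha>-\<beta>) is 1 and the drift may survive in the limit,
  which is why triviality asks for a strict inequality.\<close>

lemma ternary_code_separated:
  fixes a b :: "nat \<Rightarrow> bool"
  assumes "\<bar>(\<Sum>k. of_bool (a k) / (3::real) ^ k) - (\<Sum>k. of_bool (b k) / 3 ^ k)\<bar> < (1/2) / 3 ^ n"
    and "k \<le> n"
  shows "a k = b k"
proof (rule ccontr)
  let ?s = "\<lambda>a::nat \<Rightarrow> bool. \<Sum>k. of_bool (a k) / (3::real) ^ k"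
  assume "a k \<noteq> b k"
  \<comment> \<open>The first differing digit contributes 1/3^j, all later ones together at most
    half of that. In base 2 the later digits could cancel it.\<close>
  define j where "j = (LEAST k. a k \<noteq> b k)"
  have j: "a j \<noteq> b j" unfolding j_def using \<open>a k \<noteq> b k\<close> by (rule LeastI)
  have lt: "a i = b i" if "i < j" for i using not_less_Least that unfolding j_def by blast
  have "j \<le> n" using Least_le[of "\<lambda>k. a k \<noteq> b k", OF \<open>a k \<noteq> b k\<close>] \<open>k \<le> n\<close> unfolding j_def by linarith
  have geo: "summable (\<lambda>k. 1 / (3::real) ^ k)"
    using summable_geometric[of "1/3::real"] by (simp add: power_divide)
  have sm: "summable (\<lambda>k. of_bool (a k) / (3::real) ^ k)" for a :: "nat \<Rightarrow> bool"
    by (rule summable_comparison_test'[OF geo]) simp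
  define d where "d k = (of_bool (a k) - of_bool (b k)) / (3::real) ^ k" for k
  have sd: "summable d" unfolding d_def diff_divide_distrib using sm by (intro summable_diff)
  have diff: "?s a - ?s b = suminf d"
    unfolding d_def diff_divide_distrib by (rule suminf_diff[OF sm sm])
  have "suminf d = (\<Sum>k. d (k + Suc j)) + (\<Sum>k<Suc j. d k)"
    by (rule suminf_split_initial_segment[OF sd])
  also have "(\<Sum>k<Suc j. d k) = d j" using lt by (simp add: d_def)
  finally have eq: "suminf d = (\<Sum>k. d (k + Suc j)) + d j" .
  have tail: "\<bar>\<Sum>k. d (k + Suc j)\<bar> \<le> (\<Sum>k. 1 / 3 ^ Suc j * (1/3::real) ^ k)"
  proof (rule order_trans[OF summable_rabs suminf_le])
    show "\<bar>d (k + Suc j)\<bar> \<le> 1 / 3 ^ Suc j * (1/3::real) ^ k" for k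
      by (auto simp: d_def power_add power_divide field_simps)
    show g: "summable (\<lambda>k. 1 / 3 ^ Suc j * (1/3::real) ^ k)"
      by (intro summable_mult summable_geometric) simp
    show "summable (\<lambda>k. \<bar>d (k + Suc j)\<bar>)"
      by (rule summable_comparison_test'[OF g]) (auto simp: d_def power_add power_divide field_simps)
    then show "summable (\<lambda>k. \<bar>d (k + Suc j)\<bar>)" .
  qed
  also have "\<dots> = 1 / 3 ^ Suc j * (1 / (1 - 1/3))"
    by (subst suminf_mult) (auto intro!: summable_geometric simp: suminf_geometric)
  also have "\<dots> = (1/2) / 3 ^ j" by simp
  finally have "\<bar>\<Sum>k. d (k + Suc j)\<bar> \<le> (1/2) / 3 ^ j" .
  moreover have "\<bar>d j\<bar> = 1 / 3 ^ j" using j by (auto simp: d_def)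
  ultimately have "\<bar>suminf d\<bar> \<ge> 1 / 3 ^ j - (1/2) / 3 ^ j" unfolding eq by linarith
  also have "1 / 3 ^ j - (1/2) / 3 ^ j = (1/2) / (3::real) ^ j" by simp
  also have "\<dots> \<ge> (1/2) / 3 ^ n" using \<open>j \<le> n\<close> by (intro divide_left_mono power_increasing) auto
  finally show False using assms(1) diff by simp
qed

text \<open>The code reads the indicators of the sets of a countable basis as ternary digits.\<close>

lemma compact_real_code:
  fixes K :: "'m::{complete_space, second_countable_topology} set"
  assumes "compact K"
  obtains \<sigma> :: "'m \<Rightarrow> real" and \<pi> :: "real \<Rightarrow> 'm" and C where
    "\<sigma> \<in> borel_measurable borel" "compact C" "\<And>x. x \<in> K \<Longrightarrow> \<sigma> x \<in> C" "\<And>x. \<sigma> x \<in> {0..2}"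
    "continuous_on C \<pi>" "\<pi> ` C \<subseteq> K" "\<And>x. x \<in> K \<Longrightarrow> \<pi> (\<sigma> x) = x"
proof -
  obtain B :: "nat \<Rightarrow> 'm set" where B: "topological_basis (range B)"
  proof -
    obtain B :: "'m set set" where B: "countable B" "topological_basis B" using ex_countable_basis by blast
    moreover have "B \<noteq> {}"
      using B(2) topological_basisE[of B UNIV undefined] by blast
    ultimately have "range (from_nat_into B) = B" by (metis range_from_nat_into)
    with B that show ?thesis by metis
  qed
  have op: "open (B k)" for k using topological_basis_open[OF B] by blast
  define \<sigma> where "\<sigma> x = (\<Sum>k. of_bool (x \<in> B k) / (3::real) ^ k)" for x
  have geo: "summable (\<lambda>k. (1 / (3::real)) ^ k)"
    by (intro summable_geometric) simp
  have sm: "summable (\<lambda>k. of_bool (a k) / (3::real) ^ k)" for a :: "nat \<Rightarrow> bool"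
    by (rule summable_comparison_test'[OF geo]) (simp add: power_divide)
  have meas: "\<sigma> \<in> borel_measurable borel"
    unfolding \<sigma>_def using borel_open[OF op] by (intro borel_measurable_suminf) simp
  have bnd: "\<sigma> x \<in> {0..2}" for x
  proof -
    have "\<sigma> x \<le> (\<Sum>k. (1 / (3::real)) ^ k)" unfolding \<sigma>_def
      by (rule suminf_le[OF _ sm geo]) (simp add: power_divide)
    also have "\<dots> \<le> 2" by (simp add: suminf_geometric)
    finally have "\<sigma> x \<le> 2" .
    moreover have "0 \<le> \<sigma> x" unfolding \<sigma>_def by (rule suminf_nonneg[OF sm]) auto
    ultimately show ?thesis by simp
  qed
  have uc: "\<exists>d>0. \<forall>x\<in>K. \<forall>y\<in>K. \<bar>\<sigma> x - \<sigma> y\<bar> < d \<longrightarrow> dist x y < e" if "e > 0" for e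
  proof -
    \<comment> \<open>Finitely many of these small basis sets cover \<open>K\<close>. If two codes
      agree up to the largest index used, both points lie in a common small set.\<close>
    define I where "I = {k. \<forall>x\<in>B k. \<forall>y\<in>B k. dist x y < e}"
    have "K \<subseteq> (\<Union>k\<in>I. B k)"
    proof
      fix x assume "x \<in> K"
      have "x \<in> ball x (e/2)" using \<open>e > 0\<close> by simp
      then obtain k where k: "x \<in> B k" "B k \<subseteq> ball x (e/2)"
        using topological_basisE[OF B open_ball] by (metis rangeE)
      have "k \<in> I" unfolding I_def
      proof (intro CollectI ballI)
        fix y z assume "y \<in> B k" "z \<in> B k"
        with k have "dist x y < e/2" "dist x z < e/2" by auto
        then show "dist y z < e" using dist_triangle_half_r by blast
      qed
      with k show "x \<in> (\<Union>k\<in>I. B k)" by blast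
    qed
    then obtain J where J: "J \<subseteq> I" "finite J" "K \<subseteq> (\<Union>k\<in>J. B k)"
      using compactE_image[OF assms, of I B] op by blast
    define n where "n = Max (insert 0 J)"
    have n: "k \<le> n" if "k \<in> J" for k using that J unfolding n_def by simp
    show ?thesis
    proof (intro exI conjI ballI impI)
      show "(1/2) / (3::real) ^ n > 0" by simp
      fix x y assume xy: "x \<in> K" "y \<in> K" and d: "\<bar>\<sigma> x - \<sigma> y\<bar> < (1/2) / 3 ^ n"
      obtain k where k: "k \<in> J" "x \<in> B k" using J xy by blast
      have "(x \<in> B k) = (y \<in> B k)"
        by (rule ternary_code_separated[OF d[unfolded \<sigma>_def] n[OF k(1)]])
      with k J show "dist x y < e" unfolding I_def by blast
    qed
  qed
  have inj: "inj_on \<sigma> K"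
  proof (rule inj_onI, rule ccontr)
    fix x y assume xy: "x \<in> K" "y \<in> K" "\<sigma> x = \<sigma> y" "x \<noteq> y"
    then have "dist x y > 0" by simp
    from uc[OF this] xy show False by fastforce
  qed
  define \<tau> where "\<tau> = inv_into K \<sigma>"
  have \<tau>: "\<tau> (\<sigma> x) = x" if "x \<in> K" for x unfolding \<tau>_def using inj that by simp
  have "uniformly_continuous_on (\<sigma> ` K) \<tau>"
    unfolding uniformly_continuous_on_def
  proof (intro allI impI)
    fix e :: real assume "e > 0"
    from uc[OF this] obtain d where "d > 0" "\<forall>x\<in>K. \<forall>y\<in>K. \<bar>\<sigma> x - \<sigma> y\<bar> < d \<longrightarrow> dist x y < e" by blast
    then show "\<exists>d>0. \<forall>x\<in>\<sigma> ` K. \<forall>x'\<in>\<sigma> ` K. dist x' x < d \<longrightarrow> dist (\<tau> x') (\<tau> x) < e"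
      by (intro exI[of _ d]) (auto simp: \<tau> dist_real_def)
  qed
  \<comment> \<open>The image of \<open>K\<close> under \<open>\<sigma>\<close> need not be closed,
    since \<open>\<sigma>\<close> is only shown to be Borel. The decoder has to be extended to the
    closure, and it keeps its values in the closed set \<open>K\<close>.\<close>
  then obtain \<pi> where \<pi>: "uniformly_continuous_on (closure (\<sigma> ` K)) \<pi>" "\<And>x. x \<in> \<sigma> ` K \<Longrightarrow> \<tau> x = \<pi> x"
    using uniformly_continuous_on_extension_on_closure by metis
  have cont: "continuous_on (closure (\<sigma> ` K)) \<pi>" using \<pi>(1) by (rule uniformly_continuous_imp_continuous)
  have "\<pi> ` \<sigma> ` K \<subseteq> K" using \<pi>(2) \<tau> by force
  then have "\<pi> ` closure (\<sigma> ` K) \<subseteq> K"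
    by (rule image_closure_subset[OF cont compact_imp_closed[OF assms]])
  moreover have "compact (closure (\<sigma> ` K))"
    using bnd by (intro compact_closure[THEN iffD2] bounded_subset[OF bounded_closed_interval[of 0 2]]) auto
  ultimately show thesis
    using that[OF meas _ _ bnd cont] \<pi>(2) \<tau> closure_subset by fastforce
qed


text \<open>Helly's theorem is applied to the laws of the codes. Continuity is asked only of the
  decoder: a test function \<open>g\<close> becomes \<open>g o \<pi>\<close> on the compact set
  \<open>C\<close>, and its bounded continuous extension to the reals agrees with \<open>g\<close>
  along the codes of points of \<open>K\<close>.\<close>

lemma compact_subsequence_weak_limit:
  fixes K :: "'m::{complete_space, second_countable_topology} set" and X :: "nat \<Rightarrow> 'w \<Rightarrow> 'm"
  assumes K: "compact K" and M: "\<And>n. prob_space (M n)" "\<And>n. X n \<in> M n \<rightarrow>\<^sub>M borel"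
    and XK: "\<And>n w. w \<in> space (M n) \<Longrightarrow> X n w \<in> K"
  obtains s \<nu> where "strict_mono s" "prob_space \<nu>" "sets \<nu> = sets borel" "AE u in \<nu>. u \<in> K"
    "\<And>g B. continuous_on UNIV g \<Longrightarrow> (\<And>u. \<bar>g u\<bar> \<le> B) \<Longrightarrow>
      (\<lambda>n. \<integral>w. g (X (s n) w) \<partial>M (s n)) \<longlonglongrightarrow> (\<integral>u. g u \<partial>\<nu> :: real)"
proof -
  obtain \<sigma> and \<pi> and C where \<sigma>[measurable]: "\<sigma> \<in> borel_measurable borel" and C: "compact C"
    and \<sigma>C: "\<And>x. x \<in> K \<Longrightarrow> \<sigma> x \<in> C" and bnd: "\<And>x. \<sigma> x \<in> {0..2::real}"
    and \<pi>: "continuous_on C \<pi>" "\<pi> ` C \<subseteq> K" "\<And>x. x \<in> K \<Longrightarrow> \<pi> (\<sigma> x) = x"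
    using compact_real_code[OF K] by metis
  interpret M: prob_space "M n" for n by (rule M)
  note M(2)[measurable]
  define \<mu> where "\<mu> n = distr (M n) borel (\<lambda>w. \<sigma> (X n w))" for n
  have \<mu>: "real_distribution (\<mu> n)" for n
    unfolding \<mu>_def by (intro M.real_distribution_distr) measurable
  have "tight \<mu>"
    unfolding tight_def
  proof (intro conjI allI impI \<mu>)
    fix e :: real assume "e > 0"
    have "measure (\<mu> n) {-1<..2} = measure (M n) (space (M n))" for n
    proof -
      have "(\<lambda>w. \<sigma> (X n w)) -` {-1<..2} \<inter> space (M n) = space (M n)"
        using bnd by (force simp: less_le_trans[of "-1" 0])
      then show ?thesis unfolding \<mu>_def by (subst measure_distr) auto
    qed
    with \<open>e > 0\<close> show "\<exists>a b. a < b \<and> (\<forall>n. 1 - e < measure (\<mu> n) {a<..b})"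
      by (intro exI[of _ "-1"] exI[of _ 2]) (auto simp: M.prob_space)
  qed
  from tight_imp_convergent_subsubsequence[OF this strict_mono_id]
  obtain s \<mu>' where s: "strict_mono s" and \<mu>': "real_distribution \<mu>'"
    and conv: "weak_conv_m (\<lambda>n. \<mu> (s n)) \<mu>'"
    by (auto simp: comp_def id_def)
  interpret \<mu>': real_distribution \<mu>' by (rule \<mu>')
  have lim: "(\<lambda>n. \<integral>w. g (\<sigma> (X (s n) w)) \<partial>M (s n)) \<longlonglongrightarrow> (\<integral>u. g u \<partial>\<mu>')"
    if g: "continuous_on UNIV g" "\<And>u. \<bar>g u\<bar> \<le> B" for g :: "real \<Rightarrow> real" and B
  proof -
    have [measurable]: "g \<in> borel_measurable borel" using g(1) by (rule borel_measurable_continuous_onI)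
    have "(\<lambda>n. \<integral>u. g u \<partial>\<mu> (s n)) \<longlonglongrightarrow> (\<integral>u. g u \<partial>\<mu>')"
      by (rule weak_conv_imp_integral_bdd_continuous_conv[OF \<mu> \<mu>' conv, where B=B])
         (use g in \<open>auto simp: continuous_on_eq_continuous_at\<close>)
    then show ?thesis unfolding \<mu>_def by (subst (asm) integral_distr) auto
  qed
  \<comment> \<open>\<open>infdist u {}\<close> is 0, so the distance function identifies
    \<open>C\<close> only when \<open>C\<close> is nonempty.\<close>
  have "C \<noteq> {}"
    using M.not_empty[of 0] XK[of _ 0] \<sigma>C by blast
  have AE: "AE u in \<mu>'. u \<in> C"
  proof -
    define g where "g u = min 1 (infdist u C)" for u
    have g: "continuous_on UNIV g" unfolding g_def by (intro continuous_intros)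
    then have [measurable]: "g \<in> borel_measurable borel" by (rule borel_measurable_continuous_onI)
    have g1: "\<bar>g u\<bar> \<le> 1" for u using infdist_nonneg[of u C] unfolding g_def by auto
    have "(\<integral>w. g (\<sigma> (X (s n) w)) \<partial>M (s n)) = (\<integral>w. 0 \<partial>M (s n))" for n
      by (rule Bochner_Integration.integral_cong) (auto simp: g_def XK \<sigma>C)
    then have "(\<integral>u. g u \<partial>\<mu>') = 0" using lim[OF g g1] by (simp add: LIMSEQ_const_iff)
    moreover have "integrable \<mu>' g"
      by (rule \<mu>'.integrable_const_bound[where B=1]) (use g1 in auto)
    ultimately have "AE u in \<mu>'. g u = 0"
      by (subst (asm) integral_nonneg_eq_0_iff_AE) (auto simp: g_def infdist_nonneg)
    then show ?thesis
    proof (rule AE_mp, intro AE_I2 impI)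
      fix u assume "g u = 0"
      then have "infdist u C = 0" unfolding g_def by (auto simp: min_def split: if_splits)
      with \<open>C \<noteq> {}\<close> C show "u \<in> C" by (simp add: in_closed_iff_infdist_zero compact_imp_closed)
    qed
  qed
  have C_meas [measurable]: "C \<in> sets borel" using C by (simp add: borel_closed compact_imp_closed)
  obtain k where k: "k \<in> K" using M.not_empty[of 0] XK[of _ 0] by blast
  \<comment> \<open>\<open>C\<close> has full measure under the limit law; the default
    \<open>k\<close> keeps the decoded point in \<open>K\<close> everywhere.\<close>
  define \<rho> where "\<rho> u = (if u \<in> C then \<pi> u else k)" for u
  have [measurable]: "\<rho> \<in> borel_measurable borel"
    unfolding \<rho>_def using C_meas \<pi>(1) continuous_on_const by (rule borel_measurable_continuous_on_if)
  show thesis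
  proof (rule that[OF s])
    show "prob_space (distr \<mu>' borel \<rho>)" by (rule \<mu>'.prob_space_distr) simp
    show "sets (distr \<mu>' borel \<rho>) = sets borel" by simp
    have [measurable]: "K \<in> sets borel" using K by (simp add: borel_closed compact_imp_closed)
    show "AE u in distr \<mu>' borel \<rho>. u \<in> K"
      by (subst AE_distr_iff) (use \<pi>(2) k in \<open>auto simp: \<rho>_def\<close>)
    fix g :: "'m \<Rightarrow> real" and B assume g: "continuous_on UNIV g" "\<And>u. \<bar>g u\<bar> \<le> B"
    have [measurable]: "g \<in> borel_measurable borel" using g(1) by (rule borel_measurable_continuous_onI)
    have "0 \<le> B" using g(2)[of undefined] by linarith
    have "continuous_on C (\<lambda>u. g (\<pi> u))"
      by (rule continuous_on_compose2[OF g(1) \<pi>(1)]) auto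
    then obtain h where h: "continuous_on UNIV h" "\<And>x. x \<in> C \<Longrightarrow> h x = g (\<pi> x)" "\<And>x. norm (h x) \<le> B"
      using Tietze[of C "\<lambda>u. g (\<pi> u)" UNIV B] C g(2) \<open>0 \<le> B\<close> by (auto simp: compact_imp_closed)
    have [measurable]: "h \<in> borel_measurable borel" using h(1) by (rule borel_measurable_continuous_onI)
    have "(\<integral>w. h (\<sigma> (X (s n) w)) \<partial>M (s n)) = (\<integral>w. g (X (s n) w) \<partial>M (s n))" for n
      by (rule Bochner_Integration.integral_cong) (auto simp: h \<sigma>C XK \<pi>)
    moreover have "(\<integral>u. h u \<partial>\<mu>') = (\<integral>u. g u \<partial>distr \<mu>' borel \<rho>)"
    proof -
      have "(\<integral>u. h u \<partial>\<mu>') = (\<integral>u. g (\<rho> u) \<partial>\<mu>')"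
      proof (rule integral_cong_AE)
        show "AE u in \<mu>'. h u = g (\<rho> u)" using AE by (auto simp: \<rho>_def h)
      qed measurable
      then show ?thesis by (subst integral_distr) auto
    qed
    ultimately show "(\<lambda>n. \<integral>w. g (X (s n) w) \<partial>M (s n)) \<longlonglongrightarrow> (\<integral>u. g u \<partial>distr \<mu>' borel \<rho>)"
      using lim[OF h(1), of B] h(3) by simp
  qed
qed

section \<open>Paths with a prescribed modulus of continuity\<close>

lemma tendsto_fun_iff:
  fixes u :: "nat \<Rightarrow> 'i \<Rightarrow> 'b::topological_space"
  shows "(u \<longlonglongrightarrow> l) \<longleftrightarrow> (\<forall>i. (\<lambda>n. u n i) \<longlonglongrightarrow> l i)"
  using limitin_componentwise[of "\<lambda>i::'i. euclidean::'b topology" UNIV u l sequentially]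
  by (simp add: euclidean_product_topology)

text \<open>Tychonoff's theorem for closed balls whose radii may vary with the index.\<close>

lemma compact_fun_cball:
  fixes R :: "'i \<Rightarrow> real"
  shows "compact {u :: 'i \<Rightarrow> 'a::euclidean_space. \<forall>i. norm (u i) \<le> R i}"
proof -
  have "compactin (product_topology (\<lambda>i. euclidean) UNIV) (Pi\<^sub>E UNIV (\<lambda>i::'i. cball (0::'a) (R i)))"
    by (subst compactin_PiE) auto
  moreover have "Pi\<^sub>E UNIV (\<lambda>i. cball 0 (R i)) = {u :: 'i \<Rightarrow> 'a. \<forall>i. norm (u i) \<le> R i}"
    by (auto simp: PiE_def)
  ultimately show ?thesis by (simp add: euclidean_product_topology)
qed

text \<open>The identity is a time change, so locally uniform convergence puts \<open>v n\<close>
  eventually into every \<open>J1_nhd T e w\<close>, and each open set around \<open>w\<close>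
  contains one of these by the definition of the topology.\<close>

lemma D_continuous_uniform_limit:
  fixes f :: "(real \<Rightarrow> 'a::euclidean_space) \<Rightarrow> real"
  assumes f: "continuous_map D_topology euclideanreal f" and v: "\<And>n. v n \<in> D_paths" and w: "w \<in> D_paths"
    and unif: "\<And>T e. e > 0 \<Longrightarrow> \<forall>\<^sub>F n in sequentially. \<forall>t\<in>{0..T}. dist (v n t) (w t) < e"
  shows "(\<lambda>n. f (v n)) \<longlonglongrightarrow> f w"
proof (rule topological_tendstoI)
  fix S :: "real set" assume "open S" "f w \<in> S"
  then have "openin D_topology {v \<in> D_paths. f v \<in> S}"
    using f unfolding continuous_map_def by simp
  with w \<open>f w \<in> S\<close> obtain T e where Te: "e > 0" "J1_nhd T e w \<subseteq> {v \<in> D_paths. f v \<in> S}"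
    unfolding openin_D_topology by blast
  have l: "(\<lambda>t. t) \<in> time_changes"
    unfolding time_changes_def by (simp add: strict_mono_on_def)
  from unif[OF \<open>e > 0\<close>, of T] show "\<forall>\<^sub>F n in sequentially. f (v n) \<in> S"
  proof eventually_elim
    case (elim n)
    then have "v n \<in> J1_nhd T e w"
      unfolding J1_nhd_def using v \<open>e > 0\<close> by (intro CollectI conjI bexI[OF _ l]) simp_all
    with Te show ?case by blast
  qed
qed

text \<open>Rounding down keeps the grid point of a time in [0, T] inside [0, T], where the modulus
  of a path is under control. \<open>Suc k\<close> avoids division by zero.\<close>

definition grid :: "nat \<Rightarrow> real \<Rightarrow> rat" where
  "grid k t = of_int \<lfloor>t * real (Suc k)\<rfloor> / of_nat (Suc k)"

lemma grid_nonneg: "t \<ge> 0 \<Longrightarrow> grid k t \<ge> 0"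
  unfolding grid_def by (intro divide_nonneg_nonneg) auto

lemma of_rat_grid: "real_of_rat (grid k t) = of_int \<lfloor>t * real (Suc k)\<rfloor> / real (Suc k)"
  unfolding grid_def by (simp add: of_rat_divide del: of_nat_Suc)

lemma grid_bounds: "t - 1 / real (Suc k) \<le> real_of_rat (grid k t)" "real_of_rat (grid k t) \<le> t"
proof -
  have "of_int \<lfloor>t * real (Suc k)\<rfloor> \<le> t * real (Suc k)" by simp
  then show "real_of_rat (grid k t) \<le> t"
    unfolding of_rat_grid by (subst pos_divide_le_eq) auto
  have "t * real (Suc k) - 1 \<le> of_int \<lfloor>t * real (Suc k)\<rfloor>" by linarith
  then have "(t * real (Suc k) - 1) / real (Suc k) \<le> real_of_rat (grid k t)"
    unfolding of_rat_grid by (intro divide_right_mono) auto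
  then show "t - 1 / real (Suc k) \<le> real_of_rat (grid k t)"
    by (simp add: diff_divide_distrib del: of_nat_Suc)
qed

lemma grid_tendsto: "(\<lambda>k. real_of_rat (grid k t)) \<longlonglongrightarrow> t"
proof (rule tendsto_sandwich)
  have "(\<lambda>k. t - 1 / real (Suc k)) \<longlonglongrightarrow> t - 0"
    using LIMSEQ_Suc[OF lim_1_over_n] by (intro tendsto_diff tendsto_const) simp
  then show "(\<lambda>k. t - 1 / real (Suc k)) \<longlonglongrightarrow> t" by simp
  show "\<forall>\<^sub>F k in sequentially. t - 1 / real (Suc k) \<le> real_of_rat (grid k t)"
    "\<forall>\<^sub>F k in sequentially. real_of_rat (grid k t) \<le> t"
    using grid_bounds by (blast intro: always_eventually)+
qed simp

text \<open>The parameter \<open>state_type\<close> fixes the state space of the paths, a type that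
  \<open>\<omega>\<close> and \<open>R\<close> do not mention.\<close>

locale path_modulus =
  fixes \<omega> :: "real \<Rightarrow> real" and R :: real and state_type :: "'a::euclidean_space itself"
  assumes \<omega>_cont: "continuous_on {0..} \<omega>" and \<omega>_0: "\<omega> 0 = 0" and \<omega>_nonneg: "\<And>h. \<omega> h \<ge> 0"
    and R_nonneg: "R \<ge> 0"
begin

text \<open>The additive error makes room for jumps. A single index governs error and horizon, so
  the sets decrease in \<open>m\<close>, and a limit of paths \<open>v n\<close> taken from
  \<open>nearly n\<close> obeys \<open>\<omega>\<close> exactly on all of [0, \<infinity>).\<close>

definition nearly :: "nat \<Rightarrow> (real \<Rightarrow> 'a) set" where
  "nearly m = {v. norm (v 0) \<le> R \<and>
     (\<forall>s\<in>{0..real m}. \<forall>t\<in>{0..real m}. norm (v t - v s) \<le> \<omega> \<bar>t - s\<bar> + 1 / real (Suc m))}"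

text \<open>The extra 1 absorbs the error 1/(m+1) allowed in \<open>nearly m\<close>.\<close>

definition rat_box :: "(rat \<Rightarrow> 'a) set" where
  "rat_box = {u. \<forall>q. norm (u q) \<le> R + \<omega> (of_rat q) + 1}"

definition rat_paths :: "(rat \<Rightarrow> 'a) set" where
  "rat_paths = {u \<in> rat_box. \<forall>q\<ge>0. \<forall>q'\<ge>0. norm (u q - u q') \<le> \<omega> \<bar>of_rat q - of_rat q'\<bar>}"

text \<open>Sampling at rational times. Paths in \<^term>\<open>nearly m\<close> are unaffected up to time \<^term>\<open>m\<close>; the
  truncation only serves to keep every sample in a compact set.\<close>

definition clip :: "(real \<Rightarrow> 'a) \<Rightarrow> rat \<Rightarrow> 'a" where
  "clip v q = (if 0 \<le> q \<and> norm (v (of_rat q)) \<le> R + \<omega> (of_rat q) + 1 then v (of_rat q) else 0)"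

definition ext :: "(rat \<Rightarrow> 'a) \<Rightarrow> real \<Rightarrow> 'a" where
  "ext u = (\<lambda>t\<in>{0..}. lim (\<lambda>k. u (grid k t)))"

lemma \<omega>_small:
  assumes "e > 0"
  obtains d where "d > 0" "\<And>h. 0 \<le> h \<Longrightarrow> h < d \<Longrightarrow> \<omega> h < e"
proof -
  from \<omega>_cont obtain d where "d > 0" "\<And>h. h \<in> {0..} \<Longrightarrow> dist h 0 < d \<Longrightarrow> dist (\<omega> h) (\<omega> 0) < e"
    using assms unfolding continuous_on_iff by (metis atLeast_iff order_refl)
  with \<omega>_0 \<omega>_nonneg show ?thesis by (intro that[of d]) (auto simp: dist_real_def)
qed

lemma \<omega>_tendsto:
  assumes "(x \<longlongrightarrow> l) F" "\<And>n. x n \<ge> 0" "l \<ge> 0"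
  shows "((\<lambda>n. \<omega> (x n)) \<longlongrightarrow> \<omega> l) F"
  by (rule continuous_on_tendsto_compose[OF \<omega>_cont assms(1)]) (use assms in auto)

lemma nearly_mono: "m \<le> n \<Longrightarrow> nearly n \<subseteq> nearly m"
proof
  fix v assume "m \<le> n" and v: "v \<in> nearly n"
  then have le: "1 / real (Suc n) \<le> 1 / real (Suc m)" by (intro divide_left_mono) auto
  show "v \<in> nearly m" unfolding nearly_def
  proof (intro CollectI conjI ballI)
    fix s t assume "s \<in> {0..real m}" "t \<in> {0..real m}"
    with v \<open>m \<le> n\<close> have "norm (v t - v s) \<le> \<omega> \<bar>t - s\<bar> + 1 / real (Suc n)"
      unfolding nearly_def by auto
    with le show "norm (v t - v s) \<le> \<omega> \<bar>t - s\<bar> + 1 / real (Suc m)" by linarith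
  qed (use v in \<open>auto simp: nearly_def\<close>)
qed

lemma nearly_clip:
  assumes "v \<in> nearly m" "0 \<le> q" "of_rat q \<le> real m"
  shows "clip v q = v (of_rat q)"
proof -
  have "of_rat q \<in> {0..real m}" "0 \<in> {0..real m}" using assms by auto
  then have "norm (v (of_rat q) - v 0) \<le> \<omega> \<bar>of_rat q - 0\<bar> + 1 / real (Suc m)"
    using assms(1) unfolding nearly_def by blast
  moreover have "1 / real (Suc m) \<le> 1" by simp
  moreover have "norm (v 0) \<le> R" using assms unfolding nearly_def by auto
  moreover have "norm (v (of_rat q)) \<le> norm (v (of_rat q) - v 0) + norm (v 0)"
    using norm_triangle_sub by (metis add.commute)
  ultimately have "norm (v (of_rat q)) \<le> R + \<omega> \<bar>of_rat q - 0\<bar> + 1" by linarith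
  with assms(2) show ?thesis unfolding clip_def by simp
qed

lemma clip_in_box: "clip v \<in> rat_box"
  unfolding clip_def rat_box_def using \<omega>_nonneg R_nonneg by (auto simp: add_nonneg_nonneg)

lemma compact_rat_box: "compact rat_box"
  unfolding rat_box_def by (rule compact_fun_cball)

lemma zero_rat_paths: "(\<lambda>_. 0) \<in> rat_paths"
  unfolding rat_paths_def rat_box_def using \<omega>_nonneg R_nonneg by (auto simp: add_nonneg_nonneg)

lemma closed_rat_paths: "closed rat_paths"
proof -
  have c: "continuous_on UNIV (\<lambda>u::rat \<Rightarrow> 'a. u q)" for q
    by (rule continuous_on_product_coordinates)
  have "rat_paths = rat_box \<inter> (\<Inter>q\<in>{0..}. \<Inter>q'\<in>{0..}. {u. norm (u q - u q') \<le> \<omega> \<bar>of_rat q - of_rat q'\<bar>})"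
    unfolding rat_paths_def by auto
  moreover have "closed {u::rat \<Rightarrow> 'a. norm (u q - u q') \<le> \<omega> \<bar>of_rat q - of_rat q'\<bar>}" for q q'
    by (intro closed_Collect_le continuous_intros c)
  ultimately show ?thesis
    using compact_imp_closed[OF compact_rat_box] by (auto intro!: closed_Int closed_INT)
qed

lemma rat_pathsD: "u \<in> rat_paths \<Longrightarrow> q \<ge> 0 \<Longrightarrow> q' \<ge> 0 \<Longrightarrow> norm (u q - u q') \<le> \<omega> \<bar>of_rat q - of_rat q'\<bar>"
  unfolding rat_paths_def by auto

lemma ext_tendsto:
  assumes u: "u \<in> rat_paths" and t: "t \<ge> 0"
  shows "(\<lambda>k. u (grid k t)) \<longlonglongrightarrow> ext u t"
proof -
  have "Cauchy (\<lambda>k. u (grid k t))"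
  proof (rule metric_CauchyI)
    fix e :: real assume "e > 0"
    from \<omega>_small[OF this] obtain d where d: "d > 0" "\<And>h. 0 \<le> h \<Longrightarrow> h < d \<Longrightarrow> \<omega> h < e" by metis
    have "Cauchy (\<lambda>k. real_of_rat (grid k t))" using grid_tendsto by (rule LIMSEQ_imp_Cauchy)
    then obtain N where N: "\<forall>m\<ge>N. \<forall>n\<ge>N. dist (real_of_rat (grid m t)) (real_of_rat (grid n t)) < d"
      using metric_CauchyD d(1) by blast
    have "dist (u (grid m t)) (u (grid n t)) < e" if "m \<ge> N" "n \<ge> N" for m n
      using rat_pathsD[OF u grid_nonneg[OF t] grid_nonneg[OF t], of m n] N that d(2)
      by (metis abs_ge_zero dist_norm dist_real_def order_le_less_trans)
    then show "\<exists>N. \<forall>m\<ge>N. \<forall>n\<ge>N. dist (u (grid m t)) (u (grid n t)) < e" by blast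
  qed
  then show ?thesis unfolding ext_def using t by (simp add: Cauchy_convergent_iff convergent_LIMSEQ_iff)
qed

lemma ext_modulus:
  assumes u: "u \<in> rat_paths" and "s \<ge> 0" "t \<ge> 0"
  shows "norm (ext u t - ext u s) \<le> \<omega> \<bar>t - s\<bar>"
proof (rule tendsto_le)
  show "(\<lambda>k. norm (u (grid k t) - u (grid k s))) \<longlonglongrightarrow> norm (ext u t - ext u s)"
    by (intro tendsto_intros ext_tendsto assms)
  show "(\<lambda>k. \<omega> \<bar>of_rat (grid k t) - of_rat (grid k s)\<bar>) \<longlonglongrightarrow> \<omega> \<bar>t - s\<bar>"
    by (intro \<omega>_tendsto tendsto_intros grid_tendsto) auto
  show "\<forall>\<^sub>F k in sequentially. norm (u (grid k t) - u (grid k s)) \<le> \<omega> \<bar>of_rat (grid k t) - of_rat (grid k s)\<bar>"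
    using rat_pathsD[OF u grid_nonneg grid_nonneg] assms by auto
qed simp

lemma ext_of_rat:
  assumes u: "u \<in> rat_paths" and q: "q \<ge> 0"
  shows "ext u (of_rat q) = u q"
proof -
  have q': "real_of_rat q \<ge> 0" using q by simp
  have "(\<lambda>k. \<omega> \<bar>of_rat (grid k (of_rat q)) - of_rat q\<bar>) \<longlonglongrightarrow> \<omega> \<bar>of_rat q - of_rat q\<bar>"
    by (intro \<omega>_tendsto tendsto_intros grid_tendsto) auto
  then have "(\<lambda>k. \<omega> \<bar>of_rat (grid k (of_rat q)) - of_rat q\<bar>) \<longlonglongrightarrow> 0" by (simp add: \<omega>_0)
  then have "(\<lambda>k. u (grid k (of_rat q)) - u q) \<longlonglongrightarrow> 0"
    by (rule Lim_null_comparison[rotated]) (use rat_pathsD[OF u grid_nonneg[OF q'] q] in auto)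
  then have "(\<lambda>k. u (grid k (of_rat q))) \<longlonglongrightarrow> u q" by (simp add: LIM_zero_iff)
  then show ?thesis using ext_tendsto[OF u q'] LIMSEQ_unique by blast
qed

lemma ext_C_paths:
  assumes u: "u \<in> rat_paths"
  shows "ext u \<in> C_paths"
  unfolding C_paths_def
proof (intro CollectI conjI)
  show "ext u \<in> extensional {0..}" unfolding ext_def by simp
  show "continuous_on {0..} (ext u)"
    unfolding continuous_on_iff
  proof (intro ballI allI impI)
    fix t e :: real assume t: "t \<in> {0..}" and "e > 0"
    from \<omega>_small[OF this(2)] obtain d where d: "d > 0" "\<And>h. 0 \<le> h \<Longrightarrow> h < d \<Longrightarrow> \<omega> h < e" by metis
    show "\<exists>d>0. \<forall>t'\<in>{0..}. dist t' t < d \<longrightarrow> dist (ext u t') (ext u t) < e"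
    proof (intro exI conjI ballI impI)
      fix t' assume "t' \<in> {0..}" "dist t' t < d"
      then have "norm (ext u t' - ext u t) \<le> \<omega> \<bar>t' - t\<bar>" "\<omega> \<bar>t' - t\<bar> < e"
        using ext_modulus[OF u] d(2) t by (auto simp: dist_real_def)
      then show "dist (ext u t') (ext u t) < e" by (simp add: dist_norm)
    qed (rule d)
  qed
qed

text \<open>The Arzela-Ascoli step: [0, T] has finitely many grid points, convergence is uniform on
  them, and the moduli of \<open>v n\<close> and \<open>ext u\<close> carry it to all other
  times.\<close>

lemma uniform_from_rat:
  assumes u: "u \<in> rat_paths"
    and v: "\<And>T e. e > 0 \<Longrightarrow> \<forall>\<^sub>F n in sequentially. \<forall>s\<in>{0..T}. \<forall>t\<in>{0..T}. norm (v n t - v n s) \<le> \<omega> \<bar>t - s\<bar> + e"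
    and conv: "\<And>q. q \<ge> 0 \<Longrightarrow> (\<lambda>n. v n (of_rat q)) \<longlonglongrightarrow> u q"
    and e: "e > 0"
  shows "\<forall>\<^sub>F n in sequentially. \<forall>t\<in>{0..T}. dist (v n t) (ext u t) < e"
proof -
  \<comment> \<open>\<open>v n\<close> uses e/4 for its modulus and e/4 for its additive error;
    \<open>ext u\<close> and the grid point use e/4 each.\<close>
  have "e/4 > 0" using e by simp
  then obtain d where d: "d > 0" "\<And>h. 0 \<le> h \<Longrightarrow> h < d \<Longrightarrow> \<omega> h < e/4" using \<omega>_small by metis
  obtain k :: nat where k: "1 / real (Suc k) < d" using d(1) nat_approx_posE by blast
  define Q where "Q = grid k ` {0..T}"
  have "Q \<subseteq> (\<lambda>i. of_int i / of_nat (Suc k)) ` {0..\<lfloor>T * real (Suc k)\<rfloor>}"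
  proof
    fix q assume "q \<in> Q"
    then obtain t where "q = grid k t" "t \<in> {0..T}" unfolding Q_def by blast
    then show "q \<in> (\<lambda>i. of_int i / of_nat (Suc k)) ` {0..\<lfloor>T * real (Suc k)\<rfloor>}"
      unfolding grid_def by (intro image_eqI[of _ _ "\<lfloor>t * real (Suc k)\<rfloor>"]) (auto intro!: floor_mono mult_right_mono)
  qed
  then have "finite Q" by (rule finite_subset) simp
  moreover have "\<forall>\<^sub>F n in sequentially. dist (v n (of_rat q)) (u q) < e/4" if "q \<in> Q" for q
  proof (rule tendstoD[OF conv])
    show "q \<ge> 0" using that grid_nonneg unfolding Q_def by auto
  qed (use e in simp)
  ultimately have "\<forall>\<^sub>F n in sequentially. \<forall>q\<in>Q. dist (v n (of_rat q)) (u q) < e/4"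
    by (simp add: eventually_ball_finite_distrib)
  moreover have "\<forall>\<^sub>F n in sequentially. \<forall>s\<in>{0..T}. \<forall>t\<in>{0..T}. norm (v n t - v n s) \<le> \<omega> \<bar>t - s\<bar> + e/4"
    using v e by simp
  ultimately show ?thesis
  proof eventually_elim
    case (elim n)
    show ?case
    proof
      fix t assume t: "t \<in> {0..T}"
      let ?q = "grid k t"
      have q0: "?q \<ge> 0" using t by (simp add: grid_nonneg)
      have b: "0 \<le> real_of_rat ?q" "real_of_rat ?q \<le> t" "\<bar>t - of_rat ?q\<bar> < d"
        using q0 grid_bounds[where t=t and k=k] k by auto
      have "norm (v n t - v n (of_rat ?q)) \<le> \<omega> \<bar>t - of_rat ?q\<bar> + e/4"
        using elim(2) b t by (metis atLeastAtMost_iff order_trans)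
      moreover have "norm (ext u t - ext u (of_rat ?q)) \<le> \<omega> \<bar>t - of_rat ?q\<bar>"
        using ext_modulus[OF u b(1), of t] t by simp
      moreover have "\<omega> \<bar>t - of_rat ?q\<bar> < e/4" using d(2) b by auto
      moreover have "dist (v n (of_rat ?q)) (u ?q) < e/4" using elim(1) t unfolding Q_def by blast
      ultimately have "dist (v n t) (v n (of_rat ?q)) < e/2" "dist (ext u t) (u ?q) < e/4"
        "dist (v n (of_rat ?q)) (u ?q) < e/4"
        unfolding ext_of_rat[OF u q0] by (auto simp: dist_norm)
      then show "dist (v n t) (ext u t) < e"
        using dist_triangle[of "v n t" "ext u t" "v n (of_rat ?q)"]
          dist_triangle2[of "v n (of_rat ?q)" "ext u t" "u ?q"] by linarith
    qed
  qed
qed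

text \<open>Compactness of the samples suffices: on each fixed interval the truncation in
  \<open>clip\<close> is eventually inactive and the error 1/(m+1) tends to 0, so the limit of the
  samples inherits the modulus and determines a continuous path.\<close>

lemma nearly_subsequence:
  assumes v: "\<And>n. v n \<in> nearly n"
  obtains s u where "strict_mono s" "u \<in> rat_paths" "(\<lambda>n. clip (v (s n))) \<longlonglongrightarrow> u"
    "\<And>T e. e > 0 \<Longrightarrow> \<forall>\<^sub>F n in sequentially. \<forall>t\<in>{0..T}. dist (v (s n) t) (ext u t) < e"
proof -
  have "seq_compact rat_box" using compact_rat_box by (simp add: compact_eq_seq_compact_metric)
  then obtain u s where u: "u \<in> rat_box" and s: "strict_mono s" and "((\<lambda>n. clip (v n)) \<circ> s) \<longlonglongrightarrow> u"
    by (rule seq_compactE[where f="\<lambda>n. clip (v n)"]) (auto simp: clip_in_box)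
  then have lim: "(\<lambda>n. clip (v (s n))) \<longlonglongrightarrow> u" by (simp add: comp_def)
  have conv: "(\<lambda>n. v (s n) (of_rat q)) \<longlonglongrightarrow> u q" if "q \<ge> 0" for q
  proof (rule Lim_transform_eventually)
    show "(\<lambda>n. clip (v (s n)) q) \<longlonglongrightarrow> u q" using lim unfolding tendsto_fun_iff by blast
    show "\<forall>\<^sub>F n in sequentially. clip (v (s n)) q = v (s n) (of_rat q)"
      using eventually_ge_at_top[of "nat \<lceil>real_of_rat q\<rceil>"]
    proof eventually_elim
      case (elim n)
      then have "real_of_rat q \<le> real n" by linarith
      also have "\<dots> \<le> real (s n)" using seq_suble[OF s] by simp
      finally show ?case using nearly_clip[OF v that] by simp
    qed
  qed
  have mod: "\<forall>\<^sub>F n in sequentially. \<forall>a\<in>{0..T}. \<forall>b\<in>{0..T}. norm (v (s n) b - v (s n) a) \<le> \<omega> \<bar>b - a\<bar> + e"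
    if "e > 0" for T e
  proof -
    obtain k :: nat where k: "1 / real (Suc k) < e" using \<open>e > 0\<close> nat_approx_posE by blast
    show ?thesis using eventually_ge_at_top[of "max k (nat \<lceil>T\<rceil>)"]
    proof eventually_elim
      case (elim n)
      have sn: "n \<le> s n" using seq_suble[OF s] by simp
      have "1 / real (Suc (s n)) \<le> 1 / real (Suc k)" using sn elim by (intro divide_left_mono) auto
      with k have "1 / real (Suc (s n)) \<le> e" by linarith
      moreover have "T \<le> real (s n)" using sn elim by linarith
      moreover have "norm (v (s n) b - v (s n) a) \<le> \<omega> \<bar>b - a\<bar> + 1 / real (Suc (s n))"
        if "a \<in> {0..real (s n)}" "b \<in> {0..real (s n)}" for a b
        using v[of "s n"] that unfolding nearly_def by blast
      ultimately show ?case by (meson add_left_mono atLeastAtMost_iff order_trans)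
    qed
  qed
  have "u \<in> rat_paths" unfolding rat_paths_def
  proof (intro CollectI conjI u allI impI)
    fix q q' :: rat assume q: "q \<ge> 0" "q' \<ge> 0"
    show "norm (u q - u q') \<le> \<omega> \<bar>of_rat q - of_rat q'\<bar>"
    proof (rule field_le_epsilon)
      fix e :: real assume "e > 0"
      show "norm (u q - u q') \<le> \<omega> \<bar>of_rat q - of_rat q'\<bar> + e"
      proof (rule tendsto_upperbound)
        show "(\<lambda>n. norm (v (s n) (of_rat q) - v (s n) (of_rat q'))) \<longlonglongrightarrow> norm (u q - u q')"
          by (intro tendsto_intros conv q)
        show "\<forall>\<^sub>F n in sequentially. norm (v (s n) (of_rat q) - v (s n) (of_rat q')) \<le> \<omega> \<bar>of_rat q - of_rat q'\<bar> + e"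
          using mod[OF \<open>e > 0\<close>, of "max (of_rat q) (of_rat q')"] by eventually_elim (use q in auto)
      qed simp
    qed
  qed
  then show thesis using that[OF s _ lim] uniform_from_rat[OF _ mod conv] by blast
qed

lemma ext_uniform:
  assumes "\<And>n. u n \<in> rat_paths" "l \<in> rat_paths" "u \<longlonglongrightarrow> l" "e > 0"
  shows "\<forall>\<^sub>F n in sequentially. \<forall>t\<in>{0..T}. dist (ext (u n) t) (ext l t) < e"
proof (rule uniform_from_rat[OF assms(2) _ _ assms(4)])
  show "\<forall>\<^sub>F n in sequentially. \<forall>s\<in>{0..T}. \<forall>t\<in>{0..T}. norm (ext (u n) t - ext (u n) s) \<le> \<omega> \<bar>t - s\<bar> + e"
    if "e > 0" for T e
    using ext_modulus[OF assms(1)] that by (intro always_eventually allI ballI) (simp add: add_increasing2)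
  show "(\<lambda>n. ext (u n) (of_rat q)) \<longlonglongrightarrow> l q" if "q \<ge> 0" for q
    using assms(3) unfolding ext_of_rat[OF assms(1) that] tendsto_fun_iff by blast
qed

text \<open>This prepares Tietze's theorem. Sequences suffice because a countable product of metric
  spaces is metrizable.\<close>

lemma continuous_on_ext:
  assumes "continuous_map D_topology euclideanreal f"
  shows "continuous_on rat_paths (\<lambda>u. f (ext u))"
  unfolding continuous_on_sequentially comp_def
  using ext_C_paths C_paths_subset_D_paths
  by (intro allI ballI impI D_continuous_uniform_limit[OF assms] ext_uniform) blast+

text \<open>By \<open>ext_uniform\<close>, the members of \<open>rat_paths\<close> whose extension
  avoids a given open set form a closed set, so preimages of open sets are Borel. The zero path is
  the value chosen off \<open>rat_paths\<close>.\<close>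

lemma measurable_ext:
  "(\<lambda>u. ext (if u \<in> rat_paths then u else (\<lambda>_. 0))) \<in> borel \<rightarrow>\<^sub>M borel_of C_topology"
proof (rule measurable_sigma_sets[OF sets_borel_of])
  let ?G = "\<lambda>u. ext (if u \<in> rat_paths then u else (\<lambda>_. 0))"
  show "{U. openin C_topology U} \<subseteq> Pow (topspace (C_topology :: (real \<Rightarrow> 'a) topology))"
    by (auto dest!: openin_subset)
  show "?G \<in> space borel \<rightarrow> topspace C_topology"
    using ext_C_paths zero_rat_paths by auto
  fix U :: "(real \<Rightarrow> 'a) set" assume "U \<in> {U. openin C_topology U}"
  then have U: "\<And>w. w \<in> U \<Longrightarrow> \<exists>T>0. \<exists>e>0. lu_nhd T e w \<subseteq> U" unfolding openin_C_topology by blast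
  have "closed {u \<in> rat_paths. ext u \<notin> U}"
    unfolding closed_sequential_limits
  proof (intro allI impI, elim conjE)
    fix u l assume u: "\<forall>n. u n \<in> {u \<in> rat_paths. ext u \<notin> U}" and lim: "u \<longlonglongrightarrow> l"
    then have l: "l \<in> rat_paths" using closed_rat_paths closed_sequentially by blast
    have "ext l \<notin> U"
    proof
      assume "ext l \<in> U"
      then obtain T e where Te: "e > 0" "lu_nhd T e (ext l) \<subseteq> U" using U by blast
      have "\<forall>\<^sub>F n in sequentially. \<forall>t\<in>{0..T}. dist (ext (u n) t) (ext l t) < e"
        using u by (intro ext_uniform l lim Te) blast
      then obtain n where "\<forall>t\<in>{0..T}. dist (ext (u n) t) (ext l t) < e"
        unfolding eventually_sequentially by blast
      then have "ext (u n) \<in> lu_nhd T e (ext l)" unfolding lu_nhd_def using u ext_C_paths by blast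
      with Te u show False by blast
    qed
    with l show "l \<in> {u \<in> rat_paths. ext u \<notin> U}" by blast
  qed
  moreover have "?G -` U \<inter> space borel =
      (rat_paths - {u \<in> rat_paths. ext u \<notin> U}) \<union> (if ext (\<lambda>_. 0) \<in> U then - rat_paths else {})"
    by (auto split: if_splits)
  ultimately show "?G -` U \<inter> space borel \<in> sets borel"
    using closed_rat_paths by auto
qed

end

section \<open>Weak limits of almost equicontinuous processes\<close>

lemma borel_of_euclidean: "borel_of (euclidean :: 'a::topological_space topology) = borel"
  unfolding borel_of_def borel_def by (simp add: open_openin[symmetric])

lemma measurable_C_map_real:
  "continuous_map T euclideanreal f \<Longrightarrow> f \<in> borel_of T \<rightarrow>\<^sub>M borel"
  using measurable_borel_of[of T euclideanreal f] by (simp add: borel_of_euclidean)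

context path_modulus
begin

text \<open>If every \<open>nearly k\<close> contained a path violating the bound,
  \<open>nearly_subsequence\<close> would extract a convergent subsequence along which
  \<open>H\<close> does not tend to 0. Convergence along sequences thus becomes a bound that is
  uniform on one set, and such a bound can be integrated.\<close>

lemma nearly_uniform:
  fixes H :: "(real \<Rightarrow> 'a) \<Rightarrow> real"
  assumes H: "\<And>v u. (\<And>n. v n \<in> D_paths) \<Longrightarrow> u \<in> rat_paths \<Longrightarrow> (\<lambda>n. clip (v n)) \<longlonglongrightarrow> u \<Longrightarrow>
      (\<And>T e. e > 0 \<Longrightarrow> \<forall>\<^sub>F n in sequentially. \<forall>t\<in>{0..T}. dist (v n t) (ext u t) < e) \<Longrightarrow> (\<lambda>n. H (v n)) \<longlonglongrightarrow> 0"
    and "e > 0"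
  shows "\<exists>k. \<forall>v\<in>nearly k \<inter> D_paths. \<bar>H v\<bar> < e"
proof (rule ccontr)
  assume "\<not> ?thesis"
  then obtain v where v: "\<And>k. v k \<in> nearly k" "\<And>k. v k \<in> D_paths" "\<And>k. \<not> \<bar>H (v k)\<bar> < e"
    by (metis IntE)
  obtain s u where su: "strict_mono s" "u \<in> rat_paths" "(\<lambda>n. clip (v (s n))) \<longlonglongrightarrow> u"
    "\<And>T e. e > 0 \<Longrightarrow> \<forall>\<^sub>F n in sequentially. \<forall>t\<in>{0..T}. dist (v (s n) t) (ext u t) < e"
    using nearly_subsequence[OF v(1)] by blast
  have "(\<lambda>n. H (v (s n))) \<longlonglongrightarrow> 0" by (rule H[OF v(2) su(2-4)])
  from tendstoD[OF this \<open>e > 0\<close>] obtain n where "\<bar>H (v (s n))\<bar> < e"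
    by (auto simp: eventually_sequentially dist_real_def)
  with v(3) show False by blast
qed

text \<open>On an event of probability at least 1 - 1/(m+1) the integrand is below e/2; off this
  event it is at most \<open>B\<close>.\<close>

lemma nearly_expectation:
  fixes H :: "(real \<Rightarrow> 'a) \<Rightarrow> real" and Y :: "nat \<Rightarrow> 'w \<Rightarrow> real \<Rightarrow> 'a"
  assumes M: "\<And>n. prob_space (M n)" and D: "\<And>n w. Y n w \<in> D_paths"
    and tight: "\<And>m. \<forall>\<^sub>F n in sequentially. \<exists>A\<in>sets (M n). measure (M n) A \<ge> 1 - 1 / real (Suc m) \<and> (\<forall>w\<in>A. Y n w \<in> nearly m)"
    and [measurable]: "\<And>n. (\<lambda>w. H (Y n w)) \<in> borel_measurable (M n)"
    and B: "\<And>v. v \<in> D_paths \<Longrightarrow> \<bar>H v\<bar> \<le> B"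
    and H: "\<And>e. e > 0 \<Longrightarrow> \<exists>k. \<forall>v\<in>nearly k \<inter> D_paths. \<bar>H v\<bar> < e"
  shows "(\<lambda>n. \<integral>w. H (Y n w) \<partial>M n) \<longlonglongrightarrow> 0"
proof (rule tendstoI)
  fix e :: real assume "e > 0"
  interpret M: prob_space "M n" for n by (rule M)
  have "B \<ge> 0" using B[OF D, of 0 undefined] by linarith
  obtain k where k: "\<And>v. v \<in> nearly k \<Longrightarrow> v \<in> D_paths \<Longrightarrow> \<bar>H v\<bar> < e/2" using H[of "e/2"] \<open>e > 0\<close> by auto
  \<comment> \<open>\<open>B\<close> may be 0, hence \<open>B + 1\<close> in the
    denominator.\<close>
  obtain j :: nat where j: "1 / real (Suc j) < e / (2 * (B + 1))"
    using nat_approx_posE[of "e / (2 * (B + 1))"] \<open>e > 0\<close> \<open>B \<ge> 0\<close> by auto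
  \<comment> \<open>One index serves both purposes: \<open>nearly m\<close> lies in
    \<open>nearly k\<close>, and the exceptional probability is at most 1/(j+1).\<close>
  define m where "m = max j k"
  have "1 / real (Suc m) \<le> 1 / real (Suc j)" unfolding m_def by (intro divide_left_mono) auto
  with j have "1 / real (Suc m) < e / (2 * (B + 1))" by linarith
  then have "B * (1 / real (Suc m)) \<le> B * (e / (2 * (B + 1)))"
    using \<open>B \<ge> 0\<close> by (intro mult_left_mono) auto
  also have "\<dots> < e/2" using \<open>B \<ge> 0\<close> \<open>e > 0\<close> by (simp add: field_simps)
  finally have m: "B * (1 / real (Suc m)) < e/2" .
  from tight[of m] show "\<forall>\<^sub>F n in sequentially. dist (\<integral>w. H (Y n w) \<partial>M n) 0 < e"
  proof eventually_elim
    case (elim n)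
    then obtain A where [measurable]: "A \<in> sets (M n)" and A: "measure (M n) A \<ge> 1 - 1 / real (Suc m)"
      "\<And>w. w \<in> A \<Longrightarrow> Y n w \<in> nearly m" by blast
    have int: "integrable (M n) (\<lambda>w. H (Y n w))"
      by (rule M.integrable_const_bound[where B=B]) (use B D in auto)
    have "\<bar>\<integral>w. H (Y n w) \<partial>M n\<bar> \<le> (\<integral>w. \<bar>H (Y n w)\<bar> \<partial>M n)" by (rule integral_abs_bound)
    also have "\<dots> \<le> (\<integral>w. e/2 + B * indicator (space (M n) - A) w \<partial>M n)"
    proof (rule integral_mono)
      show "integrable (M n) (\<lambda>w. \<bar>H (Y n w)\<bar>)" using int by simp
      show "integrable (M n) (\<lambda>w. e/2 + B * indicator (space (M n) - A) w)"
        by (intro Bochner_Integration.integrable_add integrable_mult_right integrable_real_indicator)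
           (auto simp: M.emeasure_eq_measure)
      fix w assume "w \<in> space (M n)"
      have "nearly m \<subseteq> nearly k" by (rule nearly_mono) (simp add: m_def)
      then show "\<bar>H (Y n w)\<bar> \<le> e/2 + B * indicator (space (M n) - A) w"
        using k[OF _ D, of n w] A(2)[of w] B[OF D, of n w] \<open>w \<in> space (M n)\<close> \<open>e > 0\<close>
        by (cases "w \<in> A") (auto simp: less_imp_le)
    qed
    also have "\<dots> = e/2 + B * (1 - measure (M n) A)"
      by (simp add: M.prob_space M.prob_compl M.emeasure_eq_measure)
    also have "\<dots> \<le> e/2 + B * (1 / real (Suc m))" using A(1) \<open>B \<ge> 0\<close> by (intro add_left_mono mult_left_mono) auto
    also have "\<dots> < e" using m by linarith
    finally show ?case by (simp add: dist_real_def)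
  qed
qed

text \<open>The limit law is found on the sample space and carried to \<open>C_paths\<close> by
  \<open>ext\<close>. For a test function \<open>f\<close>, the value \<open>f (Y n w)\<close> is
  compared with \<open>g (clip (Y n w))\<close>, where \<open>g\<close> extends
  \<open>f o ext\<close> from \<open>rat_paths\<close>; the mean difference vanishes by
  \<open>nearly_expectation\<close>, and the second term converges by weak convergence of the
  samples.\<close>

lemma weak_limit_exists:
  fixes Y :: "nat \<Rightarrow> 'w \<Rightarrow> real \<Rightarrow> 'a"
  assumes M: "\<And>n. prob_space (M n)" and Y: "\<And>n. Y n \<in> M n \<rightarrow>\<^sub>M borel_of D_topology"
    and D: "\<And>n w. Y n w \<in> D_paths"
    and coord[measurable]: "\<And>n t. (\<lambda>w. Y n w t) \<in> borel_measurable (M n)"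
    and tight: "\<And>m. \<forall>\<^sub>F n in sequentially. \<exists>A\<in>sets (M n). measure (M n) A \<ge> 1 - 1 / real (Suc m) \<and> (\<forall>w\<in>A. Y n w \<in> nearly m)"
  shows "\<exists>Q s. prob_space Q \<and> sets Q = sets (borel_of C_topology) \<and> strict_mono s \<and>
    weak_conv_on D_topology (\<lambda>j. distr (M (s j)) (borel_of D_topology) (Y (s j)))
      (distr Q (borel_of D_topology) (\<lambda>w. w))"
proof -
  have clip_meas[measurable]: "(\<lambda>w. clip (Y n w)) \<in> M n \<rightarrow>\<^sub>M borel" for n
  proof (rule measurable_coordinatewise_then_product)
    show "(\<lambda>w. clip (Y n w) q) \<in> borel_measurable (M n)" for q
      unfolding clip_def by measurable
  qed
  obtain s \<nu> where s: "strict_mono s" and "prob_space \<nu>" and sets_\<nu>[measurable_cong]: "sets \<nu> = sets borel"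
    and lim: "\<And>g B. continuous_on UNIV g \<Longrightarrow> (\<And>u. \<bar>g u\<bar> \<le> B) \<Longrightarrow>
      (\<lambda>n. \<integral>w. g (clip (Y (s n) w)) \<partial>M (s n)) \<longlonglongrightarrow> (\<integral>u. g u \<partial>\<nu> :: real)"
  proof (rule compact_subsequence_weak_limit[where X="\<lambda>n w. clip (Y n w)", OF compact_rat_box M clip_meas clip_in_box])
    fix s :: "nat \<Rightarrow> nat" and \<nu> :: "(rat \<Rightarrow> 'a) measure"
    assume "strict_mono s" "prob_space \<nu>" "sets \<nu> = sets borel"
      "\<And>g B. continuous_on UNIV g \<Longrightarrow> (\<And>u. \<bar>g u\<bar> \<le> B) \<Longrightarrow>
        (\<lambda>n. \<integral>w. g (clip (Y (s n) w)) \<partial>M (s n)) \<longlonglongrightarrow> (\<integral>u. g u \<partial>\<nu> :: real)"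
    then show thesis by (rule that)
  qed
  interpret \<nu>: prob_space \<nu> by fact
  have AE: "AE u in \<nu>. u \<in> rat_paths"
  proof -
    \<comment> \<open>A bounded continuous function whose zero set is the closed nonempty set
      \<open>rat_paths\<close>. The samples of \<open>Y n\<close> may lie outside this set, but
      their mean distance to it tends to 0.\<close>
    define g where "g u = min 1 (infdist u rat_paths)" for u
    have g: "continuous_on UNIV g" unfolding g_def by (intro continuous_intros)
    then have [measurable]: "g \<in> borel_measurable borel" by (rule borel_measurable_continuous_onI)
    have g1: "\<bar>g u\<bar> \<le> 1" for u using infdist_nonneg[of u rat_paths] unfolding g_def by auto
    have "(\<lambda>n. \<integral>w. g (clip (Y n w)) \<partial>M n) \<longlonglongrightarrow> 0"
    proof (rule nearly_expectation[OF M D tight _ g1 nearly_uniform])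
      fix v :: "nat \<Rightarrow> real \<Rightarrow> 'a" and u assume u: "u \<in> rat_paths" "(\<lambda>n. clip (v n)) \<longlonglongrightarrow> u"
      then have "(\<lambda>n. g (clip (v n))) \<longlonglongrightarrow> g u"
        by (intro continuous_on_tendsto_compose[OF g]) auto
      then show "(\<lambda>n. g (clip (v n))) \<longlonglongrightarrow> 0" using u by (simp add: g_def)
    qed measurable
    from LIMSEQ_subseq_LIMSEQ[OF this s] have "(\<lambda>n. \<integral>w. g (clip (Y (s n) w)) \<partial>M (s n)) \<longlonglongrightarrow> 0"
      by (simp add: comp_def)
    then have "(\<integral>u. g u \<partial>\<nu>) = 0" using lim[OF g g1] LIMSEQ_unique by blast
    moreover have "integrable \<nu> g"
      by (rule \<nu>.integrable_const_bound[where B=1]) (use g1 in auto)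
    ultimately have "AE u in \<nu>. g u = 0"
      by (subst (asm) integral_nonneg_eq_0_iff_AE) (auto simp: g_def infdist_nonneg)
    then show ?thesis
    proof (rule AE_mp, intro AE_I2 impI)
      fix u assume "g u = 0"
      then have "infdist u rat_paths = 0" unfolding g_def by (auto simp: min_def split: if_splits)
      with zero_rat_paths closed_rat_paths show "u \<in> rat_paths" using in_closed_iff_infdist_zero by blast
    qed
  qed
  define G where "G u = ext (if u \<in> rat_paths then u else (\<lambda>_. 0))" for u
  have G[measurable]: "G \<in> \<nu> \<rightarrow>\<^sub>M borel_of C_topology"
    using measurable_ext unfolding G_def[abs_def] by (simp cong: measurable_cong_sets add: sets_\<nu>)
  note measurable_C_D[measurable]
  note Y[measurable]
  have "weak_conv_on D_topology (\<lambda>j. distr (M (s j)) (borel_of D_topology) (Y (s j)))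
      (distr (distr \<nu> (borel_of C_topology) G) (borel_of D_topology) (\<lambda>w. w))"
    unfolding weak_conv_on_def
  proof (intro allI impI, elim conjE)
    fix f :: "(real \<Rightarrow> 'a) \<Rightarrow> real"
    assume f: "continuous_map D_topology euclideanreal f" and bnd: "bounded (f ` topspace D_topology)"
    note f_meas[measurable] = measurable_C_map_real[OF f]
    obtain B where B: "\<And>v. v \<in> D_paths \<Longrightarrow> \<bar>f v\<bar> \<le> B" using bnd by (auto simp: bounded_iff)
    have B0: "0 \<le> B" using B[OF D, of 0 undefined] by linarith
    have "norm (f (ext u)) \<le> B" if "u \<in> rat_paths" for u
      using B ext_C_paths[OF that] C_paths_subset_D_paths by auto
    then obtain g where g: "continuous_on UNIV g" "\<And>u. u \<in> rat_paths \<Longrightarrow> g u = f (ext u)" "\<And>u. \<bar>g u\<bar> \<le> B"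
      using Tietze[OF continuous_on_ext[OF f] _ B0, of UNIV] closed_rat_paths by auto
    have [measurable]: "g \<in> borel_measurable borel" using g(1) by (rule borel_measurable_continuous_onI)
    have "(\<lambda>n. \<integral>w. f (Y n w) - g (clip (Y n w)) \<partial>M n) \<longlonglongrightarrow> 0"
    proof (rule nearly_expectation[OF M D tight _ _ nearly_uniform])
      show "\<bar>f v - g (clip v)\<bar> \<le> 2 * B" if "v \<in> D_paths" for v
        using B[OF that] g(3)[of "clip v"] by linarith
      show "(\<lambda>w. f (Y n w) - g (clip (Y n w))) \<in> borel_measurable (M n)" for n by measurable
      fix v :: "nat \<Rightarrow> real \<Rightarrow> 'a" and u
      assume v: "\<And>n. v n \<in> D_paths" "u \<in> rat_paths" "(\<lambda>n. clip (v n)) \<longlonglongrightarrow> u"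
        "\<And>T e. e > 0 \<Longrightarrow> \<forall>\<^sub>F n in sequentially. \<forall>t\<in>{0..T}. dist (v n t) (ext u t) < e"
      have "(\<lambda>n. f (v n)) \<longlonglongrightarrow> f (ext u)"
        using ext_C_paths[OF v(2)] C_paths_subset_D_paths
        by (intro D_continuous_uniform_limit[OF f v(1) _ v(4)]) auto
      moreover have "(\<lambda>n. g (clip (v n))) \<longlonglongrightarrow> g u"
        using v(3) by (intro continuous_on_tendsto_compose[OF g(1)]) auto
      ultimately have "(\<lambda>n. f (v n) - g (clip (v n))) \<longlonglongrightarrow> f (ext u) - g u" by (rule tendsto_diff)
      then show "(\<lambda>n. f (v n) - g (clip (v n))) \<longlonglongrightarrow> 0" using g(2)[OF v(2)] by simp
    qed
    from LIMSEQ_subseq_LIMSEQ[OF this s]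
    have "(\<lambda>n. \<integral>w. f (Y (s n) w) - g (clip (Y (s n) w)) \<partial>M (s n)) \<longlonglongrightarrow> 0"
      by (simp add: comp_def)
    from tendsto_add[OF this lim[OF g(1,3)]]
    have "(\<lambda>n. (\<integral>w. f (Y (s n) w) - g (clip (Y (s n) w)) \<partial>M (s n)) + (\<integral>w. g (clip (Y (s n) w)) \<partial>M (s n)))
      \<longlonglongrightarrow> (\<integral>u. g u \<partial>\<nu>)" by simp
    moreover have "(\<integral>w. f (Y n w) - g (clip (Y n w)) \<partial>M n) + (\<integral>w. g (clip (Y n w)) \<partial>M n)
        = (\<integral>v. f v \<partial>distr (M n) (borel_of D_topology) (Y n))" for n
    proof -
      interpret M: prob_space "M n" by (rule M)
      have "integrable (M n) (\<lambda>w. f (Y n w))"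
        by (rule M.integrable_const_bound[where B=B]) (use B D in auto)
      moreover have "integrable (M n) (\<lambda>w. g (clip (Y n w)))"
        by (rule M.integrable_const_bound[where B=B]) (use g(3) in auto)
      ultimately show ?thesis by (subst integral_distr) auto
    qed
    moreover have "(\<integral>u. g u \<partial>\<nu>) = (\<integral>v. f v \<partial>distr (distr \<nu> (borel_of C_topology) G) (borel_of D_topology) (\<lambda>w. w))"
    proof -
      have GD[measurable]: "G \<in> \<nu> \<rightarrow>\<^sub>M borel_of D_topology"
        using measurable_comp[OF G measurable_C_D] by (simp add: comp_def)
      have "(\<integral>u. g u \<partial>\<nu>) = (\<integral>u. f (G u) \<partial>\<nu>)"
      proof (rule integral_cong_AE)
        show "AE u in \<nu>. g u = f (G u)" using AE by eventually_elim (simp add: G_def g(2))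
      qed measurable
      also have "\<dots> = (\<integral>v. f v \<partial>distr \<nu> (borel_of D_topology) G)" by (subst integral_distr) auto
      finally show ?thesis by (subst distr_distr) (auto simp: comp_def)
    qed
    ultimately show "(\<lambda>n. \<integral>w. f w \<partial>distr (M (s n)) (borel_of D_topology) (Y (s n))) \<longlonglongrightarrow>
      (\<integral>w. f w \<partial>distr (distr \<nu> (borel_of C_topology) G) (borel_of D_topology) (\<lambda>w. w))" by simp
  qed
  moreover have "prob_space (distr \<nu> (borel_of C_topology) G)" by (rule \<nu>.prob_space_distr) (rule G)
  ultimately show ?thesis using s by (intro exI[of _ "distr \<nu> (borel_of C_topology) G"] exI[of _ s]) auto
qed

end

section \<open>Step paths and deviation from a constant path\<close>

text \<open>The scaled path as a deterministic function of the whole sequence \<open>y\<close>.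
  Measurability of the random path becomes a property of this one map.\<close>

definition step_path :: "real \<Rightarrow> real \<Rightarrow> (nat \<Rightarrow> 'a::euclidean_space) \<Rightarrow> real \<Rightarrow> 'a" where
  "step_path a c y = (\<lambda>t\<in>{0..}. a *\<^sub>R y (nat \<lfloor>t * c\<rfloor>))"

lemma step_path_D_paths:
  assumes "c \<ge> 0"
  shows "step_path a c y \<in> D_paths"
proof (cases "c = 0")
  \<comment> \<open>This case occurs: \<open>r powr (1 + \<alpha>)\<close> is 0 for
    \<open>r = 0\<close>, and the sequence of scales may contain 0.\<close>
  case True
  have "continuous_on {0..} (step_path a c y)"
    by (rule continuous_on_eq[OF continuous_on_const[of _ "a *\<^sub>R y 0"]]) (simp add: step_path_def True)
  then have "step_path a c y \<in> C_paths"
    unfolding C_paths_def by (simp add: step_path_def)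
  then show ?thesis using C_paths_subset_D_paths by blast
next
  case False
  with assms have c: "c > 0" by simp
  show ?thesis unfolding D_paths_def
  proof (intro CollectI conjI allI impI)
    show "step_path a c y \<in> extensional {0..}" by (simp add: step_path_def)
    fix t :: real assume t: "t \<ge> 0"
    have "\<forall>\<^sub>F s in at_right t. s \<in> {t<..<(of_int \<lfloor>t * c\<rfloor> + 1) / c}"
      using c by (intro eventually_at_right_real) (simp add: pos_less_divide_eq)
    then have "\<forall>\<^sub>F s in at_right t. step_path a c y t = step_path a c y s"
    proof eventually_elim
      case (elim s)
      then have "\<lfloor>s * c\<rfloor> = \<lfloor>t * c\<rfloor>"
        using c by (intro floor_unique) (auto simp: pos_less_divide_eq intro: order_trans[OF of_int_floor_le] mult_right_mono)
      with t elim show ?case by (simp add: step_path_def)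
    qed
    then show "continuous (at_right t) (step_path a c y)"
      unfolding continuous_within by (rule Lim_transform_eventually[OF tendsto_const])
  next
    fix t :: real assume t: "t > 0"
    \<comment> \<open>The largest integer strictly below \<open>t * c\<close>. At a jump time, where
      \<open>t * c\<close> is an integer, the left limit is the preceding value, which the floor of
      \<open>t * c\<close> would miss.\<close>
    define m where "m = \<lceil>t * c\<rceil> - 1"
    have "0 < t * c" using t c by simp
    then have "m \<ge> 0" unfolding m_def by linarith
    have "of_int m < t * c" unfolding m_def by linarith
    then have "\<forall>\<^sub>F s in at_left t. s \<in> {of_int m / c<..<t}"
      using c by (intro eventually_at_left_real) (simp add: pos_divide_less_eq)
    then have "\<forall>\<^sub>F s in at_left t. a *\<^sub>R y (nat m) = step_path a c y s"
    proof eventually_elim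
      case (elim s)
      have "s * c < t * c" "of_int m < s * c" using elim c by (auto simp: pos_divide_less_eq)
      then have "\<lfloor>s * c\<rfloor> = m" unfolding m_def by (intro floor_unique) linarith+
      moreover have "s > 0"
        using elim c \<open>m \<ge> 0\<close> by (auto intro: le_less_trans[of 0 "of_int m / c"])
      ultimately show ?case by (simp add: step_path_def)
    qed
    then show "\<exists>l. (step_path a c y \<longlongrightarrow> l) (at_left t)"
      by (intro exI) (rule Lim_transform_eventually[OF tendsto_const])
  qed
qed

text \<open>On [0, T] the path depends on finitely many entries of the sequence, so the map is
  continuous from the product topology to \<open>D_topology\<close>. Borel measurability follows
  from the open sets directly, without describing them through evaluations at fixed times.\<close>

lemma measurable_step_path:
  fixes \<Phi> :: "nat \<Rightarrow> 'w \<Rightarrow> 'a::euclidean_space"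
  assumes "c \<ge> 0" and \<Phi>: "\<And>k. \<Phi> k \<in> M \<rightarrow>\<^sub>M borel"
  shows "(\<lambda>w. step_path a c (\<lambda>k. \<Phi> k w)) \<in> M \<rightarrow>\<^sub>M borel_of D_topology"
proof -
  let ?G = "step_path a c :: (nat \<Rightarrow> 'a) \<Rightarrow> real \<Rightarrow> 'a"
  have "?G \<in> borel \<rightarrow>\<^sub>M borel_of D_topology"
  proof (rule measurable_sigma_sets[OF sets_borel_of])
    show "{U. openin D_topology U} \<subseteq> Pow (topspace (D_topology :: (real \<Rightarrow> 'a) topology))"
      by (auto dest!: openin_subset)
    show "?G \<in> space borel \<rightarrow> topspace D_topology"
      using step_path_D_paths[OF assms(1)] by auto
    fix U :: "(real \<Rightarrow> 'a) set" assume "U \<in> {U. openin D_topology U}"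
    then have U: "\<And>w. w \<in> U \<Longrightarrow> \<exists>T>0. \<exists>e>0. J1_nhd T e w \<subseteq> U" unfolding openin_D_topology by blast
    have "closed {y. ?G y \<notin> U}"
      unfolding closed_sequential_limits
    proof (intro allI impI, elim conjE)
      fix y l assume y: "\<forall>n. y n \<in> {y. ?G y \<notin> U}" and lim: "y \<longlonglongrightarrow> l"
      have "?G l \<notin> U"
      proof
        assume "?G l \<in> U"
        then obtain T e where Te: "e > 0" "J1_nhd T e (?G l) \<subseteq> U" using U by blast
        have "\<forall>\<^sub>F n in sequentially. dist (a *\<^sub>R y n k) (a *\<^sub>R l k) < e" for k
          using lim \<open>e > 0\<close> unfolding tendsto_fun_iff by (intro tendstoD tendsto_intros) auto
        then have "\<forall>\<^sub>F n in sequentially. \<forall>k\<le>nat \<lfloor>T * c\<rfloor>. dist (a *\<^sub>R y n k) (a *\<^sub>R l k) < e"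
          by (simp add: eventually_ball_finite_distrib Ball_def[symmetric] atMost_def[symmetric] flip: atMost_iff)
        then obtain n where n: "\<And>k. k \<le> nat \<lfloor>T * c\<rfloor> \<Longrightarrow> dist (a *\<^sub>R y n k) (a *\<^sub>R l k) < e"
          unfolding eventually_sequentially by blast
        have "dist (?G (y n) t) (?G l t) < e" if "t \<in> {0..T}" for t
          using n[of "nat \<lfloor>t * c\<rfloor>"] that \<open>c \<ge> 0\<close> unfolding step_path_def
          by (auto intro!: nat_mono floor_mono mult_right_mono)
        moreover have "(\<lambda>t. t) \<in> time_changes"
          unfolding time_changes_def by (simp add: strict_mono_on_def)
        ultimately have "?G (y n) \<in> J1_nhd T e (?G l)"
          unfolding J1_nhd_def using \<open>e > 0\<close> step_path_D_paths[OF assms(1)]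
          by (intro CollectI conjI bexI[of _ "\<lambda>t. t"]) simp_all
        with Te y show False by blast
      qed
      then show "l \<in> {y. ?G y \<notin> U}" by blast
    qed
    then have "open (- {y. ?G y \<notin> U})" by blast
    moreover have "?G -` U \<inter> space borel = - {y. ?G y \<notin> U}" by auto
    ultimately show "?G -` U \<inter> space borel \<in> sets borel" by simp
  qed
  moreover have "(\<lambda>w k. \<Phi> k w) \<in> M \<rightarrow>\<^sub>M borel"
    by (rule measurable_coordinatewise_then_product[OF \<Phi>])
  ultimately show ?thesis by (rule measurable_compose[rotated])
qed

text \<open>A supremum over all times is compatible with time changes, and the decreasing weight makes late
  times negligible; so this is continuous in the Skorokhod topology.\<close>

definition const_dev :: "'a::euclidean_space \<Rightarrow> (real \<Rightarrow> 'a) \<Rightarrow> real" where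
  "const_dev x w = (SUP t\<in>{0..}. min 1 (dist (w t) x) / (1 + t))"

lemma const_dev_term:
  fixes t :: real
  assumes "t \<ge> 0"
  shows "0 \<le> min 1 (dist (w t) x) / (1 + t)" "min 1 (dist (w t) x) / (1 + t) \<le> 1 / (1 + t)"
    "min 1 (dist (w t) x) / (1 + t) \<le> 1" "min 1 (dist (w t) x) / (1 + t) \<le> dist (w t) x"
proof -
  show 2: "min 1 (dist (w t) x) / (1 + t) \<le> 1 / (1 + t)" using assms by (intro divide_right_mono) auto
  show "0 \<le> min 1 (dist (w t) x) / (1 + t)" using assms by simp
  have "1 / (1 + t) \<le> 1" using assms by simp
  with 2 show "min 1 (dist (w t) x) / (1 + t) \<le> 1" by linarith
  have "min 1 (dist (w t) x) / (1 + t) \<le> min 1 (dist (w t) x) / 1"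
    using assms by (intro divide_left_mono) auto
  then show "min 1 (dist (w t) x) / (1 + t) \<le> dist (w t) x" by linarith
qed

lemma const_dev_upper: "t \<ge> 0 \<Longrightarrow> min 1 (dist (w t) x) / (1 + t) \<le> const_dev x w"
  unfolding const_dev_def using const_dev_term(3) by (intro cSUP_upper bdd_aboveI2[of _ _ 1]) auto

lemma const_dev_least: "(\<And>t. t \<ge> 0 \<Longrightarrow> min 1 (dist (w t) x) / (1 + t) \<le> b) \<Longrightarrow> const_dev x w \<le> b"
  unfolding const_dev_def by (intro cSUP_least) auto

lemma const_dev_bounds: "0 \<le> const_dev x w" "const_dev x w \<le> 1"
proof -
  show "const_dev x w \<le> 1" by (intro const_dev_least const_dev_term(3))
  show "0 \<le> const_dev x w" using const_dev_upper[of 0 w x] const_dev_term(1)[of 0 w x] by linarith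
qed

lemma const_dev_eq_0:
  assumes "const_dev x w = 0" "w \<in> extensional {0..}"
  shows "w = (\<lambda>t\<in>{0..}. x)"
proof (rule extensionalityI[OF assms(2)])
  fix t :: real assume t: "t \<in> {0..}"
  then have "min 1 (dist (w t) x) / (1 + t) \<le> 0" using const_dev_upper[of t w x] assms(1) by simp
  moreover have "1 + t > 0" using t by simp
  ultimately have "dist (w t) x \<le> 0" by (simp add: divide_le_0_iff min_le_iff_disj)
  with t show "w t = (\<lambda>t\<in>{0..}. x) t" by simp
qed simp

lemma const_dev_small:
  assumes "0 \<le> T" "1 / (1 + T) \<le> e" "\<And>t. t \<in> {0..T} \<Longrightarrow> dist (w t) x \<le> e"
  shows "const_dev x w \<le> e"
proof (rule const_dev_least)
  fix t :: real assume t: "t \<ge> 0"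
  show "min 1 (dist (w t) x) / (1 + t) \<le> e"
  proof (cases "t \<le> T")
    case True
    with t have "dist (w t) x \<le> e" using assms(3) by simp
    with const_dev_term(4)[OF t, of w x] show ?thesis by linarith
  next
    case False
    then have "1 / (1 + t) \<le> 1 / (1 + T)" using \<open>0 \<le> T\<close> by (intro divide_left_mono) auto
    with const_dev_term(2)[OF t, of w x] assms(2) show ?thesis by linarith
  qed
qed

text \<open>One \<open>e\<close> comes from the numerators, the other from the weight 1/(1+t), which
  is 1-Lipschitz on nonnegative times.\<close>

lemma const_dev_term_close:
  fixes s t :: real
  assumes st: "s \<ge> 0" "t \<ge> 0" "\<bar>s - t\<bar> \<le> e" and "dist (v s) (w t) \<le> e"
  shows "\<bar>min 1 (dist (v s) x) / (1 + s) - min 1 (dist (w t) x) / (1 + t)\<bar> \<le> 2 * e"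
proof -
  let ?a = "min 1 (dist (v s) x)" and ?b = "min 1 (dist (w t) x)"
  have "\<bar>dist (v s) x - dist (w t) x\<bar> \<le> dist (v s) (w t)"
    by (metis abs_dist_diff_le dist_commute)
  then have ab: "\<bar>?a - ?b\<bar> \<le> e" using assms(4) by linarith
  have "\<bar>?a / (1 + s) - ?b / (1 + s)\<bar> = \<bar>?a - ?b\<bar> / (1 + s)" using st by (simp add: diff_divide_distrib[symmetric])
  also have "\<dots> \<le> \<bar>?a - ?b\<bar> / 1" using st by (intro divide_left_mono) auto
  finally have 1: "\<bar>?a / (1 + s) - ?b / (1 + s)\<bar> \<le> e" using ab by simp
  have "?b / (1 + s) - ?b / (1 + t) = ?b * ((t - s) / ((1 + s) * (1 + t)))" using st by (simp add: field_simps)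
  then have "\<bar>?b / (1 + s) - ?b / (1 + t)\<bar> = ?b * (\<bar>t - s\<bar> / ((1 + s) * (1 + t)))"
    using st by (simp add: abs_mult)
  also have "\<dots> \<le> 1 * (\<bar>t - s\<bar> / 1)"
  proof (intro mult_mono divide_left_mono)
    have "1 * 1 \<le> (1 + s) * (1 + t)" using st by (intro mult_mono) auto
    then show "1 \<le> (1 + s) * (1 + t)" by simp
  qed (use st in auto)
  finally have "\<bar>?b / (1 + s) - ?b / (1 + t)\<bar> \<le> e" using st(3) by (simp add: abs_minus_commute)
  with 1 show ?thesis by linarith
qed

lemma const_dev_J1_close:
  assumes e: "0 < e" "e < 1" and T: "1 / T \<le> e" "T > 0" and v: "v \<in> J1_nhd T e w"
  shows "\<bar>const_dev x v - const_dev x w\<bar> \<le> 2 * e"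
proof -
  obtain l where l: "l \<in> time_changes" "\<And>t. t \<ge> 0 \<Longrightarrow> \<bar>l t - t\<bar> < e"
    "\<And>t. t \<in> {0..T} \<Longrightarrow> dist (v (l t)) (w t) < e"
    using v unfolding J1_nhd_def by blast
  have l0: "l ` {0..} = {0..}" using l(1) unfolding time_changes_def by blast
  have close: "\<bar>min 1 (dist (v (l t)) x) / (1 + l t) - min 1 (dist (w t) x) / (1 + t)\<bar> \<le> 2 * e"
    if t: "t \<ge> 0" for t
  proof -
    have lt: "l t \<ge> 0" using l0 t by auto
    show ?thesis
    proof (cases "t \<le> T")
      case True
      with l(2)[OF t] l(3)[of t] t lt show ?thesis by (intro const_dev_term_close) auto
    next
      case False
      have "1 / (1 + t) \<le> 1 / T" using False T by (intro divide_left_mono) auto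
      \<comment> \<open>As \<open>l t > t - e\<close> and \<open>e < 1\<close>, one has
        \<open>1 + l t > t > T\<close>.\<close>
      moreover have "1 / (1 + l t) \<le> 1 / T" using False T l(2)[OF t] e by (intro divide_left_mono) auto
      ultimately show ?thesis
        using const_dev_term(1,2)[OF lt, of v x] const_dev_term(1,2)[OF t, of w x] T by (simp add: abs_le_iff)
    qed
  qed
  have "const_dev x w \<le> const_dev x v + 2 * e"
  proof (rule const_dev_least)
    fix t :: real assume t: "t \<ge> 0"
    then have "l t \<ge> 0" using l0 by auto
    from const_dev_upper[OF this, of v x] close[OF t]
    show "min 1 (dist (w t) x) / (1 + t) \<le> const_dev x v + 2 * e" by linarith
  qed
  moreover have "const_dev x v \<le> const_dev x w + 2 * e"
  proof (rule const_dev_least)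
    fix s :: real assume "s \<ge> 0"
    \<comment> \<open>Surjectivity of the time change: every time of \<open>v\<close> is some
      \<open>l t\<close>.\<close>
    with l0 obtain t where t: "s = l t" "t \<ge> 0" by (metis atLeast_iff imageE)
    from const_dev_upper[OF t(2), of w x] close[OF t(2)]
    show "min 1 (dist (v s) x) / (1 + s) \<le> const_dev x w + 2 * e" unfolding t(1) by linarith
  qed
  ultimately show ?thesis by linarith
qed

lemma continuous_map_const_dev: "continuous_map D_topology euclideanreal (const_dev x)"
  unfolding continuous_map_def
proof (intro conjI allI impI)
  fix U :: "real set" assume "openin euclideanreal U"
  then have U: "open U" by simp
  show "openin D_topology {w \<in> topspace D_topology. const_dev x w \<in> U}"
    unfolding openin_D_topology topspace_D_topology
  proof (intro conjI ballI)
    fix w assume "w \<in> {w \<in> D_paths. const_dev x w \<in> U}"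
    with U obtain d where d: "d > 0" "\<And>y. \<bar>y - const_dev x w\<bar> < d \<Longrightarrow> y \<in> U"
      unfolding open_dist dist_real_def by blast
    \<comment> \<open>1/2 ensures \<open>e < 1\<close>, as \<open>const_dev_J1_close\<close>
      requires, and d/3 ensures \<open>2 * e < d\<close>.\<close>
    define e where "e = min (1/2) (d/3)"
    have e: "0 < e" "e < 1" "2 * e < d" using d(1) by (auto simp: e_def)
    have "J1_nhd (1/e) e w \<subseteq> {w \<in> D_paths. const_dev x w \<in> U}"
    proof
      fix v assume v: "v \<in> J1_nhd (1/e) e w"
      have "\<bar>const_dev x v - const_dev x w\<bar> \<le> 2 * e"
        by (rule const_dev_J1_close[OF e(1,2) _ _ v]) (use e in auto)
      with d(2) e have "const_dev x v \<in> U" by simp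
      with v show "v \<in> {w \<in> D_paths. const_dev x w \<in> U}" unfolding J1_nhd_def by simp
    qed
    then show "\<exists>T>0. \<exists>e>0. J1_nhd T e w \<subseteq> {w \<in> D_paths. const_dev x w \<in> U}"
      using e(1) by (intro exI[of _ "1/e"] conjI exI[of _ e]) auto
  qed blast
qed simp

section \<open>A maximal inequality for the noise of a Markov chain\<close>

definition pseudo_norm :: "'a::real_inner \<Rightarrow> real" where
  "pseudo_norm s = sqrt (1 + (norm s)\<^sup>2) - 1"

lemma pseudo_norm_nonneg: "pseudo_norm s \<ge> 0"
  unfolding pseudo_norm_def by simp

lemma pseudo_norm_0 [simp]: "pseudo_norm 0 = 0"
  unfolding pseudo_norm_def by simp

lemma pseudo_norm_pos: "s \<noteq> 0 \<Longrightarrow> pseudo_norm s > 0"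
  unfolding pseudo_norm_def by (simp add: real_less_rsqrt)

lemma pseudo_norm_add_linear: "pseudo_norm (s + e) \<le> pseudo_norm s + norm e"
proof -
  let ?R = "sqrt (1 + (norm s)\<^sup>2)"
  have "norm s \<le> ?R" by (intro real_le_rsqrt) simp
  have "1 + (norm (s + e))\<^sup>2 \<le> 1 + (norm s + norm e)\<^sup>2"
    by (simp add: norm_triangle_ineq power_mono)
  also have "\<dots> = 1 + (norm s)\<^sup>2 + 2 * norm s * norm e + (norm e)\<^sup>2" by (simp add: power2_sum)
  also have "\<dots> \<le> 1 + (norm s)\<^sup>2 + 2 * ?R * norm e + (norm e)\<^sup>2"
    using \<open>norm s \<le> ?R\<close> by (intro add_mono mult_right_mono) auto
  also have "\<dots> = (?R + norm e)\<^sup>2" by (simp add: power2_sum add_nonneg_nonneg)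
  finally have "sqrt (1 + (norm (s + e))\<^sup>2) \<le> ?R + norm e" by (intro real_le_lsqrt) auto
  then show ?thesis unfolding pseudo_norm_def by simp
qed

text \<open>The square root lies below its tangent at 1 + |s|^2. The linear term is the gradient
  applied to \<open>e\<close>, so it has mean zero for a centred increment.\<close>

lemma pseudo_norm_add_quadratic:
  "pseudo_norm (s + e) \<le> pseudo_norm s + (s \<bullet> e) / sqrt (1 + (norm s)\<^sup>2) + (norm e)\<^sup>2"
proof -
  let ?R = "sqrt (1 + (norm s)\<^sup>2)"
  let ?B = "2 * (s \<bullet> e) + (norm e)\<^sup>2"
  have R: "?R \<ge> 1" "?R\<^sup>2 = 1 + (norm s)\<^sup>2" by (auto simp: add_nonneg_nonneg)
  have eq: "1 + (norm (s + e))\<^sup>2 = ?R\<^sup>2 + ?B"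
    unfolding R(2) power2_norm_eq_inner by (simp add: inner_add inner_commute)
  have "?R\<^sup>2 + ?B \<ge> 0" unfolding eq[symmetric] by simp
  then have "?R + ?B / (2 * ?R) \<ge> 0"
  proof -
    have "x + b / (2 * x) = (x\<^sup>2 + (x\<^sup>2 + b)) / (2 * x)" if "x \<ge> 1" for x b :: real
      using that by (simp add: field_simps power2_eq_square)
    from this[OF R(1)] have "?R + ?B / (2 * ?R) = (?R\<^sup>2 + (?R\<^sup>2 + ?B)) / (2 * ?R)" .
    also have "\<dots> \<ge> 0"
      by (intro divide_nonneg_nonneg add_nonneg_nonneg[OF zero_le_power2 \<open>?R\<^sup>2 + ?B \<ge> 0\<close>]) (use R(1) in linarith)
    finally show ?thesis .
  qed
  moreover have "?R\<^sup>2 + ?B \<le> (?R + ?B / (2 * ?R))\<^sup>2"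
  proof -
    have "(x + b / (2 * x))\<^sup>2 = x\<^sup>2 + b + (b / (2 * x))\<^sup>2" if "x \<ge> 1" for x b :: real
      using that by (simp add: power2_sum)
    from this[OF R(1)] have "(?R + ?B / (2 * ?R))\<^sup>2 = ?R\<^sup>2 + ?B + (?B / (2 * ?R))\<^sup>2" .
    then show ?thesis by simp
  qed
  ultimately have "sqrt (1 + (norm (s + e))\<^sup>2) \<le> ?R + ?B / (2 * ?R)"
    unfolding eq by (intro real_le_lsqrt) auto
  also have "?B / (2 * ?R) = (s \<bullet> e) / ?R + (norm e)\<^sup>2 / (2 * ?R)" by (simp add: add_divide_distrib)
  also have "(norm e)\<^sup>2 / (2 * ?R) \<le> (norm e)\<^sup>2 / 1"
  proof -
    have "1 \<le> 2 * ?R" "0 < 2 * ?R" using R(1) by linarith+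
    then show ?thesis by (intro divide_left_mono mult_pos_pos) simp_all
  qed
  finally show ?thesis unfolding pseudo_norm_def by simp
qed

text \<open>For |e| <= 1 the quadratic bound applies and |e|^2 <= |e|^q. For |e| > 1 the linear
  bound applies and |e| <= |e|^q; the inner product term may be as low as -|e| there, which has to
  be made up for and gives the factor 2.\<close>

lemma pseudo_norm_step:
  assumes q: "1 \<le> q" "q \<le> 2"
  shows "pseudo_norm (s + e) \<le> pseudo_norm s + (s \<bullet> e) / sqrt (1 + (norm s)\<^sup>2) + 2 * norm e powr q"
proof (cases "norm e \<le> 1")
  case True
  have "(norm e)\<^sup>2 \<le> norm e powr q"
  proof (cases "norm e = 0")
    case False
    then have "(norm e)\<^sup>2 = norm e powr 2" by (simp add: powr_numeral)
    also have "\<dots> \<le> norm e powr q" using True q False by (intro powr_mono') auto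
    finally show ?thesis .
  qed simp
  moreover have "norm e powr q \<ge> 0" by simp
  ultimately show ?thesis using pseudo_norm_add_quadratic[of s e] by linarith
next
  case False
  let ?R = "sqrt (1 + (norm s)\<^sup>2)"
  have R: "norm s \<le> ?R" "?R > 0" by (auto intro!: real_le_rsqrt simp: add_pos_nonneg)
  have "\<bar>s \<bullet> e\<bar> \<le> norm s * norm e" by (rule Cauchy_Schwarz_ineq2)
  also have "\<dots> \<le> ?R * norm e" using R by (intro mult_right_mono) auto
  finally have "\<bar>(s \<bullet> e) / ?R\<bar> \<le> norm e" using R(2) by (simp add: abs_divide pos_divide_le_eq mult.commute)
  moreover have "norm e \<le> norm e powr q" using powr_mono[of 1 q "norm e"] False q by simp
  ultimately show ?thesis using pseudo_norm_add_linear[of s e] by linarith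
qed

lemma borel_measurable_pseudo_norm [measurable]:
  "pseudo_norm \<in> borel_measurable (borel :: 'a::euclidean_space measure)"
  unfolding pseudo_norm_def[abs_def] by measurable

text \<open>The linear term of \<open>pseudo_norm_step\<close> integrates to 0 because the increment
  is centred, and homogeneity of the q-th power yields \<open>r powr (-q)\<close>.\<close>

lemma nn_integral_pseudo_norm_step:
  fixes \<mu> :: "'a::euclidean_space measure"
  assumes \<mu>: "prob_space \<mu>" and [measurable_cong]: "sets \<mu> = sets borel"
    and int: "integrable \<mu> (\<lambda>y. y)"
    and q: "1 \<le> q" "q \<le> 2" and r: "r > 0" and M: "M \<ge> 0"
    and mom: "(\<integral>\<^sup>+y. ennreal (norm (y - (\<integral>y. y \<partial>\<mu>)) powr q) \<partial>\<mu>) \<le> ennreal M"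
  shows "(\<integral>\<^sup>+y. ennreal (pseudo_norm (s + inverse r *\<^sub>R (y - (\<integral>y. y \<partial>\<mu>)))) \<partial>\<mu>)
    \<le> ennreal (pseudo_norm s + 2 * M * r powr (-q))"
proof -
  interpret prob_space \<mu> by fact
  let ?m = "\<integral>y. y \<partial>\<mu>"
  let ?e = "\<lambda>y. inverse r *\<^sub>R (y - ?m)"
  let ?R = "sqrt (1 + (norm s)\<^sup>2)"
  have pq: "norm (?e y) powr q = r powr (-q) * norm (y - ?m) powr q" for y
    using r by (simp add: powr_mult powr_minus inverse_powr)
  have int_e: "integrable \<mu> ?e" using int by (intro integrable_scaleR_right Bochner_Integration.integrable_diff) auto
  have int_q: "integrable \<mu> (\<lambda>y. norm (y - ?m) powr q)"
    using mom by (intro integrableI_nonneg) (auto simp: order_le_less_trans)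
  have le_q: "(\<integral>y. norm (y - ?m) powr q \<partial>\<mu>) \<le> M"
    using mom M by (subst (asm) nn_integral_eq_integral[OF int_q]) auto
  let ?g = "\<lambda>y. pseudo_norm s + (s \<bullet> ?e y) / ?R + 2 * (r powr (-q) * norm (y - ?m) powr q)"
  have le: "pseudo_norm (s + ?e y) \<le> ?g y" for y
    using pseudo_norm_step[OF q, of s "?e y"] unfolding pq .
  have int_g: "integrable \<mu> ?g"
    using int_e int_q by (intro Bochner_Integration.integrable_add integrable_divide integrable_inner_right integrable_mult_right) auto
  have "(\<integral>\<^sup>+y. ennreal (pseudo_norm (s + ?e y)) \<partial>\<mu>) \<le> (\<integral>\<^sup>+y. ennreal (?g y) \<partial>\<mu>)"
    by (intro nn_integral_mono ennreal_leI le)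
  also have "\<dots> = ennreal (\<integral>y. ?g y \<partial>\<mu>)"
    by (rule nn_integral_eq_integral[OF int_g]) (intro AE_I2 order_trans[OF pseudo_norm_nonneg le])
  also have "(\<integral>y. ?g y \<partial>\<mu>) = pseudo_norm s + (s \<bullet> (\<integral>y. ?e y \<partial>\<mu>)) / ?R + 2 * (r powr (-q) * (\<integral>y. norm (y - ?m) powr q \<partial>\<mu>))"
    using int_e int_q by (simp add: prob_space del: inner_scaleR_right integral_scaleR_right)
  also have "(\<integral>y. ?e y \<partial>\<mu>) = 0" using int by (simp add: prob_space)
  also have "pseudo_norm s + (s \<bullet> 0) / ?R + 2 * (r powr (-q) * (\<integral>y. norm (y - ?m) powr q \<partial>\<mu>)) \<le>
    pseudo_norm s + 2 * M * r powr (-q)"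
    using mult_left_mono[OF le_q, of "r powr (-q)"] by (simp add: algebra_simps)
  finally show ?thesis by (simp add: ennreal_leI)
qed

text \<open>Meant for \<open>\<F> 0\<close>, which is trivial because the chain starts at a fixed
  point almost surely.\<close>

lemma real_cond_exp_trivial:
  fixes f :: "'w \<Rightarrow> real"
  assumes M: "prob_space M" and F: "subalgebra M F" and int: "integrable M f"
    and triv: "\<And>A. A \<in> sets F \<Longrightarrow> (AE w in M. w \<in> A) \<or> (AE w in M. w \<notin> A)"
  shows "AE w in M. real_cond_exp M F f w = (\<integral>w. f w \<partial>M)"
proof -
  interpret prob_space M by fact
  interpret finite_measure_subalgebra M F by standard (rule F)
  show ?thesis
  proof (rule real_cond_exp_charact)
    fix A assume A: "A \<in> sets F"
    then have [measurable]: "A \<in> sets M" using F unfolding subalgebra_def by blast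
    have [measurable]: "f \<in> borel_measurable M" using int by simp
    from triv[OF A] show "(\<integral>w\<in>A. f w \<partial>M) = (\<integral>w\<in>A. (\<integral>w. f w \<partial>M) \<partial>M)"
    proof
      assume AE: "AE w in M. w \<in> A"
      have "(\<integral>w\<in>A. g w \<partial>M) = (\<integral>w. g w \<partial>M)" if [measurable]: "g \<in> borel_measurable M" for g :: "'w \<Rightarrow> real"
        unfolding set_lebesgue_integral_def by (rule integral_cong_AE) (use AE in auto)
      then show ?thesis by (simp add: prob_space)
    next
      assume AE: "AE w in M. w \<notin> A"
      have "(\<integral>w\<in>A. g w \<partial>M) = (\<integral>w. 0 \<partial>M)" if [measurable]: "g \<in> borel_measurable M" for g :: "'w \<Rightarrow> real"
        unfolding set_lebesgue_integral_def by (rule integral_cong_AE) (use AE in auto)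
      then show ?thesis by simp
    qed
  qed (use int in auto)
qed

section \<open>The Markov property with respect to the whole history\<close>

locale integrable_chain =
  fixes P :: "'a::euclidean_space \<Rightarrow> 'a measure" and \<Omega> :: "'w measure"
    and PP :: "'a \<Rightarrow> 'w measure" and \<Phi> :: "nat \<Rightarrow> 'w \<Rightarrow> 'a"
  assumes chain: "markov_chain P \<Omega> PP \<Phi>" and integrable_1: "\<And>x. integrable (PP x) (\<Phi> 1)"
begin

abbreviation \<F> :: "nat \<Rightarrow> 'w measure" where "\<F> \<equiv> natural_filtration \<Omega> \<Phi>"

definition mean :: "'a \<Rightarrow> 'a" where "mean x = (\<integral>y. y \<partial>P x)"

lemma measurable_kernel [measurable]: "P \<in> borel \<rightarrow>\<^sub>M prob_algebra borel"
  using chain unfolding markov_chain_def by blast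

lemma prob_space_kernel: "prob_space (P x)" and sets_kernel [measurable_cong]: "sets (P x) = sets borel"
  using measurable_space[OF measurable_kernel, of x] by (auto simp: space_prob_algebra)

lemma prob_space_PP: "prob_space (PP x)" and sets_PP [measurable_cong]: "sets (PP x) = sets \<Omega>"
  using chain unfolding markov_chain_def by blast+

lemma space_PP: "space (PP x) = space \<Omega>"
  using sets_PP by (rule sets_eq_imp_space_eq)

lemma measurable_\<Phi> [measurable]: "\<Phi> k \<in> \<Omega> \<rightarrow>\<^sub>M borel"
  using chain unfolding markov_chain_def by blast

lemma AE_\<Phi>_0: "AE w in PP x. \<Phi> 0 w = x"
  using chain unfolding markov_chain_def by blast

lemma space_filtration [simp]: "space (\<F> k) = space \<Omega>"
  unfolding natural_filtration_def by (intro space_measure_of) auto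

lemma sets_filtration:
  "sets (\<F> k) = sigma_sets (space \<Omega>) {\<Phi> i -` A \<inter> space \<Omega> | i A. i \<le> k \<and> A \<in> sets borel}"
  unfolding natural_filtration_def by (intro sets_measure_of) auto

lemma sets_filtration_subset: "sets (\<F> k) \<subseteq> sets \<Omega>"
  unfolding sets_filtration by (intro sets.sigma_sets_subset) auto

lemma subalgebra_filtration: "subalgebra (PP x) (\<F> k)"
  using sets_filtration_subset unfolding subalgebra_def by (simp add: space_PP sets_PP)

lemma measurable_filtration: "i \<le> k \<Longrightarrow> \<Phi> i \<in> \<F> k \<rightarrow>\<^sub>M borel"
  by (rule measurableI) (auto simp: sets_filtration intro!: sigma_sets.Basic)

lemma id_filtration: "(\<lambda>w. w) \<in> PP x \<rightarrow>\<^sub>M \<F> k"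
  by (rule measurableI) (use sets_filtration_subset in \<open>auto simp: space_PP sets_PP dest: sets.sets_into_space\<close>)

text \<open>The defining conditional probability integrated over an event of the past; this is the
  case of rectangles in \<open>markov_step\<close>.\<close>

lemma emeasure_filtration_step:
  assumes A: "A \<in> sets (\<F> k)" and B: "B \<in> sets borel"
  shows "emeasure (PP x) (A \<inter> \<Phi> (Suc k) -` B) = (\<integral>\<^sup>+w. indicator A w * emeasure (P (\<Phi> k w)) B \<partial>PP x)"
proof -
  interpret prob_space "PP x" by (rule prob_space_PP)
  interpret finite_measure_subalgebra "PP x" "\<F> k" by standard (rule subalgebra_filtration)
  have [measurable]: "A \<in> sets \<Omega>" "A \<in> sets (PP x)" using A sets_filtration_subset by (auto simp: sets_PP)
  have [measurable]: "B \<in> sets borel" by fact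
  let ?f = "\<lambda>w. indicator B (\<Phi> (Suc k) w) :: real"
  have int: "integrable (PP x) ?f"
    by (rule integrable_const_bound[where B=1]) (auto simp: indicator_def)
  have AE: "AE w in PP x. real_cond_exp (PP x) (\<F> k) ?f w = measure (P (\<Phi> k w)) B"
    using chain B unfolding markov_chain_def by blast
  have [measurable]: "(\<lambda>w. measure (P (\<Phi> k w)) B) \<in> borel_measurable \<Omega>"
    by (rule measurable_compose[OF measurable_\<Phi>], rule measure_measurable_prob_algebra2[where N=borel]) simp_all
  have int2: "integrable (PP x) (\<lambda>w. indicator A w * measure (P (\<Phi> k w)) B)"
    by (rule integrable_const_bound[where B=1])
       (auto simp: indicator_def intro!: prob_space.prob_le_1 prob_space_kernel)
  have eqs: "A \<inter> \<Phi> (Suc k) -` B \<in> sets (PP x)"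
  proof -
    have "A \<inter> \<Phi> (Suc k) -` B = A \<inter> (\<Phi> (Suc k) -` B \<inter> space \<Omega>)"
      using sets.sets_into_space[OF A] by auto
    moreover have "\<Phi> (Suc k) -` B \<inter> space \<Omega> \<in> sets \<Omega>" by (rule measurable_sets[OF measurable_\<Phi> B])
    ultimately show ?thesis using \<open>A \<in> sets \<Omega>\<close> unfolding sets_PP by (metis sets.Int)
  qed
  have "measure (PP x) (A \<inter> \<Phi> (Suc k) -` B) = (\<integral>w\<in>A. ?f w \<partial>PP x)"
  proof -
    have "(\<integral>w\<in>A. ?f w \<partial>PP x) = (\<integral>w. indicator (A \<inter> \<Phi> (Suc k) -` B) w \<partial>PP x)"
      unfolding set_lebesgue_integral_def by (intro Bochner_Integration.integral_cong) (auto simp: indicator_def)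
    also have "\<dots> = measure (PP x) (A \<inter> \<Phi> (Suc k) -` B \<inter> space (PP x))" by simp
    also have "A \<inter> \<Phi> (Suc k) -` B \<inter> space (PP x) = A \<inter> \<Phi> (Suc k) -` B"
      using sets.sets_into_space[OF eqs] by blast
    finally show ?thesis by simp
  qed
  also have "\<dots> = (\<integral>w\<in>A. real_cond_exp (PP x) (\<F> k) ?f w \<partial>PP x)"
    by (rule real_cond_exp_intA[OF int A])
  also have "\<dots> = (\<integral>w. indicator A w * measure (P (\<Phi> k w)) B \<partial>PP x)"
    unfolding set_lebesgue_integral_def by (rule integral_cong_AE) (use AE in auto)
  finally have "emeasure (PP x) (A \<inter> \<Phi> (Suc k) -` B) = ennreal (\<integral>w. indicator A w * measure (P (\<Phi> k w)) B \<partial>PP x)"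
    by (simp add: emeasure_eq_measure)
  also have "\<dots> = (\<integral>\<^sup>+w. ennreal (indicator A w * measure (P (\<Phi> k w)) B) \<partial>PP x)"
    by (rule nn_integral_eq_integral[symmetric, OF int2]) auto
  also have "\<dots> = (\<integral>\<^sup>+w. indicator A w * emeasure (P (\<Phi> k w)) B \<partial>PP x)"
    by (intro nn_integral_cong)
       (simp add: indicator_def finite_measure.emeasure_eq_measure[OF prob_space.finite_measure[OF prob_space_kernel]])
  finally show ?thesis .
qed

text \<open>The history enters as the point \<^term>\<open>w\<close> itself, viewed in the \<open>\<sigma>\<close>-algebra \<^term>\<open>\<F> k\<close>.\<close>

lemma markov_step:
  assumes G: "G \<in> borel_measurable (\<F> k \<Otimes>\<^sub>M borel)"
  shows "(\<integral>\<^sup>+w. G (w, \<Phi> (Suc k) w) \<partial>PP x) = (\<integral>\<^sup>+w. \<integral>\<^sup>+y. G (w, y) \<partial>P (\<Phi> k w) \<partial>PP x)"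
proof -
  interpret prob_space "PP x" by (rule prob_space_PP)
  let ?N = "\<F> k \<Otimes>\<^sub>M (borel :: 'a measure)"
  note id_filtration[measurable] measurable_filtration[OF order_refl, measurable]
  have pair[measurable]: "(\<lambda>w. (w, \<Phi> (Suc k) w)) \<in> PP x \<rightarrow>\<^sub>M ?N" by measurable
  \<comment> \<open>The conditional law of the pair (history, next state) given the history
    \<open>w\<close>.\<close>
  let ?K = "\<lambda>w. distr (P (\<Phi> k w)) ?N (Pair w)"
  have "?K \<in> \<F> k \<rightarrow>\<^sub>M prob_algebra ?N"
    by (rule measurable_distr_prob_space2[where M=borel]) simp_all
  then have K[measurable]: "?K \<in> PP x \<rightarrow>\<^sub>M subprob_algebra ?N"
    by (intro measurable_from_subalg[OF subalgebra_filtration] measurable_prob_algebraD)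
  have Pair[measurable]: "Pair w \<in> P y \<rightarrow>\<^sub>M ?N" if "w \<in> space \<Omega>" for w y
    unfolding measurable_cong_sets[OF sets_kernel refl] using that by (intro measurable_Pair1') simp
  have ne: "space (PP x) \<noteq> {}" by (rule not_empty)
  \<comment> \<open>Both measures agree on rectangles, which are stable under intersection and
    generate the product \<sigma>-algebra.\<close>
  have eq: "distr (PP x) ?N (\<lambda>w. (w, \<Phi> (Suc k) w)) = PP x \<bind> ?K"
  proof (rule measure_eqI_generator_eq)
    let ?E = "{A \<times> B | A B. A \<in> sets (\<F> k) \<and> B \<in> sets (borel :: 'a measure)}"
    show "Int_stable ?E" by (rule Int_stable_pair_measure_generator)
    show "?E \<subseteq> Pow (space (\<F> k) \<times> space (borel :: 'a measure))" by (rule pair_measure_closed)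
    show "sets (distr (PP x) ?N (\<lambda>w. (w, \<Phi> (Suc k) w))) = sigma_sets (space (\<F> k) \<times> space borel) ?E"
      by (simp add: sets_pair_measure)
    show "sets (PP x \<bind> ?K) = sigma_sets (space (\<F> k) \<times> space borel) ?E"
      using sets_bind[of "PP x" ?K ?N] ne by (simp add: sets_pair_measure)
    show "range (\<lambda>i::nat. space (\<F> k) \<times> space (borel :: 'a measure)) \<subseteq> ?E"
      using sets.top by blast
    show "(\<Union>i::nat. space (\<F> k) \<times> space (borel :: 'a measure)) = space (\<F> k) \<times> space borel" by simp
    show "emeasure (distr (PP x) ?N (\<lambda>w. (w, \<Phi> (Suc k) w))) (space (\<F> k) \<times> space borel) \<noteq> \<infinity>" for i :: nat
    proof (subst emeasure_distr[OF pair])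
      show "space (\<F> k) \<times> space borel \<in> sets ?N" by (intro pair_measureI sets.top)
    qed (simp add: emeasure_eq_measure)
    fix X assume "X \<in> ?E"
    then obtain A B where X: "X = A \<times> B" and A: "A \<in> sets (\<F> k)" and B: "B \<in> sets (borel :: 'a measure)" by blast
    then have XN: "X \<in> sets ?N" by simp
    have "emeasure (distr (PP x) ?N (\<lambda>w. (w, \<Phi> (Suc k) w))) X = emeasure (PP x) (A \<inter> \<Phi> (Suc k) -` B)"
      using sets.sets_into_space[OF A]
      by (subst emeasure_distr[OF pair XN], intro arg_cong2[where f=emeasure]) (auto simp: X space_PP)
    also have "\<dots> = (\<integral>\<^sup>+w. indicator A w * emeasure (P (\<Phi> k w)) B \<partial>PP x)"
      by (rule emeasure_filtration_step[OF A B])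
    also have "\<dots> = (\<integral>\<^sup>+w. emeasure (?K w) X \<partial>PP x)"
    proof (rule nn_integral_cong)
      fix w assume "w \<in> space (PP x)"
      then have w: "w \<in> space \<Omega>" by (simp add: space_PP)
      have "Pair w -` X \<inter> space (P (\<Phi> k w)) = (if w \<in> A then B else {})"
        unfolding X using sets_eq_imp_space_eq[OF sets_kernel] by auto
      then show "indicator A w * emeasure (P (\<Phi> k w)) B = emeasure (?K w) X"
        by (simp add: emeasure_distr[OF Pair[OF w] XN])
    qed
    also have "\<dots> = emeasure (PP x \<bind> ?K) X"
      by (rule emeasure_bind[symmetric, OF ne K XN])
    finally show "emeasure (distr (PP x) ?N (\<lambda>w. (w, \<Phi> (Suc k) w))) X = emeasure (PP x \<bind> ?K) X" .
  qed
  have "(\<integral>\<^sup>+w. G (w, \<Phi> (Suc k) w) \<partial>PP x) = (\<integral>\<^sup>+z. G z \<partial>distr (PP x) ?N (\<lambda>w. (w, \<Phi> (Suc k) w)))"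
    by (subst nn_integral_distr[OF pair]) (simp_all add: G)
  also have "\<dots> = (\<integral>\<^sup>+w. \<integral>\<^sup>+z. G z \<partial>?K w \<partial>PP x)"
    unfolding eq by (rule nn_integral_bind[OF G K])
  also have "\<dots> = (\<integral>\<^sup>+w. \<integral>\<^sup>+y. G (w, y) \<partial>P (\<Phi> k w) \<partial>PP x)"
  proof (rule nn_integral_cong)
    fix w assume "w \<in> space (PP x)"
    then show "(\<integral>\<^sup>+z. G z \<partial>?K w) = (\<integral>\<^sup>+y. G (w, y) \<partial>P (\<Phi> k w))"
      by (subst nn_integral_distr[OF Pair]) (simp_all add: G space_PP)
  qed
  finally show ?thesis .
qed

lemma distr_\<Phi>_1: "distr (PP x) borel (\<Phi> 1) = P x"
proof (rule measure_eqI)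
  fix A assume "A \<in> sets (distr (PP x) borel (\<Phi> 1))"
  then have [measurable]: "A \<in> sets borel" by simp
  interpret prob_space "PP x" by (rule prob_space_PP)
  have "emeasure (distr (PP x) borel (\<Phi> 1)) A = (\<integral>\<^sup>+y. indicator A y \<partial>distr (PP x) borel (\<Phi> 1))"
    by simp
  also have "\<dots> = (\<integral>\<^sup>+w. indicator A (\<Phi> 1 w) \<partial>PP x)"
    by (subst nn_integral_distr) auto
  also have "\<dots> = (\<integral>\<^sup>+w. \<integral>\<^sup>+y. indicator A y \<partial>P (\<Phi> 0 w) \<partial>PP x)"
    using markov_step[of "\<lambda>(w, y). indicator A y" 0 x] by simp
  also have "\<dots> = (\<integral>\<^sup>+w. emeasure (P x) A \<partial>PP x)"
    by (rule nn_integral_cong_AE) (use AE_\<Phi>_0[of x] in eventually_elim, simp add: sets_kernel)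
  also have "\<dots> = emeasure (P x) A" by (simp add: emeasure_space_1)
  finally show "emeasure (distr (PP x) borel (\<Phi> 1)) A = emeasure (P x) A" .
qed (simp add: sets_kernel)

lemma integrable_kernel: "integrable (P x) (\<lambda>y. y)"
  using integrable_1[of x] unfolding distr_\<Phi>_1[of x, symmetric] by (subst integrable_distr_eq) auto

lemma mean_eq: "mean x = (\<integral>w. \<Phi> 1 w \<partial>PP x)"
  unfolding mean_def distr_\<Phi>_1[of x, symmetric] by (subst integral_distr) auto

lemma mean_drift: "mean x = x + drift PP \<Phi> x"
  unfolding drift_def mean_eq by simp

lemma measurable_mean [measurable]: "mean \<in> borel_measurable borel"
  unfolding mean_def[abs_def]
  by (rule measurable_compose[OF measurable_prob_algebraD[OF measurable_kernel]])
     (rule integral_measurable_subprob_algebra, simp)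

text \<open>The sets decided almost surely form a \<sigma>-algebra, and
  \<open>\<Phi> 0 w = x\<close> almost surely decides every generator.\<close>

lemma filtration_0_trivial:
  assumes "A \<in> sets (\<F> 0)"
  shows "(AE w in PP x. w \<in> A) \<or> (AE w in PP x. w \<notin> A)"
  using assms unfolding sets_filtration
proof (induction rule: sigma_sets.induct)
  case (Basic a)
  then obtain A where a: "a = \<Phi> 0 -` A \<inter> space \<Omega>" by auto
  show ?case
  proof (cases "x \<in> A")
    case True
    have "AE w in PP x. w \<in> a" using AE_\<Phi>_0[of x] AE_space
      by eventually_elim (use True in \<open>auto simp: a space_PP\<close>)
    then show ?thesis ..
  next
    case False
    have "AE w in PP x. w \<notin> a" using AE_\<Phi>_0[of x]
      by eventually_elim (use False in \<open>auto simp: a\<close>)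
    then show ?thesis ..
  qed
next
  case Empty
  then show ?case by simp
next
  case (Compl a)
  from Compl.IH show ?case
  proof
    assume "AE w in PP x. w \<in> a"
    then have "AE w in PP x. w \<notin> space \<Omega> - a" by eventually_elim simp
    then show ?thesis ..
  next
    assume "AE w in PP x. w \<notin> a"
    then have "AE w in PP x. w \<in> space \<Omega> - a" using AE_space by eventually_elim (simp add: space_PP)
    then show ?thesis ..
  qed
next
  case (Union a)
  show ?case
  proof (cases "\<exists>i. AE w in PP x. w \<in> a i")
    case True
    then obtain i where "AE w in PP x. w \<in> a i" ..
    then have "AE w in PP x. w \<in> (\<Union>i. a i)" by eventually_elim blast
    then show ?thesis ..
  next
    case False
    then have "\<And>i. AE w in PP x. w \<notin> a i" using Union by blast
    then have "AE w in PP x. \<forall>i. w \<notin> a i" by (simp add: AE_all_countable)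
    then have "AE w in PP x. w \<notin> (\<Union>i. a i)" by eventually_elim blast
    then show ?thesis ..
  qed
qed

text \<open>The bridge from the noise, defined by conditional expectations, to the kernel: it turns
  (B1) into a moment bound for \<open>P x\<close>.\<close>

lemma AE_noise_1: "AE w in PP x. noise \<Omega> PP \<Phi> x 1 w = \<Phi> 1 w - mean x"
proof -
  have "AE w in PP x. real_cond_exp (PP x) (\<F> 0) (\<lambda>w. \<Phi> 1 w \<bullet> b) w = (\<integral>w. \<Phi> 1 w \<bullet> b \<partial>PP x)" for b
    by (rule real_cond_exp_trivial[OF prob_space_PP subalgebra_filtration _ filtration_0_trivial])
       (use integrable_1 in simp)
  then have "AE w in PP x. \<forall>b\<in>Basis. real_cond_exp (PP x) (\<F> 0) (\<lambda>w. \<Phi> 1 w \<bullet> b) w = (\<integral>w. \<Phi> 1 w \<partial>PP x) \<bullet> b"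
    using integrable_1 by (intro AE_ball_countable[THEN iffD2]) (auto simp: countable_finite)
  then show ?thesis
  proof eventually_elim
    case (elim w)
    then have "vec_cond_exp (PP x) (\<F> 0) (\<Phi> 1) w = (\<Sum>b\<in>Basis. ((\<integral>w. \<Phi> 1 w \<partial>PP x) \<bullet> b) *\<^sub>R b)"
      unfolding vec_cond_exp_def by (intro sum.cong) auto
    then show ?case unfolding noise_def mean_eq by (simp add: euclidean_representation)
  qed
qed

text \<open>(B1) provides one \<open>K\<close> for which the tail integrals are below 1 for all
  \<open>x\<close>. With |e|^q <= 1 + |e|^p, and |e|^p <= K^p below the level \<open>K\<close>, the
  constant K^p + 2 works.\<close>

lemma moment_bound:
  assumes B1: "condB1 \<Omega> PP \<Phi> p" and q: "0 \<le> q" "q \<le> p"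
  obtains M where "M \<ge> 0" "\<And>x. (\<integral>\<^sup>+y. ennreal (norm (y - mean x) powr q) \<partial>P x) \<le> ennreal M"
proof -
  let ?I = "\<lambda>K x. \<integral>\<^sup>+\<omega>. ennreal (norm (noise \<Omega> PP \<Phi> x 1 \<omega>) powr p)
          * indicator {\<omega>'. norm (noise \<Omega> PP \<Phi> x 1 \<omega>') \<ge> K} \<omega> \<partial>PP x"
  have p: "p > 1" and lim: "((\<lambda>K::real. SUP x. ?I K x) \<longlongrightarrow> 0) at_top"
    using B1 unfolding condB1_def by auto
  have "\<forall>\<^sub>F K in at_top. (SUP x. ?I K x) < 1" using order_tendstoD(2)[OF lim, of 1] by simp
  then have "\<forall>\<^sub>F K in at_top. (SUP x. ?I K x) < 1 \<and> K \<ge> 0"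
    using eventually_ge_at_top[of 0] by eventually_elim simp
  then obtain K where K: "(SUP x. ?I K x) < 1" "K \<ge> 0"
    by (metis (no_types, lifting) eventually_at_top_linorder order_refl)
  have "(\<integral>\<^sup>+y. ennreal (norm (y - mean x) powr q) \<partial>P x) \<le> ennreal (K powr p + 2)" for x
  proof -
    interpret prob_space "PP x" by (rule prob_space_PP)
    let ?e = "\<lambda>w. norm (\<Phi> 1 w - mean x)"
    have "(\<integral>\<^sup>+y. ennreal (norm (y - mean x) powr q) \<partial>P x) = (\<integral>\<^sup>+w. ennreal (?e w powr q) \<partial>PP x)"
      unfolding distr_\<Phi>_1[of x, symmetric] by (subst nn_integral_distr) auto
    also have "\<dots> \<le> (\<integral>\<^sup>+w. ennreal (K powr p + 1) + ennreal (?e w powr p) * indicator {w. ?e w \<ge> K} w \<partial>PP x)"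
    proof (rule nn_integral_mono)
      fix w
      have "?e w powr q \<le> 1 + ?e w powr p"
      proof (cases "?e w \<le> 1")
        case True
        then have "?e w powr q \<le> 1" using q by (simp add: powr_le1)
        then show ?thesis by (simp add: add_increasing2)
      next
        case False
        then have "?e w powr q \<le> ?e w powr p" using q by (intro powr_mono) auto
        then show ?thesis by simp
      qed
      moreover have "?e w powr p \<le> K powr p" if "\<not> ?e w \<ge> K" using that p by (intro powr_mono2) auto
      ultimately have "?e w powr q \<le> (K powr p + 1) + ?e w powr p * indicator {w. ?e w \<ge> K} w"
        using powr_ge_zero[of K p] by (cases "?e w \<ge> K") (simp_all del: powr_ge_zero)
      then have "ennreal (?e w powr q) \<le> ennreal ((K powr p + 1) + ?e w powr p * indicator {w. ?e w \<ge> K} w)"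
        by (rule ennreal_leI)
      also have "\<dots> = ennreal (K powr p + 1) + ennreal (?e w powr p) * indicator {w. ?e w \<ge> K} w"
        by (subst ennreal_plus) (auto simp: indicator_def)
      finally show "ennreal (?e w powr q) \<le> ennreal (K powr p + 1) + ennreal (?e w powr p) * indicator {w. ?e w \<ge> K} w" .
    qed
    also have "\<dots> = ennreal (K powr p + 1) + (\<integral>\<^sup>+w. ennreal (?e w powr p) * indicator {w. ?e w \<ge> K} w \<partial>PP x)"
    proof (subst nn_integral_add)
      show "(\<lambda>w. ennreal (?e w powr p) * indicator {w. ?e w \<ge> K} w) \<in> borel_measurable (PP x)"
        by measurable
    qed (simp_all add: emeasure_space_1)
    also have "(\<integral>\<^sup>+w. ennreal (?e w powr p) * indicator {w. ?e w \<ge> K} w \<partial>PP x) = ?I K x"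
    proof (rule nn_integral_cong_AE)
      show "AE w in PP x. ennreal (?e w powr p) * indicator {w. ?e w \<ge> K} w =
        ennreal (norm (noise \<Omega> PP \<Phi> x 1 w) powr p) * indicator {w. norm (noise \<Omega> PP \<Phi> x 1 w) \<ge> K} w"
        using AE_noise_1[of x] by eventually_elim (simp add: indicator_def)
    qed
    also have "?I K x \<le> 1" using K(1) SUP_upper[of x UNIV "?I K"] by (meson UNIV_I less_imp_le order_trans)
    also have "ennreal (K powr p + 1) + 1 = ennreal (K powr p + 2)"
      by (simp flip: ennreal_1 ennreal_plus add: add.assoc)
    finally show ?thesis by (simp add: add_left_mono)
  qed
  then show thesis by (intro that[of "K powr p + 2"]) auto
qed

text \<open>The increments use \<open>mean\<close> in place of conditional expectations, so the
  decomposition of the chain into drift and \<open>mart\<close> holds at every point and not merely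
  almost surely.\<close>

definition mart :: "real \<Rightarrow> nat \<Rightarrow> 'w \<Rightarrow> 'a" where
  "mart r k w = (\<Sum>i<k. inverse r *\<^sub>R (\<Phi> (Suc i) w - mean (\<Phi> i w)))"

lemma measurable_mart: "k \<le> n \<Longrightarrow> mart r k \<in> \<F> n \<rightarrow>\<^sub>M borel"
  unfolding mart_def[abs_def]
  by (intro borel_measurable_sum borel_measurable_scaleR borel_measurable_diff measurable_filtration
      measurable_const measurable_compose[OF measurable_filtration measurable_mean]) auto

lemma measurable_mart' [measurable]: "mart r k \<in> \<Omega> \<rightarrow>\<^sub>M borel"
  unfolding mart_def[abs_def] by measurable

text \<open>The stopped functional \<open>Z\<close> starts at 0 and gains at most \<open>c\<close>
  in expectation per step. Since \<open>Z n\<close> equals \<open>pseudo_norm \<rho>\<close> once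
  the sum has left the ball, Markov's inequality finishes the argument.\<close>

lemma maximal_inequality:
  assumes r: "r > 0" and \<rho>: "\<rho> > 0" and q: "1 \<le> q" "q \<le> 2" and M: "M \<ge> 0"
    and mom: "\<And>x. (\<integral>\<^sup>+y. ennreal (norm (y - mean x) powr q) \<partial>P x) \<le> ennreal M"
  shows "measure (PP x) {w \<in> space \<Omega>. \<exists>k\<le>n. \<rho> \<le> norm (mart r k w)}
    \<le> real n * (2 * M * r powr (-q)) / pseudo_norm \<rho>"
proof -
  interpret prob_space "PP x" by (rule prob_space_PP)
  define c where "c = 2 * M * r powr (-q)"
  have c: "c \<ge> 0" using M by (simp add: c_def)
  define below where "below k w \<longleftrightarrow> (\<forall>j\<le>k. norm (mart r j w) < \<rho>)" for k w
  \<comment> \<open>After the exit, \<open>Z\<close> is frozen at the boundary value instead of the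
    value at the overshoot. This only lowers \<open>Z\<close>, so the one-step estimate
    persists.\<close>
  define Z where "Z k w = (if below k w then pseudo_norm (mart r k w) else pseudo_norm \<rho>)" for k w
  have below_meas: "Measurable.pred (\<F> k) (below k)" for k
    unfolding below_def
  proof (rule pred_intros_countable)
    fix j
    show "Measurable.pred (\<F> k) (\<lambda>w. j \<le> k \<longrightarrow> norm (mart r j w) < \<rho>)"
    proof (cases "j \<le> k")
      case True
      from measurable_mart[OF this] have [measurable]: "mart r j \<in> \<F> k \<rightarrow>\<^sub>M borel" .
      show ?thesis by measurable
    qed simp
  qed
  have below_meas'[measurable]: "Measurable.pred \<Omega> (below k)" for k
    unfolding below_def by measurable
  have Z_meas[measurable]: "Z k \<in> borel_measurable \<Omega>" for k
    unfolding Z_def by measurable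
  have "(\<integral>\<^sup>+w. ennreal (Z k w) \<partial>PP x) \<le> ennreal (real k * c)" for k
  proof (induction k)
    case 0
    have "Z 0 w = 0" for w using \<rho> by (simp add: Z_def below_def mart_def)
    then show ?case by simp
  next
    case (Suc k)
    note [measurable] = below_meas[of k] measurable_mart[OF order_refl[of k]] measurable_filtration[OF order_refl[of k]]
    \<comment> \<open>The unstopped next value as a function of history and next state, in the form
      that \<open>markov_step\<close> accepts.\<close>
    define G where "G z = ennreal (if below k (fst z)
      then pseudo_norm (mart r k (fst z) + inverse r *\<^sub>R (snd z - mean (\<Phi> k (fst z)))) else pseudo_norm \<rho>)" for z
    have G: "G \<in> borel_measurable (\<F> k \<Otimes>\<^sub>M borel)" unfolding G_def by measurable
    have "(\<integral>\<^sup>+w. ennreal (Z (Suc k) w) \<partial>PP x) \<le> (\<integral>\<^sup>+w. G (w, \<Phi> (Suc k) w) \<partial>PP x)"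
    proof (rule nn_integral_mono)
      fix w
      have "mart r (Suc k) w = mart r k w + inverse r *\<^sub>R (\<Phi> (Suc k) w - mean (\<Phi> k w))"
        by (simp add: mart_def)
      moreover have "pseudo_norm \<rho> \<le> pseudo_norm (mart r (Suc k) w)" if "below k w" "\<not> below (Suc k) w"
      proof -
        have "\<not> norm (mart r (Suc k) w) < \<rho>" using that unfolding below_def by (metis le_Suc_eq)
        then show ?thesis using \<rho> unfolding pseudo_norm_def by (simp add: power_mono)
      qed
      moreover have "below k w" if "below (Suc k) w" using that unfolding below_def by simp
      ultimately show "ennreal (Z (Suc k) w) \<le> G (w, \<Phi> (Suc k) w)"
        unfolding Z_def G_def by (auto intro!: ennreal_leI)
    qed
    also have "\<dots> = (\<integral>\<^sup>+w. \<integral>\<^sup>+y. G (w, y) \<partial>P (\<Phi> k w) \<partial>PP x)" by (rule markov_step[OF G])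
    also have "\<dots> \<le> (\<integral>\<^sup>+w. ennreal (Z k w) + ennreal c \<partial>PP x)"
    proof (rule nn_integral_mono)
      fix w
      interpret K: prob_space "P (\<Phi> k w)" by (rule prob_space_kernel)
      show "(\<integral>\<^sup>+y. G (w, y) \<partial>P (\<Phi> k w)) \<le> ennreal (Z k w) + ennreal c"
      proof (cases "below k w")
        case True
        have "(\<integral>\<^sup>+y. G (w, y) \<partial>P (\<Phi> k w)) \<le> ennreal (pseudo_norm (mart r k w) + c)"
          using nn_integral_pseudo_norm_step[OF prob_space_kernel sets_kernel integrable_kernel q r M mom[unfolded mean_def]] True
          unfolding G_def c_def mean_def by simp
        also have "\<dots> = ennreal (Z k w) + ennreal c"
          using True c by (subst ennreal_plus) (simp_all add: Z_def pseudo_norm_nonneg)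
        finally show ?thesis .
      next
        case False
        then show ?thesis by (simp add: G_def Z_def K.emeasure_space_1)
      qed
    qed
    also have "\<dots> = (\<integral>\<^sup>+w. ennreal (Z k w) \<partial>PP x) + ennreal c"
      by (subst nn_integral_add) (auto simp: emeasure_space_1)
    also have "\<dots> \<le> ennreal (real k * c) + ennreal c" using Suc by (rule add_right_mono)
    also have "\<dots> = ennreal (real (Suc k) * c)" using c by (simp add: algebra_simps flip: ennreal_plus)
    finally show ?case .
  qed
  from this[of n] have Zn: "(\<integral>\<^sup>+w. ennreal (Z n w) \<partial>PP x) \<le> ennreal (real n * c)" .
  let ?A = "{w \<in> space \<Omega>. \<exists>k\<le>n. \<rho> \<le> norm (mart r k w)}"
  have [measurable]: "?A \<in> sets (PP x)" unfolding sets_PP by measurable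
  have "ennreal (pseudo_norm \<rho> * measure (PP x) ?A) = ennreal (pseudo_norm \<rho>) * emeasure (PP x) ?A"
    by (simp add: emeasure_eq_measure ennreal_mult pseudo_norm_nonneg)
  also have "\<dots> = (\<integral>\<^sup>+w. ennreal (pseudo_norm \<rho>) * indicator ?A w \<partial>PP x)"
    by (simp add: nn_integral_cmult_indicator)
  also have "\<dots> \<le> (\<integral>\<^sup>+w. ennreal (Z n w) \<partial>PP x)"
  proof (rule nn_integral_mono)
    fix w
    show "ennreal (pseudo_norm \<rho>) * indicator ?A w \<le> ennreal (Z n w)"
      unfolding Z_def below_def by (auto simp: indicator_def not_less[symmetric])
  qed
  also note Zn
  finally have "pseudo_norm \<rho> * measure (PP x) ?A \<le> real n * c"
    using c by (simp add: ennreal_le_iff)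
  then show ?thesis using pseudo_norm_pos[of \<rho>] \<rho> unfolding c_def
    by (simp add: pos_le_divide_eq mult.commute)
qed

end

section \<open>Fluid limits\<close>

text \<open>Only the parts of the path before the first and after the last visit to the ball of radius
  \<^term>\<open>\<rho>\<close> pay the rate \<^term>\<open>D\<close>; in between, the path moves by at most the diameter.\<close>

lemma drifted_increment:
  fixes y b S :: "nat \<Rightarrow> 'a::euclidean_space"
  assumes step: "\<And>l. y (Suc l) = y l + b l + (S (Suc l) - S l)"
    and S: "\<And>k. k \<le> n \<Longrightarrow> norm (S k) \<le> \<kappa>"
    and \<delta>: "\<And>l. norm (b l) \<le> \<delta>" and D: "\<And>l. \<rho> \<le> norm (y l) \<Longrightarrow> norm (b l) \<le> D" "0 \<le> D"
    and ij: "i \<le> j" "j \<le> n" and "0 < \<rho>"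
  shows "norm (y j - y i) \<le> 2 * \<rho> + real (j - i) * D + 4 * \<kappa> + \<delta>"
proof -
  have tele: "y j - y i = (\<Sum>l=i..<j. b l) + (S j - S i)" if "i \<le> j" for i j
    using that
  proof (induction rule: dec_induct)
    case (step m)
    have "y (Suc m) - y i = (y (Suc m) - y m) + (y m - y i)" by simp
    also have "y (Suc m) - y m = b m + (S (Suc m) - S m)" using assms(1)[of m] by simp
    also note step.IH
    finally show ?case using step.hyps by (simp add: algebra_simps)
  qed simp
  have SS: "norm (S l - S k) \<le> 2 * \<kappa>" if "l \<le> n" "k \<le> n" for k l
    using norm_triangle_ineq4[of "S l" "S k"] S[OF that(1)] S[OF that(2)] by linarith
  have away: "norm (\<Sum>l=k..<m. b l) \<le> real (m - k) * D" if "\<And>l. k \<le> l \<Longrightarrow> l < m \<Longrightarrow> \<rho> \<le> norm (y l)" for k m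
    using sum_norm_bound[of "{k..<m}" b D] D(1) that by simp
  have \<kappa>: "0 \<le> \<kappa>" using S[of 0] norm_ge_zero[of "S 0"] by linarith
  have \<delta>0: "0 \<le> \<delta>" using \<delta>[of 0] norm_ge_zero[of "b 0"] by linarith
  define A where "A = {l\<in>{i..<j}. norm (y l) < \<rho>}"
  have "finite A" unfolding A_def by simp
  show ?thesis
  proof (cases "A = {}")
    case True
    then have "norm (\<Sum>l=i..<j. b l) \<le> real (j - i) * D"
      by (intro away) (auto simp: A_def not_less)
    moreover have "norm (y j - y i) \<le> norm (\<Sum>l=i..<j. b l) + norm (S j - S i)"
      unfolding tele[OF ij(1)] by (rule norm_triangle_ineq)
    ultimately show ?thesis using SS[of j i] ij \<kappa> \<delta>0 \<open>0 < \<rho>\<close> by linarith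
  next
    case False
    define k where "k = Min A"
    define m where "m = Max A"
    have km: "k \<in> A" "m \<in> A" using False \<open>finite A\<close> by (auto simp: k_def m_def)
    have kmA: "k \<le> l" "l \<le> m" if "l \<in> A" for l using that \<open>finite A\<close> by (auto simp: k_def m_def)
    have "k \<le> m" using kmA(1)[OF km(2)] .
    have ik: "i \<le> k" "m < j" "norm (y k) < \<rho>" "norm (y m) < \<rho>" using km by (auto simp: A_def)
    have "norm (\<Sum>l=i..<k. b l) \<le> real (k - i) * D"
    proof (rule away)
      fix l assume l: "i \<le> l" "l < k"
      then have "l \<notin> A" using kmA(1)[of l] by auto
      with l ik \<open>k \<le> m\<close> show "\<rho> \<le> norm (y l)" by (auto simp: A_def)
    qed
    moreover have "norm (y k - y i) \<le> norm (\<Sum>l=i..<k. b l) + norm (S k - S i)"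
      unfolding tele[OF ik(1)] by (rule norm_triangle_ineq)
    ultimately have 1: "norm (y k - y i) \<le> real (k - i) * D + 2 * \<kappa>"
      using SS[of k i] ik ij \<open>k \<le> m\<close> by simp
    have "norm (\<Sum>l=Suc m..<j. b l) \<le> real (j - Suc m) * D"
    proof (rule away)
      fix l assume l: "Suc m \<le> l" "l < j"
      then have "l \<notin> A" using kmA(2)[of l] by auto
      with l ik \<open>k \<le> m\<close> show "\<rho> \<le> norm (y l)" by (auto simp: A_def)
    qed
    \<comment> \<open>The step taken at time \<open>m\<close> starts inside the ball, where only the
      crude bound \<open>\<delta>\<close> is available.\<close>
    moreover have "(\<Sum>l=m..<j. b l) = b m + (\<Sum>l=Suc m..<j. b l)"
      using ik by (simp add: sum.atLeast_Suc_lessThan)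
    moreover have "norm (y j - y m) \<le> norm (\<Sum>l=m..<j. b l) + norm (S j - S m)"
      unfolding tele[OF less_imp_le[OF ik(2)]] by (rule norm_triangle_ineq)
    moreover have "norm (b m + (\<Sum>l=Suc m..<j. b l)) \<le> norm (b m) + norm (\<Sum>l=Suc m..<j. b l)"
      by (rule norm_triangle_ineq)
    ultimately have 2: "norm (y j - y m) \<le> \<delta> + real (j - Suc m) * D + 2 * \<kappa>"
      using SS[of j m] ik ij \<delta>[of m] by simp
    have 3: "norm (y m - y k) \<le> 2 * \<rho>"
      using norm_triangle_ineq4[of "y m" "y k"] ik by linarith
    \<comment> \<open>The stretches [i, k) and [m+1, j) are disjoint parts of [i, j), so the rate is
      paid for at most j - i steps.\<close>
    have "(k - i) + (j - Suc m) \<le> j - i" using ik \<open>k \<le> m\<close> by linarith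
    then have "real (k - i) + real (j - Suc m) \<le> real (j - i)" by linarith
    then have "(real (k - i) + real (j - Suc m)) * D \<le> real (j - i) * D" using D(2) by (rule mult_right_mono)
    then have 4: "real (k - i) * D + real (j - Suc m) * D \<le> real (j - i) * D" by (simp add: algebra_simps)
    have "norm (y j - y i) \<le> norm (y j - y m) + norm (y m - y k) + norm (y k - y i)"
      using norm_triangle_ineq[of "y j - y m" "y m - y k"] norm_triangle_ineq[of "y j - y k" "y k - y i"] by simp
    with 1 2 3 4 show ?thesis by linarith
  qed
qed

text \<open>All radii are kept at once, so that the radius can later depend on |t - s| in the
  compactness proof and stay fixed in the proof of triviality.\<close>

definition drift_modulus :: "real \<Rightarrow> real \<Rightarrow> real \<Rightarrow> real \<Rightarrow> (real \<Rightarrow> 'a::euclidean_space) set" where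
  "drift_modulus T a \<beta> \<eta> = {v. \<forall>s\<in>{0..T}. \<forall>t\<in>{0..T}. \<forall>\<rho>>0.
     norm (v t - v s) \<le> 2 * \<rho> + a * \<rho> powr (-\<beta>) * \<bar>t - s\<bar> + \<eta>}"

lemma drift_modulusD:
  assumes "v \<in> drift_modulus T a \<beta> \<eta>" "s \<in> {0..T}" "t \<in> {0..T}" "\<rho> > 0"
  shows "norm (v t - v s) \<le> 2 * \<rho> + a * \<rho> powr (-\<beta>) * \<bar>t - s\<bar> + \<eta>"
  using assms unfolding drift_modulus_def by blast

lemma scaled_path_eq_step_path:
  "scaled_path \<Phi> \<alpha> r w = step_path (inverse r) (r powr (1 + \<alpha>)) (\<lambda>k. \<Phi> k w)"
  unfolding scaled_path_def step_path_def ..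

text \<open>The origin is excluded from the decay bound because \<open>0 powr (-\<beta>)\<close> is
  0, which would force the drift to vanish there.\<close>

lemma condB2_drift:
  assumes "condB2 PP \<Phi> p \<beta>"
  obtains N where "N \<ge> 0" "\<And>x. norm (drift PP \<Phi> x) \<le> N"
    "\<And>x. x \<noteq> 0 \<Longrightarrow> norm (drift PP \<Phi> x) \<le> N * norm x powr (-\<beta>)"
proof -
  let ?g = "\<lambda>x. (1 + (if \<beta> = 0 then 1 else norm x powr \<beta>)) * norm (drift PP \<Phi> x)"
  let ?N = "enn2real (drift_bound \<beta> (drift PP \<Phi>))"
  have fin: "drift_bound \<beta> (drift PP \<Phi>) < \<infinity>" using assms unfolding condB2_def by blast
  have g: "?g x \<le> ?N" for x
  proof -
    have "ennreal (?g x) \<le> drift_bound \<beta> (drift PP \<Phi>)"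
      unfolding drift_bound_def by (rule SUP_upper) simp
    also have "\<dots> = ennreal ?N" using fin by simp
    finally show ?thesis by (simp add: ennreal_le_iff)
  qed
  show thesis
  proof (rule that)
    show "?N \<ge> 0" by simp
    fix x
    have "1 * norm (drift PP \<Phi> x) \<le> ?g x" by (intro mult_right_mono) auto
    with g[of x] show "norm (drift PP \<Phi> x) \<le> ?N" by linarith
    assume x: "x \<noteq> 0"
    have "norm x powr \<beta> * norm (drift PP \<Phi> x) \<le> ?g x" using x by (intro mult_right_mono) auto
    with g[of x] have "norm x powr \<beta> * norm (drift PP \<Phi> x) \<le> ?N" by linarith
    with x show "norm (drift PP \<Phi> x) \<le> ?N * norm x powr (-\<beta>)"
      by (simp add: powr_minus field_simps)
  qed
qed

section \<open>Scaled chains and their weak limits\<close>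

context integrable_chain
begin

text \<open>Outside the ball one step of the scaled chain drifts by at most N \<rho>^(-\<beta>)
  r^(-1-\<beta>), and about (t-s) r^(1+\<alpha>) steps are made. One N/r pays for the step leaving
  the ball, the other for rounding times to integers.\<close>

lemma scaled_path_increment:
  assumes N: "N \<ge> 0" "\<And>x. norm (drift PP \<Phi> x) \<le> N"
    "\<And>x. x \<noteq> 0 \<Longrightarrow> norm (drift PP \<Phi> x) \<le> N * norm x powr (-\<beta>)"
    and r: "r > 0" and \<beta>: "\<beta> \<ge> 0"
    and S: "\<And>k. k \<le> n \<Longrightarrow> norm (mart r k w) \<le> \<kappa>" and n: "T * r powr (1 + \<alpha>) \<le> real n"
    and st: "0 \<le> s" "s \<le> t" "t \<le> T" and \<rho>: "\<rho> > 0"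
  shows "norm (scaled_path \<Phi> \<alpha> r w t - scaled_path \<Phi> \<alpha> r w s)
    \<le> 2 * \<rho> + N * r powr (\<alpha> - \<beta>) * \<rho> powr (-\<beta>) * (t - s) + 4 * \<kappa> + 2 * (N / r)"
proof -
  define c where "c = r powr (1 + \<alpha>)"
  have c: "c \<ge> 0" by (simp add: c_def)
  define i where "i = nat \<lfloor>s * c\<rfloor>"
  define j where "j = nat \<lfloor>t * c\<rfloor>"
  define y where "y k = inverse r *\<^sub>R \<Phi> k w" for k
  define b where "b k = inverse r *\<^sub>R drift PP \<Phi> (\<Phi> k w)" for k
  \<comment> \<open>The minimum with N/r keeps the extra step from rounding independent of
    \<open>\<rho>\<close>.\<close>
  define D where "D = min (N / r) (N * \<rho> powr (-\<beta>) * r powr (-1 - \<beta>))"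
  have sc: "0 \<le> s * c" "s * c \<le> t * c" using st c by (auto intro: mult_right_mono)
  have "t * c \<le> T * c" using st c by (auto intro: mult_right_mono)
  then have "j \<le> n" using n unfolding j_def c_def[symmetric] by linarith
  have "i \<le> j" unfolding i_def j_def using sc by (intro nat_mono floor_mono)
  have D0: "0 \<le> D" using N(1) r \<rho> by (auto simp: D_def)
  have y_step: "y (Suc l) = y l + b l + (mart r (Suc l) w - mart r l w)" for l
    unfolding y_def b_def mart_def by (simp add: mean_drift algebra_simps)
  have b1: "norm (b l) \<le> N / r" for l
    using N(2)[of "\<Phi> l w"] r by (simp add: b_def divide_simps)
  have b2: "norm (b l) \<le> D" if "\<rho> \<le> norm (y l)" for l
  proof -
    have le: "r * \<rho> \<le> norm (\<Phi> l w)" using that r by (simp add: y_def divide_simps mult.commute)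
    then have "\<Phi> l w \<noteq> 0" using r \<rho> by (metis less_le_not_le mult_pos_pos norm_zero)
    then have "norm (drift PP \<Phi> (\<Phi> l w)) \<le> N * norm (\<Phi> l w) powr (-\<beta>)" by (rule N(3))
    also have "\<dots> \<le> N * (r * \<rho>) powr (-\<beta>)"
      using N(1) le r \<rho> \<beta> by (intro mult_left_mono powr_mono2') auto
    finally have "norm (b l) \<le> inverse r * (N * (r * \<rho>) powr (-\<beta>))"
      using r by (simp add: b_def)
    also have "\<dots> = N * \<rho> powr (-\<beta>) * r powr (-1 - \<beta>)"
      using r \<rho> by (simp add: powr_mult powr_diff powr_minus field_simps)
    finally show ?thesis using b1[of l] by (simp add: D_def)
  qed
  have "real (j - i) \<le> (t - s) * c + 1"
    using \<open>i \<le> j\<close> sc unfolding i_def j_def by (simp add: of_nat_diff algebra_simps) linarith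
  then have "real (j - i) * D \<le> ((t - s) * c + 1) * D" using D0 by (rule mult_right_mono)
  also have "\<dots> = (t - s) * c * D + D" by (simp add: algebra_simps)
  also have "\<dots> \<le> (t - s) * c * (N * \<rho> powr (-\<beta>) * r powr (-1 - \<beta>)) + N / r"
    using st c by (intro add_mono mult_left_mono) (auto simp: D_def)
  also have "(t - s) * c * (N * \<rho> powr (-\<beta>) * r powr (-1 - \<beta>)) = N * \<rho> powr (-\<beta>) * (c * r powr (-1 - \<beta>)) * (t - s)"
    by (simp add: algebra_simps)
  also have "c * r powr (-1 - \<beta>) = r powr (\<alpha> - \<beta>)"
    unfolding c_def by (simp add: powr_add[symmetric])
  finally have jD: "real (j - i) * D \<le> N * \<rho> powr (-\<beta>) * r powr (\<alpha> - \<beta>) * (t - s) + N / r" .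
  have "norm (y j - y i) \<le> 2 * \<rho> + real (j - i) * D + 4 * \<kappa> + N / r"
    by (rule drifted_increment[where S="\<lambda>k. mart r k w", OF y_step S b1 b2 D0 \<open>i \<le> j\<close> \<open>j \<le> n\<close> \<rho>])
  with jD have "norm (y j - y i) \<le> 2 * \<rho> + N * \<rho> powr (-\<beta>) * r powr (\<alpha> - \<beta>) * (t - s) + 4 * \<kappa> + 2 * (N / r)"
    by linarith
  moreover have "scaled_path \<Phi> \<alpha> r w t = y j" "scaled_path \<Phi> \<alpha> r w s = y i"
    using st unfolding scaled_path_def y_def i_def j_def c_def by auto
  ultimately show ?thesis by (simp add: ac_simps)
qed

text \<open>The threshold for \<open>r\<close> is the same for all starting points because the
  moment and drift bounds are uniform. The starting point may therefore vary along the sequence of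
  scales.\<close>

lemma scaled_path_good_event:
  assumes B1: "condB1 \<Omega> PP \<Phi> p" and \<beta>: "0 \<le> \<beta>" "\<beta> < min 1 (p - 1)" and \<alpha>: "0 \<le> \<alpha>" "\<alpha> \<le> \<beta>"
    and N: "N \<ge> 0" "\<And>x. norm (drift PP \<Phi> x) \<le> N"
    "\<And>x. x \<noteq> 0 \<Longrightarrow> norm (drift PP \<Phi> x) \<le> N * norm x powr (-\<beta>)"
    and T: "T \<ge> 0" and \<eta>: "\<eta> > 0"
  shows "\<forall>\<^sub>F r in at_top. \<forall>x. \<exists>A\<in>sets (PP (r *\<^sub>R x)). measure (PP (r *\<^sub>R x)) A \<ge> 1 - \<eta> \<and>
    (\<forall>w\<in>A. \<Phi> 0 w = r *\<^sub>R x \<and> scaled_path \<Phi> \<alpha> r w \<in> drift_modulus T (N * r powr (\<alpha> - \<beta>)) \<beta> \<eta>)"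
proof -
  define q where "q = min p 2"
  have q: "1 \<le> q" "q \<le> 2" "0 \<le> q" "q \<le> p" "1 + \<alpha> < q" "0 < q" using \<alpha> \<beta> by (auto simp: q_def)
  obtain M where M: "M \<ge> 0" "\<And>x. (\<integral>\<^sup>+y. ennreal (norm (y - mean x) powr q) \<partial>P x) \<le> ennreal M"
    using moment_bound[OF B1 q(3,4)] by blast
  \<comment> \<open>The noise then costs \<open>4 * \<kappa>\<close>, which is \<eta>/2; the other
    half covers 2N/r as soon as r > 4N/\<eta>.\<close>
  define \<kappa> where "\<kappa> = \<eta> / 8"
  have \<kappa>: "\<kappa> > 0" using \<eta> by (simp add: \<kappa>_def)
  define f where "f r = (T * r powr (1 + \<alpha>) + 1) * (2 * M * r powr (-q)) / pseudo_norm \<kappa>" for r :: real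
  have "(f \<longlongrightarrow> 0) at_top"
  proof -
    have "\<forall>\<^sub>F r in at_top. (T * r powr (1 + \<alpha> - q) + r powr (-q)) * (2 * M / pseudo_norm \<kappa>) = f r"
      using eventually_gt_at_top[of 0]
      by eventually_elim (simp add: f_def powr_diff powr_minus field_simps)
    moreover have "((\<lambda>r. (T * r powr (1 + \<alpha> - q) + r powr (-q)) * (2 * M / pseudo_norm \<kappa>)) \<longlongrightarrow> (T * 0 + 0) * (2 * M / pseudo_norm \<kappa>)) at_top"
      using q by (intro tendsto_intros tendsto_neg_powr filterlim_ident) auto
    ultimately show ?thesis using Lim_transform_eventually by fastforce
  qed
  then have "\<forall>\<^sub>F r in at_top. f r < \<eta>" using \<eta> by (rule order_tendstoD)
  moreover have "\<forall>\<^sub>F r in at_top. r > max 1 (4 * N / \<eta>)" by (rule eventually_gt_at_top)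
  ultimately show ?thesis
  proof eventually_elim
    case (elim r)
    then have r: "r > 0" "4 * N < r * \<eta>" using \<eta> by (auto simp: pos_divide_less_eq)
    show ?case
    proof
      fix x
      interpret prob_space "PP (r *\<^sub>R x)" by (rule prob_space_PP)
      define n where "n = nat \<lceil>T * r powr (1 + \<alpha>)\<rceil>"
      have "T * r powr (1 + \<alpha>) \<ge> 0" using T by simp
      then have n: "T * r powr (1 + \<alpha>) \<le> real n" "real n \<le> T * r powr (1 + \<alpha>) + 1"
        unfolding n_def by linarith+
      define B where "B = {w \<in> space \<Omega>. \<exists>k\<le>n. \<kappa> \<le> norm (mart r k w)}"
      \<comment> \<open>The initial value holds only almost surely, so it is made part of the
        event.\<close>
      define A where "A = {w \<in> space \<Omega>. \<Phi> 0 w = r *\<^sub>R x} - B"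
      have B_meas: "B \<in> events" unfolding B_def sets_PP by measurable
      have A0: "{w \<in> space \<Omega>. \<Phi> 0 w = r *\<^sub>R x} \<in> events" unfolding sets_PP by measurable
      have p1: "prob {w \<in> space \<Omega>. \<Phi> 0 w = r *\<^sub>R x} = 1"
        using AE_\<Phi>_0[of "r *\<^sub>R x"] A0 by (subst prob_eq_1) (auto simp: space_PP)
      have "prob B \<le> real n * (2 * M * r powr (-q)) / pseudo_norm \<kappa>"
        unfolding B_def by (rule maximal_inequality[OF r(1) \<kappa> q(1,2) M])
      also have "\<dots> \<le> f r"
        unfolding f_def using n M by (intro divide_right_mono mult_right_mono) (auto simp: pseudo_norm_nonneg)
      finally have "prob B \<le> \<eta>" using elim by linarith
      moreover have "prob A \<ge> prob {w \<in> space \<Omega>. \<Phi> 0 w = r *\<^sub>R x} - prob B"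
      proof -
        have "prob {w \<in> space \<Omega>. \<Phi> 0 w = r *\<^sub>R x} \<le> prob (A \<union> B)"
          using A0 B_meas by (intro finite_measure_mono) (auto simp: A_def)
        also have "\<dots> \<le> prob A + prob B" using A0 B_meas by (intro measure_Un_le) (auto simp: A_def)
        finally show ?thesis by simp
      qed
      ultimately have "prob A \<ge> 1 - \<eta>" using p1 by linarith
      moreover have "A \<in> events" using A0 B_meas by (auto simp: A_def)
      moreover have "scaled_path \<Phi> \<alpha> r w \<in> drift_modulus T (N * r powr (\<alpha> - \<beta>)) \<beta> \<eta>" if w: "w \<in> A" for w
        unfolding drift_modulus_def
      proof (intro CollectI ballI allI impI)
        fix s t \<rho> :: real assume st: "s \<in> {0..T}" "t \<in> {0..T}" and \<rho>: "\<rho> > 0"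
        have S: "norm (mart r k w) \<le> \<kappa>" if "k \<le> n" for k
        proof -
          have "\<not> \<kappa> \<le> norm (mart r k w)" using w that unfolding A_def B_def by blast
          then show ?thesis by simp
        qed
        have rem: "4 * \<kappa> + 2 * (N / r) \<le> \<eta>" using r by (simp add: \<kappa>_def field_simps)
        have "norm (scaled_path \<Phi> \<alpha> r w t - scaled_path \<Phi> \<alpha> r w s)
          \<le> 2 * \<rho> + N * r powr (\<alpha> - \<beta>) * \<rho> powr (-\<beta>) * (t - s) + 4 * \<kappa> + 2 * (N / r)"
          if "0 \<le> s" "s \<le> t" "t \<le> T" for s t
          by (rule scaled_path_increment[OF N r(1) \<beta>(1) S n(1) that \<rho>])
        from this[of s t] this[of t s] rem st
        show "norm (scaled_path \<Phi> \<alpha> r w t - scaled_path \<Phi> \<alpha> r w s)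
          \<le> 2 * \<rho> + N * r powr (\<alpha> - \<beta>) * \<rho> powr (-\<beta>) * \<bar>t - s\<bar> + \<eta>"
          by (cases "s \<le> t") (auto simp: norm_minus_commute)
      qed
      moreover have "\<Phi> 0 w = r *\<^sub>R x" if "w \<in> A" for w using that by (simp add: A_def)
      ultimately show "\<exists>A\<in>events. prob A \<ge> 1 - \<eta> \<and>
        (\<forall>w\<in>A. \<Phi> 0 w = r *\<^sub>R x \<and> scaled_path \<Phi> \<alpha> r w \<in> drift_modulus T (N * r powr (\<alpha> - \<beta>)) \<beta> \<eta>)"
        by blast
    qed
  qed
qed

lemma scaled_path_D_paths: "scaled_path \<Phi> \<alpha> r w \<in> D_paths"
  unfolding scaled_path_eq_step_path by (rule step_path_D_paths) simp

lemma measurable_scaled_path: "scaled_path \<Phi> \<alpha> r \<in> PP x \<rightarrow>\<^sub>M borel_of D_topology"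
  unfolding scaled_path_eq_step_path[abs_def] by (rule measurable_step_path) (simp_all add: measurable_cong_sets[OF sets_PP refl])

lemma fluid_limit_exists:
  assumes B1: "condB1 \<Omega> PP \<Phi> p" and B2: "condB2 PP \<Phi> p \<beta>" and \<alpha>: "0 \<le> \<alpha>" "\<alpha> \<le> \<beta>"
    and r: "filterlim r at_top sequentially" and xs: "xs \<longlonglongrightarrow> x"
  shows "\<exists>Q s. prob_space Q \<and> sets Q = sets (borel_of C_topology) \<and> strict_mono s \<and>
      weak_conv_on D_topology (\<lambda>j. scaled_law PP \<Phi> \<alpha> (r (s j)) (xs (s j)))
        (distr Q (borel_of D_topology) (\<lambda>w. w))"
proof -
  have \<beta>: "0 \<le> \<beta>" "\<beta> < min 1 (p - 1)" using B2 unfolding condB2_def by blast+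
  obtain N where N: "N \<ge> 0" "\<And>x. norm (drift PP \<Phi> x) \<le> N"
    "\<And>x. x \<noteq> 0 \<Longrightarrow> norm (drift PP \<Phi> x) \<le> N * norm x powr (-\<beta>)"
    using condB2_drift[OF B2] by blast
  define \<gamma> where "\<gamma> = 1 / (1 + \<beta>)"
  have \<gamma>: "\<gamma> > 0" "1 - \<beta> * \<gamma> = \<gamma>" using \<beta> by (auto simp: \<gamma>_def field_simps)
  \<comment> \<open>With \<rho> = h^\<gamma> the terms 2\<rho> and N \<rho>^(-\<beta>) h are both
    multiples of h^\<gamma>, with coefficients 2 and N.\<close>
  define \<omega> where "\<omega> h = (2 + N) * h powr \<gamma>" for h :: real
  \<comment> \<open>The radius |x| + 1 contains the starting points \<open>xs n\<close> for all
    large \<open>n\<close>.\<close>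
  interpret path_modulus \<omega> "norm x + 1" "TYPE('a)"
  proof
    show "continuous_on {0..} \<omega>"
      unfolding \<omega>_def using \<gamma>(1) by (intro continuous_intros continuous_on_powr') auto
  qed (use N(1) in \<open>auto simp: \<omega>_def\<close>)
  have "\<exists>Q s. prob_space Q \<and> sets Q = sets (borel_of C_topology) \<and> strict_mono s \<and>
      weak_conv_on D_topology (\<lambda>j. distr (PP (r (s j) *\<^sub>R xs (s j))) (borel_of D_topology) (scaled_path \<Phi> \<alpha> (r (s j))))
        (distr Q (borel_of D_topology) (\<lambda>w. w))"
  proof (rule weak_limit_exists[OF prob_space_PP measurable_scaled_path scaled_path_D_paths])
    show "(\<lambda>w. scaled_path \<Phi> \<alpha> (r n) w t) \<in> borel_measurable (PP (r n *\<^sub>R xs n))" for n t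
      unfolding scaled_path_def by (cases "t \<ge> 0") auto
    fix m :: nat
    have "\<forall>\<^sub>F n in sequentially. dist (xs n) x < 1" using tendstoD[OF xs, of 1] by simp
    \<comment> \<open>This makes \<open>r n\<close> positive and, as \<alpha> <= \<beta>, bounds the
      factor r^(\<alpha>-\<beta>) by 1.\<close>
    moreover have "\<forall>\<^sub>F n in sequentially. r n \<ge> 1" using r by (simp add: filterlim_at_top)
    moreover have "\<forall>\<^sub>F n in sequentially. \<forall>x. \<exists>A\<in>sets (PP (r n *\<^sub>R x)). measure (PP (r n *\<^sub>R x)) A \<ge> 1 - 1 / real (Suc m) \<and>
      (\<forall>w\<in>A. \<Phi> 0 w = r n *\<^sub>R x \<and> scaled_path \<Phi> \<alpha> (r n) w \<in> drift_modulus (real m) (N * (r n) powr (\<alpha> - \<beta>)) \<beta> (1 / real (Suc m)))"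
      by (rule eventually_compose_filterlim[OF scaled_path_good_event[OF B1 \<beta> \<alpha> N] r]) auto
    ultimately show "\<forall>\<^sub>F n in sequentially. \<exists>A\<in>sets (PP (r n *\<^sub>R xs n)).
      measure (PP (r n *\<^sub>R xs n)) A \<ge> 1 - 1 / real (Suc m) \<and> (\<forall>w\<in>A. scaled_path \<Phi> \<alpha> (r n) w \<in> nearly m)"
    proof eventually_elim
      case (elim n)
      then obtain A where A: "A \<in> sets (PP (r n *\<^sub>R xs n))" "measure (PP (r n *\<^sub>R xs n)) A \<ge> 1 - 1 / real (Suc m)"
        and \<Phi>0: "\<And>w. w \<in> A \<Longrightarrow> \<Phi> 0 w = r n *\<^sub>R xs n"
        and inc: "\<And>w. w \<in> A \<Longrightarrow> scaled_path \<Phi> \<alpha> (r n) w \<in> drift_modulus (real m) (N * (r n) powr (\<alpha> - \<beta>)) \<beta> (1 / real (Suc m))"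
        by blast
      have "scaled_path \<Phi> \<alpha> (r n) w \<in> nearly m" if w: "w \<in> A" for w
        unfolding nearly_def
      proof (intro CollectI conjI ballI)
        have "norm (xs n) \<le> norm x + dist (xs n) x"
          using norm_triangle_sub[of "xs n" x] by (simp add: dist_norm)
        then show "norm (scaled_path \<Phi> \<alpha> (r n) w 0) \<le> norm x + 1"
          using elim \<Phi>0[OF w] by (simp add: scaled_path_def)
        fix s t assume st: "s \<in> {0..real m}" "t \<in> {0..real m}"
        show "norm (scaled_path \<Phi> \<alpha> (r n) w t - scaled_path \<Phi> \<alpha> (r n) w s) \<le> \<omega> \<bar>t - s\<bar> + 1 / real (Suc m)"
        proof (cases "s = t")
          case False
          define h where "h = \<bar>t - s\<bar>"
          have h: "h > 0" using False by (simp add: h_def)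
          have "norm (scaled_path \<Phi> \<alpha> (r n) w t - scaled_path \<Phi> \<alpha> (r n) w s)
            \<le> 2 * h powr \<gamma> + N * (r n) powr (\<alpha> - \<beta>) * (h powr \<gamma>) powr (-\<beta>) * h + 1 / real (Suc m)"
            unfolding h_def by (rule drift_modulusD[OF inc[OF w] st]) (use h in \<open>simp add: h_def\<close>)
          moreover have "N * (r n) powr (\<alpha> - \<beta>) * (h powr \<gamma>) powr (-\<beta>) * h \<le> N * 1 * (h powr \<gamma>) powr (-\<beta>) * h"
          proof (intro mult_right_mono mult_left_mono)
            have "(r n) powr (\<alpha> - \<beta>) \<le> (r n) powr 0" using elim(2) \<alpha> by (intro powr_mono) auto
            then show "(r n) powr (\<alpha> - \<beta>) \<le> 1" using elim(2) by simp
          qed (use N(1) h in auto)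
          moreover have "(h powr \<gamma>) powr (-\<beta>) * h = h powr \<gamma>"
          proof -
            have "(h powr \<gamma>) powr (-\<beta>) * h = h powr (- (\<beta> * \<gamma>)) * h powr 1"
              using h by (simp add: powr_powr mult.commute)
            also have "\<dots> = h powr (1 - \<beta> * \<gamma>)"
              unfolding powr_add[symmetric] by simp
            finally show ?thesis unfolding \<gamma>(2) .
          qed
          ultimately show ?thesis unfolding \<omega>_def h_def[symmetric] by (simp add: algebra_simps)
        qed (use \<omega>_nonneg in simp)
      qed
      with A show ?case by blast
    qed
  qed
  then show ?thesis unfolding scaled_law_def .
qed

text \<open>\<open>const_dev x\<close> is a bounded continuous test function that vanishes only at
  the constant path. Its mean along the scaled laws tends to 0, so it is 0 almost surely under
  \<open>Q\<close>.\<close>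

lemma fluid_limit_trivial:
  assumes B1: "condB1 \<Omega> PP \<Phi> p" and B2: "condB2 PP \<Phi> p \<beta>" and \<alpha>: "0 \<le> \<alpha>" "\<alpha> < \<beta>"
    and Q: "fluid_limit PP \<Phi> \<alpha> x Q"
  shows "Q = return (borel_of D_topology) (\<lambda>t\<in>{0..}. x)"
proof -
  have \<beta>: "0 \<le> \<beta>" "\<beta> < min 1 (p - 1)" using B2 unfolding condB2_def by blast+
  obtain N where N: "N \<ge> 0" "\<And>x. norm (drift PP \<Phi> x) \<le> N"
    "\<And>x. x \<noteq> 0 \<Longrightarrow> norm (drift PP \<Phi> x) \<le> N * norm x powr (-\<beta>)"
    using condB2_drift[OF B2] by blast
  from Q obtain r xs where "prob_space Q" and sQ[measurable_cong]: "sets Q = sets (borel_of D_topology)"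
    and r: "\<And>n. 0 < r n" "filterlim r at_top sequentially" and xs: "xs \<longlonglongrightarrow> x"
    and conv: "weak_conv_on D_topology (\<lambda>n. scaled_law PP \<Phi> \<alpha> (r n) (xs n)) Q"
    unfolding fluid_limit_def by blast
  interpret Q: prob_space Q by fact
  have [measurable]: "const_dev x \<in> borel_of D_topology \<rightarrow>\<^sub>M borel"
    by (rule measurable_C_map_real[OF continuous_map_const_dev])
  note measurable_scaled_path[measurable]
  have "bounded (const_dev x ` topspace D_topology)"
    unfolding bounded_iff by (intro exI[of _ 1]) (simp add: abs_of_nonneg const_dev_bounds)
  with conv have "(\<lambda>n. \<integral>w. const_dev x w \<partial>scaled_law PP \<Phi> \<alpha> (r n) (xs n)) \<longlonglongrightarrow> (\<integral>w. const_dev x w \<partial>Q)"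
    unfolding weak_conv_on_def using continuous_map_const_dev by blast
  moreover have "(\<integral>w. const_dev x w \<partial>scaled_law PP \<Phi> \<alpha> (r n) (xs n)) =
      (\<integral>w. const_dev x (scaled_path \<Phi> \<alpha> (r n) w) \<partial>PP (r n *\<^sub>R xs n))" for n
    unfolding scaled_law_def by (rule integral_distr) measurable
  ultimately have lim: "(\<lambda>n. \<integral>w. const_dev x (scaled_path \<Phi> \<alpha> (r n) w) \<partial>PP (r n *\<^sub>R xs n)) \<longlonglongrightarrow> (\<integral>w. const_dev x w \<partial>Q)"
    by simp
  have "(\<lambda>n. \<integral>w. const_dev x (scaled_path \<Phi> \<alpha> (r n) w) \<partial>PP (r n *\<^sub>R xs n)) \<longlonglongrightarrow> 0"
  proof (rule tendstoI)
    fix e' :: real assume "e' > 0"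
    \<comment> \<open>The good event contributes at most \<open>e\<close> and its complement at most
      e/4, so the total stays below e'.\<close>
    define e where "e = e' / 3"
    have e: "e > 0" using \<open>e' > 0\<close> by (simp add: e_def)
    define T where "T = 1 / e"
    have T: "0 \<le> T" "1 / (1 + T) \<le> e" using e by (auto simp: T_def field_simps)
    \<comment> \<open>Four contributions of at most e/4 each: 2\<rho>, the drift term, the error
      \<eta> of the modulus, and the distance from \<open>xs n\<close> to \<open>x\<close>.\<close>
    define \<rho> where "\<rho> = e / 8"
    define \<eta> where "\<eta> = e / 4"
    have \<rho>: "\<rho> > 0" and \<eta>: "\<eta> > 0" using e by (auto simp: \<rho>_def \<eta>_def)
    have "((\<lambda>r. N * r powr (\<alpha> - \<beta>) * \<rho> powr (-\<beta>) * T) \<longlongrightarrow> N * 0 * \<rho> powr (-\<beta>) * T) at_top"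
      using \<alpha> by (intro tendsto_intros tendsto_neg_powr filterlim_ident) auto
    then have "\<forall>\<^sub>F r in at_top. N * r powr (\<alpha> - \<beta>) * \<rho> powr (-\<beta>) * T < \<eta>"
      by (rule order_tendstoD) (use \<eta> in simp)
    then have "\<forall>\<^sub>F n in sequentially. N * r n powr (\<alpha> - \<beta>) * \<rho> powr (-\<beta>) * T < \<eta>"
      using r(2) by (rule eventually_compose_filterlim)
    moreover have "\<forall>\<^sub>F n in sequentially. dist (xs n) x < \<eta>" using tendstoD[OF xs \<eta>] .
    moreover have "\<forall>\<^sub>F n in sequentially. \<forall>x. \<exists>A\<in>sets (PP (r n *\<^sub>R x)). measure (PP (r n *\<^sub>R x)) A \<ge> 1 - \<eta> \<and>
      (\<forall>w\<in>A. \<Phi> 0 w = r n *\<^sub>R x \<and> scaled_path \<Phi> \<alpha> (r n) w \<in> drift_modulus T (N * (r n) powr (\<alpha> - \<beta>)) \<beta> \<eta>)"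
      by (rule eventually_compose_filterlim[OF scaled_path_good_event[OF B1 \<beta> \<alpha>(1) less_imp_le[OF \<alpha>(2)] N T(1) \<eta>] r(2)])
    ultimately show "\<forall>\<^sub>F n in sequentially.
      dist (\<integral>w. const_dev x (scaled_path \<Phi> \<alpha> (r n) w) \<partial>PP (r n *\<^sub>R xs n)) 0 < e'"
    proof eventually_elim
      case (elim n)
      interpret prob_space "PP (r n *\<^sub>R xs n)" by (rule prob_space_PP)
      from elim(3) obtain A where A[measurable]: "A \<in> events" "prob A \<ge> 1 - \<eta>"
        and \<Phi>0: "\<And>w. w \<in> A \<Longrightarrow> \<Phi> 0 w = r n *\<^sub>R xs n"
        and inc: "\<And>w. w \<in> A \<Longrightarrow> scaled_path \<Phi> \<alpha> (r n) w \<in> drift_modulus T (N * (r n) powr (\<alpha> - \<beta>)) \<beta> \<eta>"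
        by blast
      let ?Y = "scaled_path \<Phi> \<alpha> (r n)"
      have good: "const_dev x (?Y w) \<le> e" if w: "w \<in> A" for w
      proof (rule const_dev_small[OF T])
        fix t assume t: "t \<in> {0..T}"
        have "?Y w 0 = xs n" using \<Phi>0[OF w] r(1)[of n] by (simp add: scaled_path_def)
        then have "norm (?Y w t - xs n) \<le> 2 * \<rho> + N * (r n) powr (\<alpha> - \<beta>) * \<rho> powr (-\<beta>) * t + \<eta>"
          using drift_modulusD[OF inc[OF w] _ t \<rho>, of 0] t by simp
        moreover have "N * (r n) powr (\<alpha> - \<beta>) * \<rho> powr (-\<beta>) * t \<le> N * (r n) powr (\<alpha> - \<beta>) * \<rho> powr (-\<beta>) * T"
          using t N(1) by (intro mult_left_mono) auto
        moreover have "dist (?Y w t) x \<le> norm (?Y w t - xs n) + dist (xs n) x"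
          using dist_triangle[of "?Y w t" x "xs n"] by (simp add: dist_norm)
        ultimately show "dist (?Y w t) x \<le> e" using elim(1,2) unfolding \<rho>_def \<eta>_def by linarith
      qed
      have "(\<integral>w. const_dev x (?Y w) \<partial>PP (r n *\<^sub>R xs n)) \<le>
        (\<integral>w. e + indicator (space (PP (r n *\<^sub>R xs n)) - A) w \<partial>PP (r n *\<^sub>R xs n))"
      proof (rule integral_mono)
        show "integrable (PP (r n *\<^sub>R xs n)) (\<lambda>w. const_dev x (?Y w))"
          by (rule integrable_const_bound[where B=1]) (simp_all add: abs_of_nonneg const_dev_bounds)
        show "integrable (PP (r n *\<^sub>R xs n)) (\<lambda>w. e + indicator (space (PP (r n *\<^sub>R xs n)) - A) w)"
          by (intro Bochner_Integration.integrable_add integrable_real_indicator) (auto simp: emeasure_eq_measure)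
        fix w assume "w \<in> space (PP (r n *\<^sub>R xs n))"
        then show "const_dev x (?Y w) \<le> e + indicator (space (PP (r n *\<^sub>R xs n)) - A) w"
          using good[of w] const_dev_bounds(2)[of x "?Y w"] e by (cases "w \<in> A") auto
      qed
      also have "\<dots> = e + (1 - prob A)" by (simp add: prob_space prob_compl emeasure_eq_measure)
      also have "\<dots> < e'" using A(2) e unfolding \<eta>_def by (simp add: e_def)
      finally have "(\<integral>w. const_dev x (?Y w) \<partial>PP (r n *\<^sub>R xs n)) < e'" .
      moreover have "(\<integral>w. const_dev x (?Y w) \<partial>PP (r n *\<^sub>R xs n)) \<ge> 0" by (simp add: const_dev_bounds)
      ultimately show ?case by (simp add: dist_real_def)
    qed
  qed
  with lim have "(\<integral>w. const_dev x w \<partial>Q) = 0" by (rule LIMSEQ_unique)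
  moreover have "integrable Q (const_dev x)"
    by (rule Q.integrable_const_bound[where B=1]) (simp_all add: abs_of_nonneg const_dev_bounds)
  ultimately have "AE w in Q. const_dev x w = 0"
    by (subst (asm) integral_nonneg_eq_0_iff_AE) (auto simp: const_dev_bounds)
  then have AE: "AE w in Q. w = (\<lambda>t\<in>{0..}. x)"
    using AE_space[of Q]
  proof eventually_elim
    case (elim w)
    then show ?case
      using sets_eq_imp_space_eq[OF sQ] by (intro const_dev_eq_0) (auto simp: D_paths_def)
  qed
  show ?thesis
  proof (rule measure_eqI)
    show "sets Q = sets (return (borel_of D_topology) (\<lambda>t\<in>{0..}. x))" using sQ by simp
    fix A assume A[measurable]: "A \<in> sets Q"
    show "emeasure Q A = emeasure (return (borel_of D_topology) (\<lambda>t\<in>{0..}. x)) A"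
    proof (cases "(\<lambda>t\<in>{0..}. x) \<in> A")
      case True
      have "AE w in Q. w \<in> A" using AE by eventually_elim (use True in simp)
      with A have "emeasure Q A = 1" by (intro Q.emeasure_eq_1_AE)
      with True A sQ show ?thesis by simp
    next
      case False
      have "AE w in Q. w \<notin> A" using AE by eventually_elim (use False in simp)
      then have "emeasure Q A = 0" using AE_iff_measurable[OF A, of "\<lambda>w. w \<notin> A"] sets.sets_into_space[OF A] by auto
      with False A sQ show ?thesis by simp
    qed
  qed
qed

end

theorem theorem1p2:
  fixes P :: "'a::euclidean_space \<Rightarrow> 'a measure"
    and \<Omega> :: "'w measure"
    and PP :: "'a \<Rightarrow> 'w measure"
    and \<Phi> :: "nat \<Rightarrow> 'w \<Rightarrow> 'a"
    and p \<beta> :: real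
  assumes "markov_chain P \<Omega> PP \<Phi>"
    and "\<And>x. integrable (PP x) (\<Phi> 1)"
    and "condB1 \<Omega> PP \<Phi> p"
    and "condB2 PP \<Phi> p \<beta>"
  shows "(\<forall>\<alpha> r xs x. 0 \<le> \<alpha> \<and> \<alpha> \<le> \<beta> \<and> (\<forall>n. 0 \<le> r n) \<and>
             filterlim r at_top sequentially \<and> xs \<longlonglongrightarrow> x \<longrightarrow>
           (\<exists>Q s. prob_space Q \<and> sets Q = sets (borel_of C_topology) \<and> strict_mono s \<and>
              weak_conv_on D_topology
                (\<lambda>j. scaled_law PP \<Phi> \<alpha> (r (s j)) (xs (s j)))
                (distr Q (borel_of D_topology) (\<lambda>w. w)))) \<and>
         (\<forall>\<alpha> x Q. 0 \<le> \<alpha> \<and> \<alpha> < \<beta> \<and> fluid_limit PP \<Phi> \<alpha> x Q \<longrightarrow>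
           Q = return (borel_of D_topology) (\<lambda>t\<in>{0..}. x))"
proof -
  interpret integrable_chain P \<Omega> PP \<Phi> using assms(1,2) by unfold_locales
  show ?thesis
    using fluid_limit_exists[OF assms(3,4)] fluid_limit_trivial[OF assms(3,4)] by blast
qed

end
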